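(* Suppose $a$ is finite, that for some $c\in(a,b)$ the spectra $\sigma(H^D_{(a,c)})=\{\mu_j(c)\}_{j\in\mathbb{N}}$ and $\sigma(H^N_{(a,c)})=\{\nu_j(c)\}_{j\in\mathbb{N}_0}$ are purely discrete and bounded below, that (i) for all $s>\frac12$ one has $\sum_{j\in\mathbb{N}}\frac{1}{1+|\mu_j(c)|^s}<\infty$, and (ii) for some $r>0$ and all sufficiently large $j$, $$\mu_j(c)-\nu_{j-1}(c)\ge\frac{1}{\nu_{j-1}(c)^r}+\frac{1}{\mu_j(c)^r},\qquad \nu_j(c)-\mu_j(c)\ge\frac{1}{\nu_j(c)^r}+\frac{1}{\mu_j(c)^r}.$$ Let $\phi(z,x)=\alpha(z)c(z,x)+\beta(z)s(z,x)$ be the (unique up to a constant) real entire solution of $\tau u=zu$ of growth order $\frac12$ which is nontrivial for every $z$ and lies in the domain of $H$ near $a$. Then for every $s>\frac12$ there is a second solution $\theta(z,x)=\gamma(z)c(z,x)+\delta(z)s(z,x)$ of $\tau u=zu$, with $\gamma,\delta$ real entire without common zeros and $W(\theta(z),\phi(z))=\gamma(z)\beta(z)-\alpha(z)\delta(z)=1$, such that $\gamma,\delta\in R_s(\mathbb{C})$. In particular, $\theta(\cdot,x)\in R_s(\mathbb{C})$ in this case.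
   Context: Let $-\infty\le a<b\le\infty$, let $q\in L^1_{\mathrm{loc}}(a,b)$ be real-valued, $\tau=-\frac{d^2}{dx^2}+q$, and let $H$ be a self-adjoint operator in $L^2(a,b)$ associated with $\tau$ with separated boundary conditions at $a$ and/or $b$. A solution lies in the domain of $H$ near $a$ if it is square integrable near $a$ and satisfies the boundary condition of $H$ at $a$ in case $\tau$ is limit circle at $a$. $H^D_{(a,c)}$ and $H^N_{(a,c)}$ are the restrictions of $H$ to $(a,c)$ with Dirichlet, respectively Neumann, boundary condition at $c$; eigenvalues are listed increasingly and interlace: $\nu_0(c)<\mu_1(c)<\nu_1(c)<\mu_2(c)<\cdots$. $c(z,x)$, $s(z,x)$ solve $\tau u=zu$ with $c(z,c)=1$, $c'(z,c)=0$, $s(z,c)=0$, $s'(z,c)=1$. $W(u,v)=uv'-u'v$. Real entire means entire in $z$ and real for real $z$. For $s>0$, $R_s(\mathbb{C})$ is the ring of all entire functions $f$ for which there are constants $A,B>0$ with $|f(z)|\le B\exp(A|z|^s)$ for all $z\in\mathbb{C}$. *)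

theory Defs
  imports "HOL-Complex_Analysis.Complex_Analysis"
begin

section \<open>The Hilbert space \<open>L\<^sup>2(I)\<close>\<close>

text \<open>
  Elements of \<open>L\<^sup>2(I)\<close> are given by representatives \<open>f :: real \<Rightarrow> complex\<close>; only their values
  on \<open>I\<close> matter, and equality is equality almost everywhere on \<open>I\<close>.
\<close>

definition L2 :: "real set \<Rightarrow> (real \<Rightarrow> complex) set" where
  "L2 I = {f. f \<in> borel_measurable (lebesgue_on I) \<and>
              integrable (lebesgue_on I) (\<lambda>x. (cmod (f x))\<^sup>2)}"

definition L2_inner :: "real set \<Rightarrow> (real \<Rightarrow> complex) \<Rightarrow> (real \<Rightarrow> complex) \<Rightarrow> complex" where
  "L2_inner I f g = (LINT x|lebesgue_on I. cnj (f x) * g x)"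

definition L2_norm :: "real set \<Rightarrow> (real \<Rightarrow> complex) \<Rightarrow> real" where
  "L2_norm I f = sqrt (LINT x|lebesgue_on I. (cmod (f x))\<^sup>2)"

definition ae_eq :: "real set \<Rightarrow> (real \<Rightarrow> complex) \<Rightarrow> (real \<Rightarrow> complex) \<Rightarrow> bool" where
  "ae_eq I f g \<longleftrightarrow> (AE x in lebesgue_on I. f x = g x)"


section \<open>Unbounded operators in \<open>L\<^sup>2(I)\<close>\<close>

text \<open>
  An operator \<open>T\<close> is represented by its graph, that is, by the set of all pairs \<open>(f, h)\<close> where
  \<open>f\<close> represents an element of the domain of \<open>T\<close> and \<open>h\<close> represents \<open>T f\<close>.
\<close>

type_synonym op_graph = "((real \<Rightarrow> complex) \<times> (real \<Rightarrow> complex)) set"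

definition densely_defined :: "real set \<Rightarrow> op_graph \<Rightarrow> bool" where
  "densely_defined I T \<longleftrightarrow>
     (\<forall>g\<in>L2 I. \<forall>\<epsilon>>0. \<exists>(f, h)\<in>T. L2_norm I (\<lambda>x. f x - g x) < \<epsilon>)"

definition adjoint_graph :: "real set \<Rightarrow> op_graph \<Rightarrow> op_graph" where
  "adjoint_graph I T =
     {(g, k). g \<in> L2 I \<and> k \<in> L2 I \<and> (\<forall>(f, h)\<in>T. L2_inner I g h = L2_inner I k f)}"

definition self_adjoint :: "real set \<Rightarrow> op_graph \<Rightarrow> bool" where
  "self_adjoint I T \<longleftrightarrow> densely_defined I T \<and>
     (\<forall>g k. (g, k) \<in> adjoint_graph I T \<longleftrightarrow> (\<exists>(f, h)\<in>T. ae_eq I g f \<and> ae_eq I k h))"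

text \<open>
  \<open>z\<close> is in the resolvent set iff \<open>T - z\<close> maps the domain of \<open>T\<close> onto \<open>L\<^sup>2(I)\<close> and has a bounded
  inverse; injectivity of \<open>T - z\<close> is contained in the norm estimate.
\<close>

definition resolvent_set :: "real set \<Rightarrow> op_graph \<Rightarrow> complex set" where
  "resolvent_set I T =
     {z. (\<forall>g\<in>L2 I. \<exists>(f, h)\<in>T. ae_eq I (\<lambda>x. h x - z * f x) g) \<and>
         (\<exists>C. \<forall>(f, h)\<in>T. L2_norm I f \<le> C * L2_norm I (\<lambda>x. h x - z * f x))}"

definition spectrum :: "real set \<Rightarrow> op_graph \<Rightarrow> complex set" where
  "spectrum I T = - resolvent_set I T"

definition eigenspace :: "real set \<Rightarrow> op_graph \<Rightarrow> complex \<Rightarrow> (real \<Rightarrow> complex) set" where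
  "eigenspace I T z = {f. \<exists>h. (f, h) \<in> T \<and> ae_eq I h (\<lambda>x. z * f x)}"

definition eigenvalue :: "real set \<Rightarrow> op_graph \<Rightarrow> complex \<Rightarrow> bool" where
  "eigenvalue I T z \<longleftrightarrow> (\<exists>f\<in>eigenspace I T z. \<not> ae_eq I f (\<lambda>_. 0))"

definition finite_dim_ae :: "real set \<Rightarrow> (real \<Rightarrow> complex) set \<Rightarrow> bool" where
  "finite_dim_ae I V \<longleftrightarrow>
     (\<exists>B. finite B \<and> (\<forall>f\<in>V. \<exists>k. ae_eq I f (\<lambda>x. \<Sum>g\<in>B. k g * g x)))"

definition discrete_spectrum :: "real set \<Rightarrow> op_graph \<Rightarrow> complex set" where
  "discrete_spectrum I T =
     {z. eigenvalue I T z \<and> z isolated_in spectrum I T \<and> finite_dim_ae I (eigenspace I T z)}"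

definition purely_discrete :: "real set \<Rightarrow> op_graph \<Rightarrow> bool" where
  "purely_discrete I T \<longleftrightarrow> spectrum I T = discrete_spectrum I T"


section \<open>The differential expression \<open>\<tau> = -d\<^sup>2/dx\<^sup>2 + q\<close>\<close>

definition L1_loc :: "real set \<Rightarrow> (real \<Rightarrow> real) \<Rightarrow> bool" where
  "L1_loc I q \<longleftrightarrow> (\<forall>x\<in>I. \<forall>y\<in>I. q absolutely_integrable_on {x..y})"

text \<open>
  \<open>f\<close> is locally absolutely continuous on the interval \<open>I\<close>, with derivative \<open>g\<close> almost everywhere.
\<close>

definition AC_loc_deriv :: "real set \<Rightarrow> (real \<Rightarrow> complex) \<Rightarrow> (real \<Rightarrow> complex) \<Rightarrow> bool" where
  "AC_loc_deriv I f g \<longleftrightarrow>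
     (\<forall>x\<in>I. \<forall>y\<in>I. x \<le> y \<longrightarrow>
        g absolutely_integrable_on {x..y} \<and> f y - f x = integral {x..y} g)"

text \<open>
  \<open>f, f'\<close> are locally absolutely continuous on the open interval \<open>I\<close> and \<open>\<tau> f = h\<close> almost
  everywhere. As \<open>f'\<close> is then continuous, \<open>f\<close> is differentiable everywhere on \<open>I\<close>.
\<close>

definition tau_rel ::
    "real set \<Rightarrow> (real \<Rightarrow> real) \<Rightarrow> (real \<Rightarrow> complex) \<Rightarrow> (real \<Rightarrow> complex) \<Rightarrow> bool" where
  "tau_rel I q f h \<longleftrightarrow>
     (\<exists>f1 f2. (\<forall>x\<in>I. (f has_vector_derivative f1 x) (at x)) \<and>
              AC_loc_deriv I f1 f2 \<and>
              ae_eq I h (\<lambda>x. - f2 x + of_real (q x) * f x))"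

definition solution :: "real set \<Rightarrow> (real \<Rightarrow> real) \<Rightarrow> complex \<Rightarrow> (real \<Rightarrow> complex) \<Rightarrow> bool" where
  "solution I q z u \<longleftrightarrow> tau_rel I q u (\<lambda>x. z * u x)"

definition ivp_solution ::
    "real set \<Rightarrow> (real \<Rightarrow> real) \<Rightarrow> complex \<Rightarrow> real \<Rightarrow> complex \<Rightarrow> complex \<Rightarrow> (real \<Rightarrow> complex) \<Rightarrow> bool"
  where
  "ivp_solution I q z c v0 v1 u \<longleftrightarrow>
     solution I q z u \<and> u c = v0 \<and> (u has_vector_derivative v1) (at c)"

definition wronskian :: "(real \<Rightarrow> complex) \<Rightarrow> (real \<Rightarrow> complex) \<Rightarrow> real \<Rightarrow> complex" where
  "wronskian u v x =
     u x * vector_derivative v (at x) - vector_derivative u (at x) * v x"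

definition max_graph :: "real set \<Rightarrow> (real \<Rightarrow> real) \<Rightarrow> op_graph" where
  "max_graph I q = {(f, h). f \<in> L2 I \<and> h \<in> L2 I \<and> tau_rel I q f h}"

definition max_dom :: "real set \<Rightarrow> (real \<Rightarrow> real) \<Rightarrow> (real \<Rightarrow> complex) set" where
  "max_dom I q = fst ` max_graph I q"


section \<open>Separated boundary conditions\<close>

definition L2_near_left :: "ereal \<Rightarrow> ereal \<Rightarrow> (real \<Rightarrow> complex) \<Rightarrow> bool" where
  "L2_near_left a b f \<longleftrightarrow> (\<exists>d\<in>einterval a b. f \<in> L2 (einterval a (ereal d)))"

definition L2_near_right :: "ereal \<Rightarrow> ereal \<Rightarrow> (real \<Rightarrow> complex) \<Rightarrow> bool" where
  "L2_near_right a b f \<longleftrightarrow> (\<exists>d\<in>einterval a b. f \<in> L2 (einterval (ereal d) b))"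

text \<open>
  By the Weyl alternative it does not matter whether the following conditions are imposed for one
  or for all \<open>z\<close>.
\<close>

definition limit_circle_left :: "ereal \<Rightarrow> ereal \<Rightarrow> (real \<Rightarrow> real) \<Rightarrow> bool" where
  "limit_circle_left a b q \<longleftrightarrow>
     (\<forall>z u. solution (einterval a b) q z u \<longrightarrow> L2_near_left a b u)"

definition limit_circle_right :: "ereal \<Rightarrow> ereal \<Rightarrow> (real \<Rightarrow> real) \<Rightarrow> bool" where
  "limit_circle_right a b q \<longleftrightarrow>
     (\<forall>z u. solution (einterval a b) q z u \<longrightarrow> L2_near_right a b u)"

text \<open>
  At a limit circle endpoint a boundary condition is given by some \<open>v\<close> in the maximal domain, and
  reads \<open>W(v, f) = 0\<close> at that endpoint; \<open>v\<close> has to satisfy \<open>W(v\<^sup>*, v) = 0\<close> there and the condition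
  must not be void.
\<close>

definition wronskian_zero_left ::
    "ereal \<Rightarrow> (real \<Rightarrow> complex) \<Rightarrow> (real \<Rightarrow> complex) \<Rightarrow> bool" where
  "wronskian_zero_left a v f \<longleftrightarrow>
     ((\<lambda>x. wronskian v f (real_of_ereal x)) \<longlongrightarrow> 0) (at_right a)"

definition wronskian_zero_right ::
    "ereal \<Rightarrow> (real \<Rightarrow> complex) \<Rightarrow> (real \<Rightarrow> complex) \<Rightarrow> bool" where
  "wronskian_zero_right b v f \<longleftrightarrow>
     ((\<lambda>x. wronskian v f (real_of_ereal x)) \<longlongrightarrow> 0) (at_left b)"

definition boundary_function_left ::
    "ereal \<Rightarrow> ereal \<Rightarrow> (real \<Rightarrow> real) \<Rightarrow> (real \<Rightarrow> complex) \<Rightarrow> bool" where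
  "boundary_function_left a b q v \<longleftrightarrow>
     v \<in> max_dom (einterval a b) q \<and> wronskian_zero_left a (\<lambda>x. cnj (v x)) v \<and>
     (\<exists>f\<in>max_dom (einterval a b) q. \<not> wronskian_zero_left a v f)"

definition boundary_function_right ::
    "ereal \<Rightarrow> ereal \<Rightarrow> (real \<Rightarrow> real) \<Rightarrow> (real \<Rightarrow> complex) \<Rightarrow> bool" where
  "boundary_function_right a b q w \<longleftrightarrow>
     w \<in> max_dom (einterval a b) q \<and> wronskian_zero_right b (\<lambda>x. cnj (w x)) w \<and>
     (\<exists>f\<in>max_dom (einterval a b) q. \<not> wronskian_zero_right b w f)"

definition bc_left ::
    "ereal \<Rightarrow> ereal \<Rightarrow> (real \<Rightarrow> real) \<Rightarrow> (real \<Rightarrow> complex) \<Rightarrow> (real \<Rightarrow> complex) \<Rightarrow> bool" where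
  "bc_left a b q v f \<longleftrightarrow> (limit_circle_left a b q \<longrightarrow> wronskian_zero_left a v f)"

definition bc_right ::
    "ereal \<Rightarrow> ereal \<Rightarrow> (real \<Rightarrow> real) \<Rightarrow> (real \<Rightarrow> complex) \<Rightarrow> (real \<Rightarrow> complex) \<Rightarrow> bool" where
  "bc_right a b q w f \<longleftrightarrow> (limit_circle_right a b q \<longrightarrow> wronskian_zero_right b w f)"

definition H_op ::
    "ereal \<Rightarrow> ereal \<Rightarrow> (real \<Rightarrow> real) \<Rightarrow> (real \<Rightarrow> complex) \<Rightarrow> (real \<Rightarrow> complex) \<Rightarrow> op_graph" where
  "H_op a b q v w =
     {(f, h)\<in>max_graph (einterval a b) q. bc_left a b q v f \<and> bc_right a b q w f}"

definition near_left_dom ::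
    "ereal \<Rightarrow> ereal \<Rightarrow> (real \<Rightarrow> real) \<Rightarrow> (real \<Rightarrow> complex) \<Rightarrow> (real \<Rightarrow> complex) \<Rightarrow> bool" where
  "near_left_dom a b q v u \<longleftrightarrow> L2_near_left a b u \<and> bc_left a b q v u"

text \<open>
  The restrictions of \<open>H\<close> to \<open>(a, c)\<close> keep the boundary condition of \<open>H\<close> at \<open>a\<close>. The endpoint \<open>c\<close>
  is regular, so the one-sided limits at \<open>c\<close> of \<open>f\<close> and \<open>f'\<close> exist on the maximal domain.
\<close>

definition HD_left ::
    "ereal \<Rightarrow> ereal \<Rightarrow> (real \<Rightarrow> real) \<Rightarrow> (real \<Rightarrow> complex) \<Rightarrow> real \<Rightarrow> op_graph" where
  "HD_left a b q v c =
     {(f, h)\<in>max_graph (einterval a (ereal c)) q. bc_left a b q v f \<and>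
        (f \<longlongrightarrow> 0) (at_left c)}"

definition HN_left ::
    "ereal \<Rightarrow> ereal \<Rightarrow> (real \<Rightarrow> real) \<Rightarrow> (real \<Rightarrow> complex) \<Rightarrow> real \<Rightarrow> op_graph" where
  "HN_left a b q v c =
     {(f, h)\<in>max_graph (einterval a (ereal c)) q. bc_left a b q v f \<and>
        ((\<lambda>x. vector_derivative f (at x)) \<longlongrightarrow> 0) (at_left c)}"


section \<open>Entire functions\<close>

definition real_entire :: "(complex \<Rightarrow> complex) \<Rightarrow> bool" where
  "real_entire f \<longleftrightarrow> f holomorphic_on UNIV \<and> (\<forall>x::real. f (of_real x) \<in> \<real>)"

text \<open>The value for constant functions is \<open>0\<close>.\<close>

definition growth_order :: "(complex \<Rightarrow> complex) \<Rightarrow> ereal" where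
  "growth_order f =
     Limsup at_top (\<lambda>r::real. ereal (ln (ln (SUP z\<in>sphere 0 r. cmod (f z))) / ln r))"

definition R_ring :: "real \<Rightarrow> (complex \<Rightarrow> complex) set" where
  "R_ring s = {f. f holomorphic_on UNIV \<and>
     (\<exists>A>0. \<exists>B>0. \<forall>z. cmod (f z) \<le> B * exp (A * cmod z powr s))}"

end

theory Submission
  imports Defs
begin

text \<open>
  If \<open>\<alpha> z = 0\<close> then \<open>\<phi> z\<close> is a Dirichlet eigenfunction on \<open>(a, c)\<close>, so the zeros of \<open>\<alpha>\<close> are among the
  \<open>\<mu>\<^sub>j\<close>, and likewise those of \<open>\<beta>\<close> among the \<open>\<nu>\<^sub>j\<close>; neither the converse nor the simplicity of the
  zeros is needed. A minimum modulus estimate bounds a function of order below \<open>s\<close> from below by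
  \<open>exp (- K (1 + |z|)\<^sup>s)\<close> outside discs of polynomially small radius about its zeros, and by the
  separation hypothesis the discs about the \<open>\<mu>\<^sub>j\<close> avoid each other and the zeros of \<open>\<beta>\<close>. Then
  \<open>\<gamma>\<close> is \<open>\<alpha>\<close> times a Mittag-Leffler series with the principal parts of \<open>1 / (\<alpha> \<beta>)\<close> at the zeros of
  \<open>\<alpha>\<close>, and \<open>\<delta> = (\<gamma> \<beta> - 1) / \<alpha>\<close> is entire; its growth is controlled off the discs by the minimum
  modulus estimate and inside them by the maximum principle.
\<close>

section \<open>Minimum modulus of entire functions\<close>

text \<open>At a zero of \<alpha> of multiplicity m the equation forces
  \<open>\<gamma> \<beta> = 1\<close> up to order m, and every entire \<gamma> with this property
  yields an entire \<delta>; the difficulty is growth alone. Lower bounds on small circles leave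
  principal parts as large as \<open>exp (K |p|^s)\<close>, so their plain sum need not converge; a
  convergence factor per zero repairs this.

  Two features keep the exponent at s. A minimum modulus estimate loses a factor of order log (1 /
  radius) in the exponent; for polynomially small radii this is O(log |z|), paid for by an
  intermediate exponent t with 1/2 < t < s. Moreover each term of the series keeps the factor
  |\<alpha>(z)| outside its disc. Hence the other terms do not disturb the interpolation at a given
  zero, and in \<open>\<delta> = (\<gamma> \<beta> - 1) / \<alpha>\<close> the quotient \<gamma> /
  \<alpha> is bounded directly, leaving only 1 / \<alpha> to the minimum modulus.

  The base point of that estimate is \<i>: the zeros of \<alpha> and \<beta> are real, but 0 may be
  one of them.\<close>

lemma entire_factor_zero:
  assumes f: "f holomorphic_on UNIV" and nz: "f w \<noteq> 0"
  obtains m g where "g holomorphic_on UNIV" "g a \<noteq> (0::complex)"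
    "\<And>z. f z = (z - a) ^ m * g z"
proof -
  define m where "m = nat (zorder f a)"
  obtain r where r: "r > 0" "zor_poly f a holomorphic_on cball a r"
      "\<And>w. w \<in> cball a r \<Longrightarrow> f w = zor_poly f a w * (w - a) ^ m \<and> zor_poly f a w \<noteq> 0"
    using zorder_exist_zero[OF f open_UNIV connected_UNIV UNIV_I, of a] nz
    unfolding m_def by blast
  \<comment> \<open>The two branches agree on the punctured ball, so they glue to an entire
    function. The order \<open>m\<close> may be 0, hence \<open>a\<close> need not be a
    zero.\<close>
  define g where "g = (\<lambda>z. if z \<in> ball a r then zor_poly f a z else f z / (z - a) ^ m)"
  have "g holomorphic_on (ball a r \<union> - {a})"
    unfolding g_def
  proof (rule holomorphic_on_If_Un)
    show "zor_poly f a holomorphic_on ball a r"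
      by (rule holomorphic_on_subset[OF r(2)]) auto
    show "(\<lambda>z. f z / (z - a) ^ m) holomorphic_on - {a}"
      by (intro holomorphic_intros holomorphic_on_subset[OF f]) auto
    show "zor_poly f a z = f z / (z - a) ^ m" if "z \<in> ball a r" "z \<in> - {a}" for z
      using r(3)[of z] that by (auto simp: field_simps)
  qed auto
  moreover have "ball a r \<union> - {a} = UNIV"
    using r(1) by auto
  moreover have "g a \<noteq> 0"
    using r(1) r(3)[of a] by (auto simp: g_def)
  moreover have "f z = (z - a) ^ m * g z" for z
    using r(1) r(3)[of z] by (auto simp: g_def)
  ultimately show ?thesis
    using that by metis
qed

lemma entire_factor_finite_zeros:
  assumes f: "f holomorphic_on UNIV" and nz: "f w \<noteq> (0::complex)" and Z: "finite Z"
  obtains m :: "complex \<Rightarrow> nat" and g where "g holomorphic_on UNIV" "\<And>a. a \<in> Z \<Longrightarrow> g a \<noteq> 0"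
    "\<And>z. f z = (\<Prod>a\<in>Z. (z - a) ^ m a) * g z"
proof -
  have "\<exists>(m :: complex \<Rightarrow> nat) g. g holomorphic_on UNIV \<and> (\<forall>a\<in>Z. g a \<noteq> 0) \<and>
          (\<forall>z. f z = (\<Prod>a\<in>Z. (z - a) ^ m a) * g z)"
    using Z
  proof induction
    case empty
    then show ?case using f by auto
  next
    case (insert b Z)
    then obtain m :: "complex \<Rightarrow> nat" and g where g: "g holomorphic_on UNIV"
        "\<And>a. a \<in> Z \<Longrightarrow> g a \<noteq> 0" "\<And>z. f z = (\<Prod>a\<in>Z. (z - a) ^ m a) * g z"
      by blast
    \<comment> \<open>The point \<open>w\<close> travels through the induction as the certificate
      that the remaining factor is not identically zero.\<close>
    have "g w \<noteq> 0" using nz g(3)[of w] by auto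
    from entire_factor_zero[OF g(1) this, of b] obtain k h where
      h: "h holomorphic_on UNIV" "h b \<noteq> 0" "\<And>z. g z = (z - b) ^ k * h z" by metis
    have "(\<Prod>a\<in>Z. (z - a) ^ (m(b := k)) a) = (\<Prod>a\<in>Z. (z - a) ^ m a)" for z
      using insert by (intro prod.cong) auto
    then have "f z = (\<Prod>a\<in>insert b Z. (z - a) ^ (m(b := k)) a) * h z" for z
      using insert g(3)[of z] h(3)[of z] by (simp add: mult_ac)
    moreover have "h a \<noteq> 0" if "a \<in> insert b Z" for a
      using that h(2) g(2)[of a] h(3)[of a] by auto
    ultimately show ?case
      using h(1) by blast
  qed
  then show ?thesis using that by blast
qed

text \<open>The map u / (2 M - u) sends the half plane Re u < M into the unit disc and fixes 0.
  Schwarz at radius 1/2 gives |u| <= |2 M - u| / 2, and the triangle inequality turns this into |u|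
  <= 2 M.\<close>

lemma Borel_Caratheodory_half:
  assumes h: "h holomorphic_on ball 0 S" and h0: "h 0 = 0" and S: "S > 0"
    and Re: "\<And>z. z \<in> ball 0 S \<Longrightarrow> Re (h z) \<le> M" and M: "M \<ge> 0" and z: "cmod z \<le> S / 2"
  shows "cmod (h z) \<le> 2 * M"
proof -
  \<comment> \<open>A strictly larger \<open>M'\<close> makes the denominator of the fractional
    linear map nonzero even if \<open>M = 0\<close>; at the end \<open>M'\<close> decreases to
    \<open>M\<close>.\<close>
  have "cmod (h z) \<le> 2 * M'" if "M' > M" for M'
  proof -
    define u where "u = (\<lambda>\<zeta>. h (of_real S * \<zeta>))"
    define F where "F = (\<lambda>\<zeta>. u \<zeta> / (2 * of_real M' - u \<zeta>))"
    have M': "M' > 0" using that M by simp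
    have Re_u: "Re (u \<zeta>) < M'" if "\<zeta> \<in> ball 0 1" for \<zeta>
    proof -
      have "of_real S * \<zeta> \<in> ball 0 S"
        using that S by (simp add: norm_mult)
      from Re[OF this] show ?thesis using \<open>M' > M\<close> by (simp add: u_def)
    qed
    have less: "cmod (u \<zeta>) < cmod (2 * of_real M' - u \<zeta>)" if "\<zeta> \<in> ball 0 1" for \<zeta>
    proof -
      have "(cmod (u \<zeta>))\<^sup>2 = (Re (u \<zeta>))\<^sup>2 + (Im (u \<zeta>))\<^sup>2"
        by (simp add: cmod_power2)
      also have "\<dots> < (2 * M' - Re (u \<zeta>))\<^sup>2 + (Im (u \<zeta>))\<^sup>2"
      proof -
        have "0 < 4 * M' * (M' - Re (u \<zeta>))" using M' Re_u[OF that] by simp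
        then show ?thesis by (simp add: power2_eq_square algebra_simps)
      qed
      also have "\<dots> = (cmod (2 * of_real M' - u \<zeta>))\<^sup>2"
        by (simp add: cmod_power2)
      finally show ?thesis
        using power2_less_imp_less norm_ge_zero by blast
    qed
    have "F holomorphic_on ball 0 1"
      unfolding F_def u_def
    proof (intro holomorphic_intros)
      have "(h \<circ> (\<lambda>\<zeta>. of_real S * \<zeta>)) holomorphic_on ball 0 1"
        by (rule holomorphic_on_compose_gen[OF _ h])
           (use S in \<open>auto simp: norm_mult intro!: holomorphic_intros\<close>)
      then show "(\<lambda>\<zeta>. h (of_real S * \<zeta>)) holomorphic_on ball 0 1"
           "(\<lambda>\<zeta>. h (of_real S * \<zeta>)) holomorphic_on ball 0 1" by (simp_all add: o_def)
      show "2 * of_real M' - h (of_real S * \<zeta>) \<noteq> 0" if "\<zeta> \<in> ball 0 1" for \<zeta>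
        using less[OF that] norm_ge_zero[of "u \<zeta>"] unfolding u_def by force
    qed
    moreover have "F 0 = 0" by (simp add: F_def u_def h0)
    moreover have "cmod (F \<zeta>) < 1" if "cmod \<zeta> < 1" for \<zeta>
      using less[of \<zeta>] that le_less_trans[OF norm_ge_zero less[of \<zeta>]] unfolding F_def
      by (simp add: norm_divide)
    moreover define \<zeta> where "\<zeta> = z / of_real S"
    have \<zeta>: "cmod \<zeta> \<le> 1 / 2" using z S by (simp add: \<zeta>_def norm_divide field_simps)
    ultimately have "cmod (F \<zeta>) \<le> cmod \<zeta>"
      using Schwarz_Lemma(1)[of F \<zeta>] by auto
    moreover have "0 < cmod (2 * of_real M' - u \<zeta>)"
      using le_less_trans[OF norm_ge_zero less[of \<zeta>]] \<zeta> by simp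
    ultimately have "cmod (u \<zeta>) \<le> 1/2 * cmod (2 * of_real M' - u \<zeta>)"
    proof -
      assume *: "cmod (F \<zeta>) \<le> cmod \<zeta>" "0 < cmod (2 * of_real M' - u \<zeta>)"
      from *(1) have "cmod (u \<zeta>) / cmod (2 * of_real M' - u \<zeta>) \<le> cmod \<zeta>"
        by (simp add: F_def norm_divide)
      also note \<zeta>
      finally have "cmod (u \<zeta>) / cmod (2 * of_real M' - u \<zeta>) \<le> 1/2" .
      with *(2) show ?thesis by (simp add: pos_divide_le_eq)
    qed
    also have "\<dots> \<le> 1/2 * (2 * M' + cmod (u \<zeta>))"
      using norm_triangle_ineq4[of "2 * of_real M'" "u \<zeta>"] M' by (simp add: norm_mult)
    finally have "cmod (u \<zeta>) \<le> 2 * M'" by simp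
    moreover have "u \<zeta> = h z" using S by (simp add: u_def \<zeta>_def)
    ultimately show ?thesis by simp
  qed
  then show ?thesis
    using field_le_epsilon[of "cmod (h z)" "2 * M"]
    by (metis add_diff_cancel_left' distrib_left field_sum_of_halves less_add_same_cancel1 half_gt_zero mult_2)
qed

lemma norm_le_on_cball:
  assumes "f holomorphic_on UNIV" and "\<And>z. cmod (z - a) = r \<Longrightarrow> cmod (f z) \<le> B"
    and "cmod (w - a) \<le> r" "r > 0"
  shows "cmod (f w) \<le> B"
proof (rule maximum_modulus_frontier[of f "cball a r"])
  show "f holomorphic_on interior (cball a r)" "continuous_on (closure (cball a r)) f"
    using assms(1) by (auto intro: holomorphic_on_subset holomorphic_on_imp_continuous_on)
  show "cmod (f z) \<le> B" if "z \<in> frontier (cball a r)" for z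
    using that assms by (auto simp: dist_norm norm_minus_commute)
  show "w \<in> cball a r"
    using assms by (auto simp: dist_norm norm_minus_commute)
qed auto

text \<open>The zeros in a disc of radius \<open>2 R\<close> are divided out; their number is controlled by the
  maximum principle, and the logarithm of the zero-free quotient by Borel--Caratheodory.\<close>

lemma minimum_modulus_disc:
  fixes f :: "complex \<Rightarrow> complex"
  assumes f: "f holomorphic_on UNIV" and f0: "f 0 \<noteq> 0" and R: "R > 0"
    and bound: "\<And>z. cmod z = 6 * R \<Longrightarrow> cmod (f z) \<le> exp M * cmod (f 0)"
    and w: "cmod w \<le> R" and \<rho>: "0 < \<rho>" "\<rho> \<le> 2 * R"
    and dist: "\<And>a. f a = 0 \<Longrightarrow> cmod (w - a) \<ge> \<rho>"
  shows "cmod (f w) \<ge> cmod (f 0) * exp (- 2 * M - M / ln 2 * ln (2 * R / \<rho>))"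
proof -
  define Z where "Z = {z \<in> cball 0 (2 * R). f z = 0}"
  have bound_le: "cmod (f z) \<le> exp M * cmod (f 0)" if "cmod z \<le> 6 * R" for z
    by (rule norm_le_on_cball[OF f, of 0 "6 * R"]) (use that R bound in auto)
  have M: "M \<ge> 0"
    using bound_le[of 0] f0 R by simp
  have finite: "finite Z"
  proof (cases "f constant_on UNIV")
    case True
    then have "Z = {}" using f0 by (auto simp: Z_def constant_on_def)
    then show ?thesis by simp
  next
    case False
    then show ?thesis
      unfolding Z_def by (intro holomorphic_compact_finite_zeros[OF f]) auto
  qed
  obtain m :: "complex \<Rightarrow> nat" and g where g: "g holomorphic_on UNIV"
      "\<And>a. a \<in> Z \<Longrightarrow> g a \<noteq> 0" and fg: "\<And>z. f z = (\<Prod>a\<in>Z. (z - a) ^ m a) * g z"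
    by (rule entire_factor_finite_zeros[OF f f0 finite]) blast
  define p where "p = (\<lambda>z. \<Prod>a\<in>Z. (z - a) ^ m a)"
  define N where "N = (\<Sum>a\<in>Z. m a)"
  have norm_p: "cmod (p z) = (\<Prod>a\<in>Z. cmod (z - a) ^ m a)" for z
    by (simp add: p_def prod_norm[symmetric] norm_power)
  have Z: "cmod a \<le> 2 * R" "f a = 0" if "a \<in> Z" for a
    using that by (auto simp: Z_def)
  \<comment> \<open>The radii 2 R and 6 R are chosen so that every factor z - a is at most 2 R at
    the origin and at least 4 R on the outer circle: each zero gains a factor 2.\<close>
  have p0_le: "cmod (p 0) \<le> (2 * R) ^ N"
    unfolding norm_p N_def power_sum using Z(1) by (intro prod_mono conjI power_mono) auto
  have p_circle: "(4 * R) ^ N \<le> cmod (p z)" if "cmod z = 6 * R" for z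
    unfolding norm_p N_def power_sum
  proof (intro prod_mono conjI power_mono)
    fix a assume "a \<in> Z"
    from Z(1)[OF this] show "4 * R \<le> cmod (z - a)"
      using norm_triangle_ineq2[of z a] that by linarith
  qed (use R in auto)
  have p0: "cmod (p 0) > 0" and g0: "g 0 \<noteq> 0"
    using f0 fg[of 0] by (auto simp: p_def)
  have g_circle: "cmod (g z) \<le> exp M / 2 ^ N * cmod (g 0)" if z: "cmod z = 6 * R" for z
  proof -
    have "cmod (g z) * cmod (p z) \<le> exp M * (cmod (p 0) * cmod (g 0))"
      using bound[OF z] fg[of z] fg[of 0] by (simp add: p_def norm_mult mult_ac)
    moreover have "2 ^ N * cmod (p 0) \<le> cmod (p z)"
    proof -
      have "2 ^ N * cmod (p 0) \<le> 2 ^ N * (2 * R) ^ N"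
        using p0_le by simp
      also have "\<dots> = (4 * R) ^ N"
        by (subst power_mult_distrib[symmetric]) simp
      finally show ?thesis using p_circle[OF z] by linarith
    qed
    ultimately have "cmod (g z) * (2 ^ N * cmod (p 0)) \<le> exp M * (cmod (p 0) * cmod (g 0))"
      by (meson mult_left_mono norm_ge_zero order_trans)
    then have "cmod (p 0) * (cmod (g z) * 2 ^ N) \<le> cmod (p 0) * (exp M * cmod (g 0))"
      by (simp add: mult_ac)
    then have "cmod (g z) * 2 ^ N \<le> exp M * cmod (g 0)"
      using p0 by simp
    then show ?thesis by (simp add: field_simps)
  qed
  have g_le: "cmod (g z) \<le> exp M / 2 ^ N * cmod (g 0)" if "cmod z \<le> 6 * R" for z
    by (rule norm_le_on_cball[OF g(1), of 0 "6 * R"]) (use that R g_circle in auto)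
  \<comment> \<open>The bound on \<open>g\<close> evaluated at 0 itself: the gain of 2 per zero
    limits the number of zeros, as in Jensen's formula.\<close>
  have "2 ^ N \<le> exp M"
    using g_le[of 0] R g0 by (simp add: field_simps)
  then have "ln (2 ^ N) \<le> ln (exp M)"
    by (subst ln_le_cancel_iff) auto
  then have N: "real N \<le> M / ln 2"
    by (simp add: ln_realpow field_simps)
  have g_le': "cmod (g z) \<le> exp M * cmod (g 0)" if "cmod z \<le> 6 * R" for z
  proof -
    have "exp M / 2 ^ N \<le> exp M / 1"
      by (intro divide_left_mono) auto
    then have "exp M / 2 ^ N * cmod (g 0) \<le> exp M * cmod (g 0)"
      by (intro mult_right_mono) auto
    then show ?thesis
      using g_le[OF that] by linarith
  qed
  have g_nz: "g z \<noteq> 0" if "z \<in> ball 0 (2 * R)" for z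
  proof
    assume "g z = 0"
    then have "z \<in> Z" using that fg[of z] by (auto simp: Z_def)
    with g(2) \<open>g z = 0\<close> show False by blast
  qed
  \<comment> \<open>A zero of \<open>g\<close> in this ball would be a zero of \<open>f\<close>,
    hence in \<open>Z\<close>, where \<open>g\<close> does not vanish. The logarithm lives on radius
    2 R, and halving the radius still leaves room for \<open>w\<close>.\<close>
  obtain h where h: "h holomorphic_on ball 0 (2 * R)"
      "\<And>z. z \<in> ball 0 (2 * R) \<Longrightarrow> exp (h z) = g z"
    by (rule holomorphic_logarithm_exists[of "ball 0 (2 * R)" g 0])
       (use g(1) g_nz R in \<open>auto intro: holomorphic_on_subset\<close>)
  have Re_h: "cmod (g z) = exp (Re (h z))" if "z \<in> ball 0 (2 * R)" for z
    using h(2)[OF that, symmetric] by (simp add: norm_exp_eq_Re)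
  have "cmod (h w - h 0) \<le> 2 * M"
  proof (rule Borel_Caratheodory_half[of "\<lambda>z. h z - h 0" "2 * R"])
    fix z :: complex assume z: "z \<in> ball 0 (2 * R)"
    have "exp (Re (h z)) \<le> exp (M + Re (h 0))"
      using g_le'[of z] z R Re_h[OF z] Re_h[of 0] by (simp add: exp_add)
    then show "Re (h z - h 0) \<le> M" by simp
  qed (use R w M h(1) in \<open>auto intro!: holomorphic_intros\<close>)
  then have "Re (h 0) - 2 * M \<le> Re (h w)"
    using abs_Re_le_cmod[of "h w - h 0"] by simp
  then have "exp (Re (h 0) + - 2 * M) \<le> exp (Re (h w))"
    by simp
  then have gw: "cmod (g 0) * exp (- 2 * M) \<le> cmod (g w)"
    using Re_h[of w] Re_h[of 0] w R by (simp only: exp_add) auto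
  \<comment> \<open>Each of the \<open>N\<close> factors is at least \<open>\<rho>\<close> at
    \<open>w\<close> and at most 2 R at 0; the zero count converts the loss (\<rho> / 2 R)^N into
    the logarithmic term.\<close>
  have pw: "cmod (p 0) * exp (- M / ln 2 * ln (2 * R / \<rho>)) \<le> cmod (p w)"
  proof -
    have "0 \<le> ln (2 * R / \<rho>)" using \<rho> by simp
    then have "real N * ln (2 * R / \<rho>) \<le> M / ln 2 * ln (2 * R / \<rho>)"
      using N by (intro mult_right_mono)
    then have "exp (- M / ln 2 * ln (2 * R / \<rho>)) \<le> exp (- (real N * ln (2 * R / \<rho>)))"
      by simp
    also have "\<dots> = exp (ln ((\<rho> / (2 * R)) ^ N))"
      using \<rho> R by (simp add: ln_realpow ln_div algebra_simps)
    also have "\<dots> = (\<rho> / (2 * R)) ^ N"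
      using \<rho> R by (intro exp_ln) auto
    finally have *: "exp (- M / ln 2 * ln (2 * R / \<rho>)) \<le> (\<rho> / (2 * R)) ^ N" .
    have "cmod (p 0) * exp (- M / ln 2 * ln (2 * R / \<rho>)) \<le> (2 * R) ^ N * (\<rho> / (2 * R)) ^ N"
      using * p0_le R by (intro mult_mono) auto
    also have "\<dots> = \<rho> ^ N" using R by (simp add: power_divide)
    also have "\<dots> \<le> cmod (p w)"
      unfolding norm_p N_def power_sum
      using \<rho> dist Z(2) by (intro prod_mono conjI power_mono) auto
    finally show ?thesis .
  qed
  have "cmod (f 0) * exp (- 2 * M - M / ln 2 * ln (2 * R / \<rho>)) =
        (cmod (p 0) * exp (- M / ln 2 * ln (2 * R / \<rho>))) * (cmod (g 0) * exp (- 2 * M))"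
    using fg[of 0] by (simp add: p_def norm_mult mult_ac exp_add[symmetric])
  also have "\<dots> \<le> cmod (p w) * cmod (g w)"
    using pw gw by (intro mult_mono) auto
  also have "\<dots> = cmod (f w)"
    by (simp add: fg[of w] p_def norm_mult)
  finally show ?thesis .
qed

lemma ln_le_powr_div:
  fixes x e :: real
  assumes "x > 0" "e > 0"
  shows "ln x \<le> x powr e / e"
proof -
  have "e * ln x = ln (x powr e)" by simp
  also have "\<dots> \<le> x powr e" using assms by (intro order_trans[OF ln_le_minus_one]) auto
  finally show ?thesis using assms by (simp add: field_simps)
qed

text \<open>The disc estimate is applied about \<i> with R = 1 + |z|. There M is O(R^t) and the
  logarithm of 2 R / \<rho> is O(log R), so the exponent is O(R^t log R), hence O(R^s) with a
  constant independent of z.\<close>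

lemma minimum_modulus_entire:
  assumes f: "f \<in> R_ring t" and t: "0 \<le> t" "t < s" and nz: "f \<i> \<noteq> 0"
    and \<kappa>: "0 < \<kappa>" "\<kappa> \<le> 1" and r: "r \<ge> 0"
  shows "\<exists>K\<ge>0. \<forall>z. (\<forall>a. f a = 0 \<longrightarrow> cmod (z - a) \<ge> \<kappa> * (1 + cmod z) powr (- r)) \<longrightarrow>
      cmod (f z) \<ge> exp (- K * (1 + cmod z) powr s)"
proof -
  obtain A B where hol: "f holomorphic_on UNIV" and A: "A > 0" and B: "B > 0"
    and fB: "\<And>z. cmod (f z) \<le> B * exp (A * cmod z powr t)"
    using f by (auto simp: R_ring_def)
  \<comment> \<open>The 7 comes from |\<zeta> + \<i>| <= 6 R + 1 <= 7 R on the outer circle of the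
    recentred disc.\<close>
  define K1 where "K1 = \<bar>ln (B / cmod (f \<i>))\<bar> + A * 7 powr t"
  define e where "e = s - t"
  \<comment> \<open>Bounds ln (2 R / \<rho>) by \<open>K2 * R powr e\<close>: the gap
    \<open>e = s - t\<close> absorbs the logarithm through ln R <= R^e / e.\<close>
  define K2 where "K2 = ln (2 / \<kappa>) + (1 + r) / e"
  define K where "K = \<bar>ln (cmod (f \<i>))\<bar> + 2 * K1 + K1 / ln 2 * K2"
  have e: "e > 0" using t by (simp add: e_def)
  have K1: "K1 \<ge> 0" using A by (simp add: K1_def)
  have lnk: "ln (2 / \<kappa>) \<ge> 0" using \<kappa> by simp
  have K2: "K2 \<ge> 0" using lnk e r by (simp add: K2_def)
  have "K \<ge> 0" using K1 K2 by (simp add: K_def)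
  moreover have "cmod (f z) \<ge> exp (- K * (1 + cmod z) powr s)"
    if z: "\<And>a. f a = 0 \<Longrightarrow> cmod (z - a) \<ge> \<kappa> * (1 + cmod z) powr (- r)" for z
  proof -
    define R where "R = 1 + cmod z"
    have R: "R \<ge> 1" by (simp add: R_def)
    define \<rho> where "\<rho> = \<kappa> * R powr (- r)"
    have "R powr (- r) \<le> 1" using powr_mono[of "- r" 0 R] R r by simp
    then have \<rho>: "0 < \<rho>" "\<rho> \<le> 1"
      using \<kappa> R mult_mono[of \<kappa> 1 "R powr (- r)" 1] by (simp_all add: \<rho>_def)
    define M where "M = K1 * R powr t"
    have Rt: "R powr t \<ge> 1" using powr_mono[of 0 t R] R t by simp
    have Rts: "R powr t \<le> R powr s" using R t by (intro powr_mono) auto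
    have M0: "M \<ge> 0" using K1 by (simp add: M_def)
    define F where "F = (\<lambda>\<zeta>. f (\<zeta> + \<i>))"
    have "cmod (F 0) * exp (- 2 * M - M / ln 2 * ln (2 * R / \<rho>)) \<le> cmod (F (z - \<i>))"
    proof (rule minimum_modulus_disc)
      have "(f \<circ> (\<lambda>\<zeta>. \<zeta> + \<i>)) holomorphic_on UNIV"
        by (rule holomorphic_on_compose_gen[OF _ hol]) (auto intro!: holomorphic_intros)
      then show "F holomorphic_on UNIV" by (simp add: F_def o_def)
      show "F 0 \<noteq> 0" using nz by (simp add: F_def)
      show "R > 0" using R by simp
      show "cmod (z - \<i>) \<le> R" using norm_triangle_ineq4[of z \<i>] by (simp add: R_def)
      show "0 < \<rho>" "\<rho> \<le> 2 * R" using \<rho> R by auto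
      show "\<rho> \<le> cmod (z - \<i> - a)" if "F a = 0" for a
        using z[of "a + \<i>"] that by (simp add: F_def \<rho>_def R_def algebra_simps)
      show "cmod (F \<zeta>) \<le> exp M * cmod (F 0)" if \<zeta>: "cmod \<zeta> = 6 * R" for \<zeta>
      proof -
        have "cmod (\<zeta> + \<i>) \<le> 7 * R" using norm_triangle_ineq[of \<zeta> \<i>] \<zeta> R by simp
        then have "cmod (\<zeta> + \<i>) powr t \<le> (7 * R) powr t" using t by (intro powr_mono2) auto
        also have "\<dots> = 7 powr t * R powr t" using R by (simp add: powr_mult)
        finally have 1: "A * cmod (\<zeta> + \<i>) powr t \<le> A * 7 powr t * R powr t" using A by simp
        have "cmod (F \<zeta>) \<le> B * exp (A * cmod (\<zeta> + \<i>) powr t)" unfolding F_def by (rule fB)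
        also have "\<dots> \<le> B * exp (A * 7 powr t * R powr t)" using 1 B by simp
        also have "B = exp (ln (B / cmod (f \<i>))) * cmod (f \<i>)" using B nz by simp
        also have "exp (ln (B / cmod (f \<i>))) * cmod (f \<i>) * exp (A * 7 powr t * R powr t)
            = exp (ln (B / cmod (f \<i>)) + A * 7 powr t * R powr t) * cmod (f \<i>)"
          by (simp add: exp_add)
        also have "\<dots> \<le> exp M * cmod (f \<i>)"
        proof -
          have "ln (B / cmod (f \<i>)) \<le> \<bar>ln (B / cmod (f \<i>))\<bar> * R powr t"
            using Rt mult_left_mono[of 1 "R powr t" "\<bar>ln (B / cmod (f \<i>))\<bar>"] by simp
          then have "ln (B / cmod (f \<i>)) + A * 7 powr t * R powr t \<le> M"
            by (simp add: M_def K1_def algebra_simps)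
          then show ?thesis by (intro mult_right_mono) auto
        qed
        finally show ?thesis by (simp add: F_def)
      qed
    qed
    then have 1: "cmod (f \<i>) * exp (- 2 * M - M / ln 2 * ln (2 * R / \<rho>)) \<le> cmod (f z)"
      by (simp add: F_def)
    have "ln (2 * R / \<rho>) = ln (2 / \<kappa>) + (1 + r) * ln R"
    proof -
      have "2 * R / \<rho> = 2 / \<kappa> * R powr (1 + r)"
        using R \<kappa> by (simp add: \<rho>_def powr_add powr_minus field_simps)
      moreover have "ln (2 / \<kappa> * R powr (1 + r)) = ln (2 / \<kappa>) + ln (R powr (1 + r))"
        using R \<kappa> by (intro ln_mult_pos) auto
      ultimately show ?thesis by simp
    qed
    also have "\<dots> \<le> ln (2 / \<kappa>) * R powr e + (1 + r) * (R powr e / e)"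
    proof (rule add_mono)
      have "1 \<le> R powr e" using powr_mono[of 0 e R] R e by simp
      then show "ln (2 / \<kappa>) \<le> ln (2 / \<kappa>) * R powr e"
        using mult_left_mono[of 1 "R powr e" "ln (2 / \<kappa>)"] lnk by simp
      show "(1 + r) * ln R \<le> (1 + r) * (R powr e / e)"
        using r ln_le_powr_div[of R e] e R by (intro mult_left_mono) auto
    qed
    also have "\<dots> = K2 * R powr e" by (simp add: K2_def field_simps)
    finally have "M / ln 2 * ln (2 * R / \<rho>) \<le> M / ln 2 * (K2 * R powr e)"
      using M0 by (intro mult_left_mono) auto
    also have "\<dots> = K1 / ln 2 * K2 * R powr s"
    proof -
      have "R powr t * R powr e = R powr s" by (simp add: powr_add[symmetric] e_def)
      then show ?thesis by (simp add: M_def)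
    qed
    finally have 2: "M / ln 2 * ln (2 * R / \<rho>) \<le> K1 / ln 2 * K2 * R powr s" .
    have 3: "2 * M \<le> 2 * K1 * R powr s" using Rts K1 by (simp add: M_def mult_left_mono)
    have 4: "- \<bar>ln (cmod (f \<i>))\<bar> * R powr s \<le> ln (cmod (f \<i>))"
      using Rt Rts mult_left_mono[of 1 "R powr s" "\<bar>ln (cmod (f \<i>))\<bar>"] by auto
    have "- K * R powr s \<le> ln (cmod (f \<i>)) + (- 2 * M - M / ln 2 * ln (2 * R / \<rho>))"
      using 2 3 4 by (simp add: K_def algebra_simps)
    then have "exp (- K * R powr s) \<le> exp (ln (cmod (f \<i>)) + (- 2 * M - M / ln 2 * ln (2 * R / \<rho>)))"
      by simp
    also have "\<dots> = cmod (f \<i>) * exp (- 2 * M - M / ln 2 * ln (2 * R / \<rho>))"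
      using nz by (simp only: exp_add) simp
    also note 1
    finally show ?thesis by (simp add: R_def)
  qed
  ultimately show ?thesis by blast
qed

section \<open>The Bezout equation for entire functions with growth bounds\<close>

text \<open>Writing \<open>\<alpha> = (z - p)\<^sup>m \<alpha>\<^sub>1\<close>, the function is \<open>\<alpha>\<^sub>1 T e\<close>, where \<open>T\<close> is the Taylor polynomial of
  \<open>1 / (\<alpha>\<^sub>1 \<beta> e)\<close> of degree below \<open>m\<close> at \<open>p\<close>; in other words \<open>\<alpha> e\<close> times the principal part of
  \<open>1 / (\<alpha> \<beta> e)\<close>.\<close>

lemma local_interpolation:
  fixes \<alpha> \<beta> e :: "complex \<Rightarrow> complex"
  assumes hol: "\<alpha> holomorphic_on UNIV" "\<beta> holomorphic_on UNIV" "e holomorphic_on UNIV"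
    and nz: "\<alpha> w \<noteq> 0" and \<rho>: "\<rho> > 0"
    and zeros: "\<And>z. z \<in> cball p \<rho> \<Longrightarrow> z \<noteq> p \<Longrightarrow> \<alpha> z \<noteq> 0"
      "\<And>z. z \<in> cball p \<rho> \<Longrightarrow> \<beta> z \<noteq> 0" "\<And>z. z \<in> cball p \<rho> \<Longrightarrow> e z \<noteq> 0"
    and lower: "\<And>z. cmod (z - p) = \<rho> \<Longrightarrow> L \<le> cmod (\<alpha> z * \<beta> z * e z)" and L: "L > 0"
  obtains G where "G holomorphic_on UNIV"
    "\<And>z. cmod (z - p) \<ge> 2 * \<rho> \<Longrightarrow> cmod (G z) \<le> cmod (\<alpha> z * e z) / L"
    "\<exists>C. eventually (\<lambda>z. cmod (G z * \<beta> z - 1) \<le> C * cmod (\<alpha> z)) (nhds p)"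
proof -
  obtain m \<alpha>1 where \<alpha>1: "\<alpha>1 holomorphic_on UNIV" "\<alpha>1 p \<noteq> 0" "\<And>z. \<alpha> z = (z - p) ^ m * \<alpha>1 z"
    using entire_factor_zero[OF hol(1) nz, of p] by metis
  define h where "h = (\<lambda>z. 1 / (\<alpha>1 z * \<beta> z * e z))"
  define S where "S = {z. \<alpha>1 z * \<beta> z * e z \<noteq> 0}"
  have hol_den: "(\<lambda>z. \<alpha>1 z * \<beta> z * e z) holomorphic_on UNIV"
    by (intro holomorphic_intros hol \<alpha>1)
  have "open S"
  proof -
    have "continuous_on UNIV (\<lambda>z. \<alpha>1 z * \<beta> z * e z)"
      using hol_den by (rule holomorphic_on_imp_continuous_on)
    then have "open (UNIV \<inter> (\<lambda>z. \<alpha>1 z * \<beta> z * e z) -` (- {0}))"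
      by (rule continuous_open_preimage) auto
    then show ?thesis by (simp add: S_def vimage_def Compl_eq)
  qed
  have hS: "h holomorphic_on S"
    unfolding h_def by (intro holomorphic_intros holomorphic_on_subset[OF hol_den]) (auto simp: S_def)
  have sub: "cball p \<rho> \<subseteq> S"
  proof
    fix z assume z: "z \<in> cball p \<rho>"
    have "\<alpha>1 z \<noteq> 0" using \<alpha>1(2,3) zeros(1)[OF z] by (cases "z = p") auto
    then show "z \<in> S" using zeros(2,3)[OF z] by (simp add: S_def)
  qed
  define c where "c = (\<lambda>k. (deriv ^^ k) h p / fact k)"
  define T where "T = (\<lambda>z. \<Sum>k<m. c k * (z - p) ^ k)"
  define G where "G = (\<lambda>z. \<alpha>1 z * T z * e z)"
  have "G holomorphic_on UNIV"
    unfolding G_def T_def by (intro holomorphic_intros hol \<alpha>1)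
  moreover have "cmod (G z) \<le> cmod (\<alpha> z * e z) / L" if z: "cmod (z - p) \<ge> 2 * \<rho>" for z
  proof -
    \<comment> \<open>Cauchy's estimate on the circle of radius \<open>\<rho>\<close>, where |h| =
      \<rho>^m / |\<alpha> \<beta> e|; only this circle needs a lower bound.\<close>
    have c_le: "cmod (c k) \<le> \<rho> ^ m / L / \<rho> ^ k" for k
    proof -
      have "cmod ((deriv ^^ k) h p) \<le> fact k * (\<rho> ^ m / L) / \<rho> ^ k"
      proof (rule Cauchy_inequality)
        show "h holomorphic_on ball p \<rho>"
          by (rule holomorphic_on_subset[OF hS]) (use sub in auto)
        show "continuous_on (cball p \<rho>) h"
          by (rule holomorphic_on_imp_continuous_on, rule holomorphic_on_subset[OF hS]) (use sub in auto)
        show "cmod (h x) \<le> \<rho> ^ m / L" if x: "cmod (p - x) = \<rho>" for x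
        proof -
          have x': "cmod (x - p) = \<rho>" using x by (simp add: norm_minus_commute)
          have "L \<le> \<rho> ^ m * cmod (\<alpha>1 x * \<beta> x * e x)"
            using lower[OF x'] \<alpha>1(3)[of x] x' by (simp add: norm_mult norm_power mult_ac)
          moreover have "x \<in> S" using sub x by (auto simp: dist_norm)
          ultimately show ?thesis
            using L by (simp add: h_def norm_divide S_def field_simps)
        qed
      qed (use \<rho> in auto)
      then show ?thesis by (simp add: c_def norm_divide field_simps)
    qed
    have "cmod (T z) \<le> (\<Sum>k<m. \<rho> ^ m / L / \<rho> ^ k * cmod (z - p) ^ k)"
      unfolding T_def
      by (rule order_trans[OF norm_sum], unfold norm_mult norm_power)
         (intro sum_mono mult_right_mono c_le zero_le_power norm_ge_zero)
    \<comment> \<open>At distance at least 2 \<rho> the terms form a geometric sum of ratio 1/2 with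
      total at most 1, so the multiplicity m leaves no trace in the constant.\<close>
    also have "\<dots> \<le> (\<Sum>k<m. cmod (z - p) ^ m / L * (1 / 2) ^ (m - k))"
    proof (rule sum_mono)
      fix k assume k: "k \<in> {..<m}"
      have "\<rho> ^ m / \<rho> ^ k = \<rho> ^ (m - k)" using k \<rho> by (simp add: power_diff)
      also have "\<dots> \<le> (cmod (z - p) / 2) ^ (m - k)" using z \<rho> by (intro power_mono) auto
      finally have "\<rho> ^ m / \<rho> ^ k * cmod (z - p) ^ k \<le> (cmod (z - p) / 2) ^ (m - k) * cmod (z - p) ^ k"
        by (intro mult_right_mono) auto
      also have "\<dots> = cmod (z - p) ^ m * (1 / 2) ^ (m - k)"
        using k by (simp add: power_divide power_add[symmetric])
      finally have "(\<rho> ^ m / \<rho> ^ k * cmod (z - p) ^ k) / L \<le> (cmod (z - p) ^ m * (1 / 2) ^ (m - k)) / L"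
        using L by (intro divide_right_mono) auto
      then show "\<rho> ^ m / L / \<rho> ^ k * cmod (z - p) ^ k \<le> cmod (z - p) ^ m / L * (1 / 2) ^ (m - k)"
        by (simp add: field_simps)
    qed
    also have "\<dots> = cmod (z - p) ^ m / L * (\<Sum>k<m. (1 / 2) ^ (m - k))"
      by (simp add: sum_distrib_left)
    also have "\<dots> \<le> cmod (z - p) ^ m / L * 1"
    proof (rule mult_left_mono)
      have "(\<Sum>k<m. (1 / 2 :: real) ^ (m - k)) = (\<Sum>k<m. (1 / 2) ^ Suc k)"
        by (rule sum.reindex_bij_witness[of _ "\<lambda>k. m - Suc k" "\<lambda>k. m - Suc k"])
           (auto simp: Suc_diff_Suc simp flip: power_Suc)
      also have "\<dots> = 1 - (1 / 2) ^ m" by (induction m) auto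
      also have "\<dots> \<le> 1" by simp
      finally show "(\<Sum>k<m. (1 / 2 :: real) ^ (m - k)) \<le> 1" .
    qed (use L in auto)
    finally have "cmod (T z) \<le> cmod (z - p) ^ m / L" by simp
    then have "cmod (\<alpha>1 z * e z) * cmod (T z) \<le> cmod (\<alpha>1 z * e z) * (cmod (z - p) ^ m / L)"
      by (rule mult_left_mono) auto
    then show ?thesis by (simp add: G_def \<alpha>1(3) norm_mult norm_power mult_ac)
  qed
  moreover have "\<exists>C. eventually (\<lambda>z. cmod (G z * \<beta> z - 1) \<le> C * cmod (\<alpha> z)) (nhds p)"
  proof -
    \<comment> \<open>The Taylor remainder of \<open>h\<close> divided by (z - p)^m. Since G \<beta>
      - 1 is \<alpha>1 \<beta> e times T - h, it equals -\<alpha> times the continuous function U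
      \<beta> e.\<close>
    define U where "U = (\<lambda>z. \<Sum>k. c (k + m) * (z - p) ^ k)"
    have tail: "h z = T z + (z - p) ^ m * U z \<and> summable (\<lambda>k. c (k + m) * (z - p) ^ k)"
      if z: "z \<in> ball p \<rho>" for z
    proof -
      have hb: "h holomorphic_on ball p \<rho>"
        by (rule holomorphic_on_subset[OF hS]) (use sub in auto)
      have sums: "(\<lambda>n. c n * (z - p) ^ n) sums h z"
        unfolding c_def by (rule holomorphic_power_series[OF hb z])
      then have "(\<lambda>n. c (n + m) * (z - p) ^ (n + m)) sums (h z - T z)"
        unfolding T_def using sums_iff_shift'[of "\<lambda>n. c n * (z - p) ^ n" m "h z"] by blast
      then have *: "(\<lambda>n. (z - p) ^ m * (c (n + m) * (z - p) ^ n)) sums (h z - T z)"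
        by (simp add: power_add mult_ac)
      have summable: "summable (\<lambda>n. c (n + m) * (z - p) ^ n)"
      proof (cases "z = p")
        case True
        then show ?thesis
          using powser_sums_zero[of "\<lambda>k. c (k + m)"] by (auto simp: sums_iff)
      next
        case False
        then show ?thesis
          using sums_mult[OF *, of "1 / (z - p) ^ m"] by (auto simp: sums_iff)
      qed
      then have "(\<lambda>n. (z - p) ^ m * (c (n + m) * (z - p) ^ n)) sums ((z - p) ^ m * U z)"
        unfolding U_def by (intro sums_mult summable_sums)
      with * have "h z - T z = (z - p) ^ m * U z"
        by (rule sums_unique2)
      with summable show ?thesis by (simp add: algebra_simps)
    qed
    have ev: "eventually (\<lambda>z. z \<in> ball p \<rho>) (nhds p)" using \<rho> by (intro eventually_nhds_in_open) auto
    have U: "U holomorphic_on ball p \<rho>"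
    proof -
      have "(\<lambda>k. c (k + m) * (z - p) ^ k) sums U z" if "z \<in> ball p \<rho>" for z
        using tail[OF that] by (simp add: U_def summable_sums)
      then show ?thesis by (rule power_series_holomorphic)
    qed
    define V where "V = (\<lambda>z. U z * \<beta> z * e z)"
    have V: "isCont V p"
    proof -
      have "V holomorphic_on ball p \<rho>" unfolding V_def
        by (intro holomorphic_intros U holomorphic_on_subset[OF hol(2)] holomorphic_on_subset[OF hol(3)]) auto
      then show ?thesis using \<rho>
        by (meson centre_in_ball continuous_on_eq_continuous_at holomorphic_on_imp_continuous_on open_ball)
    qed
    then have "(V \<longlongrightarrow> V p) (nhds p)" by (simp add: isCont_def tendsto_at_iff_tendsto_nhds)
    then have "eventually (\<lambda>z. dist (V z) (V p) < 1) (nhds p)"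
      by (rule tendstoD) simp
    with ev have "eventually (\<lambda>z. cmod (G z * \<beta> z - 1) \<le> (cmod (V p) + 1) * cmod (\<alpha> z)) (nhds p)"
    proof eventually_elim
      case (elim z)
      have "z \<in> S" using sub elim(1) by auto
      have "G z * \<beta> z - 1 = \<alpha>1 z * \<beta> z * e z * (T z - h z)"
        using \<open>z \<in> S\<close> by (simp add: S_def G_def h_def algebra_simps)
      also have "T z - h z = - ((z - p) ^ m * U z)" using tail[OF elim(1)] by simp
      finally have "G z * \<beta> z - 1 = - (V z * \<alpha> z)" by (simp add: V_def \<alpha>1(3) mult_ac)
      then have "cmod (G z * \<beta> z - 1) = cmod (V z) * cmod (\<alpha> z)" by (simp add: norm_mult)
      moreover have "cmod (V z) \<le> cmod (V p) + 1"
        using elim(2) norm_triangle_sub[of "V z" "V p"] by (simp add: dist_norm)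
      ultimately show ?case by (simp add: mult_right_mono)
    qed
    then show ?thesis by blast
  qed
  ultimately show ?thesis using that by blast
qed

text \<open>The weight 1 + |z| is at least 1, so its powers absorb constants and increase with the
  exponent. It converts to |z| by (1 + x)^s <= 2^s (1 + x^s); the added units supply the strictly
  positive constants that \<open>R_ring\<close> demands.\<close>

lemma R_ring_I:
  assumes f: "f holomorphic_on UNIV" and s: "s > 0" and A: "A \<ge> 0" and B: "B \<ge> 0"
    and le: "\<And>z. cmod (f z) \<le> B * exp (A * (1 + cmod z) powr s)"
  shows "f \<in> R_ring s"
proof -
  have "cmod (f z) \<le> ((B + 1) * exp (A * 2 powr s)) * exp ((A + 1) * 2 powr s * cmod z powr s)" for z
  proof -
    have "(1 + cmod z) powr s \<le> 2 powr s * (1 + cmod z powr s)"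
    proof (cases "cmod z \<le> 1")
      case True
      then have "(1 + cmod z) powr s \<le> 2 powr s" using s by (intro powr_mono2) auto
      also have "\<dots> \<le> 2 powr s * (1 + cmod z powr s)" by (simp add: algebra_simps)
      finally show ?thesis .
    next
      case False
      then have "(1 + cmod z) powr s \<le> (2 * cmod z) powr s" using s by (intro powr_mono2) auto
      also have "\<dots> = 2 powr s * cmod z powr s" by (simp add: powr_mult)
      also have "\<dots> \<le> 2 powr s * (1 + cmod z powr s)" by (simp add: algebra_simps)
      finally show ?thesis .
    qed
    then have "A * (1 + cmod z) powr s \<le> A * (2 powr s * (1 + cmod z powr s))"
      using A by (rule mult_left_mono)
    also have "\<dots> \<le> A * 2 powr s + (A + 1) * 2 powr s * cmod z powr s"
      by (simp add: algebra_simps)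
    finally have "exp (A * (1 + cmod z) powr s)
        \<le> exp (A * 2 powr s + (A + 1) * 2 powr s * cmod z powr s)" by simp
    then have "B * exp (A * (1 + cmod z) powr s)
        \<le> (B + 1) * (exp (A * 2 powr s) * exp ((A + 1) * 2 powr s * cmod z powr s))"
      unfolding exp_add using B by (intro mult_mono) auto
    with le[of z] show ?thesis by (simp add: mult.assoc)
  qed
  moreover have "(B + 1) * exp (A * 2 powr s) > 0" "(A + 1) * 2 powr s > 0"
    using A B by (auto intro!: mult_pos_pos)
  ultimately show ?thesis
    unfolding R_ring_def using f by blast
qed

lemma R_ring_D:
  assumes f: "f \<in> R_ring t" and t: "0 \<le> t" "t \<le> s"
  obtains A B where "A > 0" "B > 0" "\<And>z. cmod (f z) \<le> B * exp (A * (1 + cmod z) powr s)"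
proof -
  obtain A B where A: "A > 0" and B: "B > 0"
    and fB: "\<And>z. cmod (f z) \<le> B * exp (A * cmod z powr t)"
    using f by (auto simp: R_ring_def)
  have "cmod (f z) \<le> B * exp (A * (1 + cmod z) powr s)" for z
  proof -
    have "cmod z powr t \<le> (1 + cmod z) powr t" using t by (intro powr_mono2) auto
    also have "\<dots> \<le> (1 + cmod z) powr s" using t by (intro powr_mono) auto
    finally have "B * exp (A * cmod z powr t) \<le> B * exp (A * (1 + cmod z) powr s)"
      using A B by simp
    with fB[of z] show ?thesis by linarith
  qed
  with A B show ?thesis using that by blast
qed

lemma R_ring_holomorphic: "f \<in> R_ring s \<Longrightarrow> f holomorphic_on UNIV"
  by (simp add: R_ring_def)

text \<open>Divisibility is expressed by a local bound |f| <= C |g|, which takes care of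
  multiplicities without naming them: the quotient is bounded near each zero of \<open>g\<close>, so
  the singularity is removable.\<close>

lemma entire_quotient:
  assumes f: "f holomorphic_on UNIV" and g: "g holomorphic_on UNIV" and nz: "g w \<noteq> 0"
    and le: "\<And>p. g p = 0 \<Longrightarrow> \<exists>C. eventually (\<lambda>z. cmod (f z) \<le> C * cmod (g z)) (nhds p)"
  obtains h where "h holomorphic_on UNIV" "\<And>z. f z = g z * h z"
proof -
  define h where "h = remove_sings (\<lambda>z. f z / g z)"
  have an: "(\<lambda>z. f z / g z) analytic_on {p}" if "g p \<noteq> 0" for p
    using that f g by (intro analytic_intros) (auto simp: analytic_on_holomorphic)
  have ana: "h analytic_on {p} \<and> f p = g p * h p" for p
  proof (cases "g p = 0")
    case False
    from an[OF this] show ?thesis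
      using False by (auto simp: h_def intro: remove_sings_analytic_on)
  next
    case True
    obtain C where C: "eventually (\<lambda>z. cmod (f z) \<le> C * cmod (g z)) (nhds p)"
      using le[OF True] by blast
    \<comment> \<open>With both sides zero at \<open>p\<close>, the identity f = g h holds there
      whatever value the extension takes.\<close>
    have "f p = 0" using eventually_nhds_x_imp_x[OF C] True by simp
    obtain m g1 where g1: "g1 holomorphic_on UNIV" "g1 p \<noteq> 0" "\<And>z. g z = (z - p) ^ m * g1 z"
      using entire_factor_zero[OF g nz, of p] by metis
    have "isCont g1 p"
      using g1(1) by (meson UNIV_I continuous_on_eq_continuous_at holomorphic_on_imp_continuous_on open_UNIV)
    then have "eventually (\<lambda>z. g1 z \<noteq> 0) (nhds p)"
      using g1(2) continuous_at_avoid[of p g1 0] by (auto simp: eventually_nhds_metric dist_commute)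
    then have "eventually (\<lambda>z. g1 z \<noteq> 0 \<and> cmod (f z) \<le> C * cmod (g z)) (nhds p)"
      using C by eventually_elim auto
    then obtain \<epsilon> where \<epsilon>: "\<epsilon> > 0"
        "\<And>z. dist z p < \<epsilon> \<Longrightarrow> g1 z \<noteq> 0 \<and> cmod (f z) \<le> C * cmod (g z)"
      by (auto simp: eventually_nhds_metric)
    have nz': "g z \<noteq> 0" if "z \<in> ball p \<epsilon> - {p}" for z
      using that \<epsilon>(2)[of z] by (auto simp: g1(3) dist_commute)
    have hol: "(\<lambda>z. f z / g z) holomorphic_on ball p \<epsilon> - {p}"
      using nz' by (intro holomorphic_intros holomorphic_on_subset[OF f] holomorphic_on_subset[OF g]) auto
    have "\<exists>H. H holomorphic_on ball p \<epsilon> \<and> (\<forall>z\<in>ball p \<epsilon> - {p}. H z = f z / g z)"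
    proof (rule holomorphic_on_extend[OF hol])
      show "p \<in> interior (ball p \<epsilon>)" using \<epsilon>(1) by (simp add: interior_open)
      have "eventually (\<lambda>z. z \<in> ball p \<epsilon> - {p}) (at p)"
        using \<epsilon>(1) by (intro eventually_at_in_open) auto
      then show "(\<lambda>z. f z / g z) \<in> O[at p](\<lambda>_. 1)"
      proof (intro bigoI[of _ C], elim eventually_mono)
        fix z assume z: "z \<in> ball p \<epsilon> - {p}"
        show "norm (f z / g z) \<le> C * norm (1 :: complex)"
          using nz'[OF z] \<epsilon>(2)[of z] z by (simp add: norm_divide divide_le_eq dist_commute)
      qed
    qed
    then obtain H where H: "H holomorphic_on ball p \<epsilon>" "\<And>z. z \<in> ball p \<epsilon> - {p} \<Longrightarrow> H z = f z / g z"
      by blast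
    have "isCont H p"
      using H(1) \<epsilon>(1)
      by (meson centre_in_ball continuous_on_eq_continuous_at holomorphic_on_imp_continuous_on open_ball)
    then have "H \<midarrow>p\<rightarrow> H p" by (simp add: isCont_def)
    moreover have "eventually (\<lambda>z. z \<in> ball p \<epsilon> - {p}) (at p)"
      using \<epsilon>(1) by (intro eventually_at_in_open) auto
    ultimately have "(\<lambda>z. f z / g z) \<midarrow>p\<rightarrow> H p"
      by (elim Lim_transform_eventually, elim eventually_mono) (use H(2) in auto)
    moreover have "isolated_singularity_at (\<lambda>z. f z / g z) p"
      using hol \<epsilon>(1) unfolding isolated_singularity_at_def
      by (intro exI[of _ \<epsilon>]) (simp add: analytic_on_open open_Diff)
    ultimately have "h analytic_on {p}"
      unfolding h_def by (intro remove_sings_analytic_at)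
    with True \<open>f p = 0\<close> show ?thesis by simp
  qed
  have "h analytic_on UNIV"
    using ana analytic_on_analytic_at by blast
  then have "h holomorphic_on UNIV"
    by (rule analytic_imp_holomorphic)
  with ana show ?thesis using that by blast
qed

text \<open>For x >= 3 T the power beats \<open>exp (K * x powr s)\<close> with a factor exp (- x^s)
  to spare. For x < 3 T every x^s is dominated by 3^s T^s, and n ln (T / x) is at most a multiple of
  x^s (T / x)^s = T^s. Thus decay in x and growth of order s in T come together.\<close>

lemma power_weight_le:
  fixes x T K s :: real
  assumes x: "x \<ge> 1" and T: "T \<ge> 1" and K: "K \<ge> 0" and s: "s > 0"
  shows "(T / x) ^ nat \<lceil>(K + 1) * x powr s\<rceil> * exp (K * x powr s)
           \<le> exp (- (x powr s)) * exp (((K + 2) / s + (K + 1) * 3 powr s) * T powr s)"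
proof -
  define n where "n = nat \<lceil>(K + 1) * x powr s\<rceil>"
  have xs: "x powr s \<ge> 1" using powr_mono[of 0 s x] x s by simp
  have n_ge: "real n \<ge> (K + 1) * x powr s" unfolding n_def by linarith
  have "0 \<le> (K + 1) * x powr s" using K by simp
  then have "real n \<le> (K + 1) * x powr s + 1" unfolding n_def by linarith
  \<comment> \<open>Rounding up costs at most 1, which is at most \<open>x powr s\<close>; this is
    the 2 in \<open>K + 2\<close>.\<close>
  then have n_le: "real n \<le> (K + 2) * x powr s" using xs by (simp add: algebra_simps)
  have "T powr s \<ge> 0" by simp
  show ?thesis
  proof (cases "x \<ge> 3 * T")
    case True
    \<comment> \<open>The threshold 3 is an upper bound for e.\<close>
    have "T / x \<le> exp (- 1)"
    proof -
      have "T / x \<le> 1 / 3" using True T x by (simp add: field_simps)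
      also have "\<dots> \<le> exp (- 1)" using exp_le by (simp add: exp_minus field_simps)
      finally show ?thesis .
    qed
    then have "(T / x) ^ n \<le> exp (- 1) ^ n" using T x by (intro power_mono) auto
    also have "\<dots> = exp (- real n)" by (simp add: exp_of_nat_mult[symmetric])
    also have "\<dots> \<le> exp (- ((K + 1) * x powr s))" using n_ge by simp
    finally have "(T / x) ^ n * exp (K * x powr s) \<le> exp (- ((K + 1) * x powr s)) * exp (K * x powr s)"
      by (intro mult_right_mono) auto
    also have "\<dots> = exp (- (x powr s)) * 1" by (simp add: exp_add[symmetric] algebra_simps)
    also have "\<dots> \<le> exp (- (x powr s)) * exp (((K + 2) / s + (K + 1) * 3 powr s) * T powr s)"
      using K s by (intro mult_left_mono) auto
    finally show ?thesis by (simp add: n_def)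
  next
    case False
    have 1: "(T / x) ^ n \<le> exp ((K + 2) / s * T powr s)"
    proof (cases "T \<ge> x")
      case True
      have "ln (T / x) \<le> (T / x) powr s / s" using T x s by (intro ln_le_powr_div) auto
      moreover have "0 \<le> ln (T / x)" using True x by simp
      ultimately have "real n * ln (T / x) \<le> (K + 2) * x powr s * ((T / x) powr s / s)"
        using n_le K by (intro mult_mono) auto
      also have "\<dots> = (K + 2) / s * T powr s" using x T by (simp add: powr_divide)
      finally have "exp (real n * ln (T / x)) \<le> exp ((K + 2) / s * T powr s)" by simp
      then show ?thesis using T x by (simp add: exp_of_nat_mult)
    next
      case False
      then have "(T / x) ^ n \<le> 1" using T x by (intro power_le_one) auto
      also have "\<dots> \<le> exp ((K + 2) / s * T powr s)" using K s by simp
      finally show ?thesis .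
    qed
    have "x powr s \<le> (3 * T) powr s" using False x s by (intro powr_mono2) auto
    also have "\<dots> = 3 powr s * T powr s" by (simp add: powr_mult)
    finally have "(K + 1) * x powr s \<le> (K + 1) * (3 powr s * T powr s)"
      using K by (intro mult_left_mono) auto
    \<comment> \<open>K x^s is rewritten as - x^s + (K + 1) x^s, so that the decaying factor
      survives and only the second summand is traded for a power of T.\<close>
    then have 2: "exp (K * x powr s) \<le> exp (- (x powr s) + (K + 1) * 3 powr s * T powr s)"
      by (simp add: algebra_simps)
    have "(T / x) ^ n * exp (K * x powr s) \<le> exp ((K + 2) / s * T powr s) *
            exp (- (x powr s) + (K + 1) * 3 powr s * T powr s)"
      using 1 2 by (intro mult_mono) auto
    also have "\<dots> = exp (- (x powr s)) * exp (((K + 2) / s + (K + 1) * 3 powr s) * T powr s)"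
      by (simp add: exp_add[symmetric] algebra_simps)
    finally show ?thesis by (simp add: n_def)
  qed
qed

lemma norm_le_double:
  assumes "cmod (w - z) \<le> 1"
  shows "1 + cmod w \<le> 2 * (1 + cmod z)"
proof -
  have "cmod w \<le> cmod (w - z) + cmod z"
    using norm_triangle_ineq[of "w - z" z] by simp
  with assms norm_ge_zero[of z] show ?thesis
    unfolding distrib_left by linarith
qed

text \<open>The factor \<open>e\<close> is a power of \<open>z - 2\<i>\<close> of degree about \<open>(K + 1) x\<^sup>s\<close>: large enough to absorb
  the lower bound of \<open>\<alpha> \<beta>\<close>, which makes the series over all zeros converge, and still of growth \<open>s\<close>.\<close>

lemma interpolation_term:
  fixes \<alpha> \<beta> :: "complex \<Rightarrow> complex" and p \<rho> K s A B :: real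
  assumes hol: "\<alpha> holomorphic_on UNIV" "\<beta> holomorphic_on UNIV"
    and nz: "\<alpha> w \<noteq> 0" and \<rho>: "0 < \<rho>" "\<rho> \<le> 1 / 4" and K: "K \<ge> 0" and s: "s > 0"
    and AB: "A \<ge> 0" "B \<ge> 0" and \<alpha>_le: "\<And>z. cmod (\<alpha> z) \<le> B * exp (A * (1 + cmod z) powr s)"
    and zeros: "\<And>z. z \<in> cball (of_real p) \<rho> \<Longrightarrow> z \<noteq> of_real p \<Longrightarrow> \<alpha> z \<noteq> 0"
      "\<And>z. z \<in> cball (of_real p) \<rho> \<Longrightarrow> \<beta> z \<noteq> 0"
    and lower: "\<And>z. cmod (z - of_real p) = \<rho> \<Longrightarrow>
        exp (- K * (1 + \<bar>p\<bar>) powr s) \<le> cmod (\<alpha> z * \<beta> z)"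
  defines "M \<equiv> ((K + 2) / s + (K + 1) * 3 powr s) * 6 powr s"
  shows "\<exists>G. G holomorphic_on UNIV \<and>
    (\<forall>z. cmod (z - of_real p) \<ge> 2 * \<rho> \<longrightarrow>
        cmod (G z) \<le> cmod (\<alpha> z) * (exp (- ((1 + \<bar>p\<bar>) powr s)) * exp (M * (1 + cmod z) powr s))) \<and>
    (\<forall>z. cmod (G z) \<le> exp (- ((1 + \<bar>p\<bar>) powr s)) *
        (B * exp ((A + M) * 2 powr s * (1 + cmod z) powr s))) \<and>
    (\<exists>C. eventually (\<lambda>z. cmod (G z * \<beta> z - 1) \<le> C * cmod (\<alpha> z)) (nhds (of_real p)))"
proof -
  define x where "x = 1 + \<bar>p\<bar>"
  define n where "n = nat \<lceil>(K + 1) * x powr s\<rceil>"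
  \<comment> \<open>The zero 2\<i> lies off the real axis, at distance at least max |p| 2 from p. On
    the disc this leaves |z - 2\<i>| >= (1 + |p|) / 2, and the normalisation 2 / x makes |e| >= 1
    there.\<close>
  define e where "e = (\<lambda>z. (2 * (z - 2 * \<i>) / of_real x) ^ n)"
  define L where "L = exp (- K * x powr s)"
  have x: "x \<ge> 1" by (simp add: x_def)
  have M: "M \<ge> 0" using K s by (simp add: M_def)
  have hol_e: "e holomorphic_on UNIV" unfolding e_def using x by (intro holomorphic_intros) auto
  have e_ge: "cmod (e z) \<ge> 1" if z: "z \<in> cball (of_real p) \<rho>" for z
  proof -
    have "cmod (of_real p - 2 * \<i>) \<ge> \<bar>p\<bar>"
      using abs_Re_le_cmod[of "of_real p - 2 * \<i>"] by simp
    moreover have "cmod (of_real p - 2 * \<i>) \<ge> 2"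
      using abs_Im_le_cmod[of "of_real p - 2 * \<i>"] by simp
    moreover have "cmod (of_real p - 2 * \<i>) - cmod (of_real p - z) \<le> cmod (z - 2 * \<i>)"
      using norm_triangle_ineq2[of "of_real p - 2 * \<i>" "of_real p - z"] by simp
    moreover have "cmod (of_real p - z) \<le> 1 / 4" using z \<rho> by (simp add: dist_norm)
    ultimately have "x \<le> 2 * cmod (z - 2 * \<i>)" unfolding x_def by linarith
    then have "1 \<le> cmod (2 * (z - 2 * \<i>) / of_real x)"
      unfolding norm_divide norm_mult using x by simp
    then show ?thesis
      unfolding e_def norm_power by (rule one_le_power)
  qed
  have e_le: "cmod (e z) / L \<le> exp (- (x powr s)) * exp (M * (1 + cmod z) powr s)" for z
  proof -
    \<comment> \<open>From 2 |z - 2\<i>| <= 2 |z| + 4; this is the origin of 6^s in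
      \<open>M\<close>.\<close>
    define T where "T = 6 * (1 + cmod z)"
    have T: "T \<ge> 1" by (simp add: T_def)
    have "2 * cmod (z - 2 * \<i>) \<le> T"
    proof -
      have "cmod (z - 2 * \<i>) \<le> cmod z + 2"
        using norm_triangle_ineq4[of z "2 * \<i>"] by (simp add: norm_mult)
      then have "2 * cmod (z - 2 * \<i>) \<le> 2 * (cmod z + 2)" by (rule mult_left_mono) simp
      also have "\<dots> \<le> T" unfolding T_def by simp
      finally show ?thesis .
    qed
    then have "cmod (2 * (z - 2 * \<i>) / of_real x) \<le> T / x"
      unfolding norm_divide norm_mult using x by (simp add: divide_right_mono)
    then have "cmod (e z) \<le> (T / x) ^ n"
      unfolding e_def norm_power by (rule power_mono) simp
    then have "cmod (e z) / L \<le> (T / x) ^ n * exp (K * x powr s)"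
      unfolding L_def by (simp add: exp_minus divide_inverse mult_right_mono)
    also have "\<dots> \<le> exp (- (x powr s)) * exp (((K + 2) / s + (K + 1) * 3 powr s) * T powr s)"
      unfolding n_def by (rule power_weight_le[OF x T K s])
    also have "T powr s = 6 powr s * (1 + cmod z) powr s"
      unfolding T_def by (rule powr_mult)
    finally show ?thesis by (simp add: M_def mult_ac)
  qed
  obtain G where G: "G holomorphic_on UNIV"
    "\<And>z. cmod (z - of_real p) \<ge> 2 * \<rho> \<Longrightarrow> cmod (G z) \<le> cmod (\<alpha> z * e z) / L"
    "\<exists>C. eventually (\<lambda>z. cmod (G z * \<beta> z - 1) \<le> C * cmod (\<alpha> z)) (nhds (of_real p))"
  proof (rule local_interpolation[OF hol hol_e nz \<rho>(1), of "of_real p" L])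
    show "e z \<noteq> 0" if "z \<in> cball (of_real p) \<rho>" for z
      using e_ge[OF that] by auto
    show "L \<le> cmod (\<alpha> z * \<beta> z * e z)" if "cmod (z - of_real p) = \<rho>" for z
    proof -
      have "1 \<le> cmod (e z)" using that by (intro e_ge) (simp add: dist_norm norm_minus_commute)
      then have "L * 1 \<le> cmod (\<alpha> z * \<beta> z) * cmod (e z)"
        using lower[OF that] by (intro mult_mono) (auto simp: L_def x_def)
      then show ?thesis by (simp add: norm_mult)
    qed
  qed (use zeros in \<open>auto simp: L_def\<close>)
  have G_far: "cmod (G z) \<le> cmod (\<alpha> z) * (exp (- (x powr s)) * exp (M * (1 + cmod z) powr s))"
    if "cmod (z - of_real p) \<ge> 2 * \<rho>" for z
  proof -
    have "cmod (G z) \<le> cmod (\<alpha> z) * (cmod (e z) / L)"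
      using G(2)[OF that] by (simp add: norm_mult)
    also have "\<dots> \<le> cmod (\<alpha> z) * (exp (- (x powr s)) * exp (M * (1 + cmod z) powr s))"
      by (intro mult_left_mono e_le) auto
    finally show ?thesis .
  qed
  define b where "b = (\<lambda>R::real. exp (- (x powr s)) * (B * exp ((A + M) * 2 powr s * R powr s)))"
  have far_le: "cmod (G w) \<le> b R"
    if w: "cmod (w - of_real p) \<ge> 2 * \<rho>" "1 + cmod w \<le> 2 * R" for w R
  proof -
    have "(1 + cmod w) powr s \<le> (2 * R) powr s" using w s by (intro powr_mono2) auto
    also have "\<dots> = 2 powr s * R powr s" by (simp add: powr_mult)
    finally have "(A + M) * (1 + cmod w) powr s \<le> (A + M) * (2 powr s * R powr s)"
      using AB M by (intro mult_left_mono) auto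
    then have *: "exp ((A + M) * (1 + cmod w) powr s) \<le> exp ((A + M) * 2 powr s * R powr s)"
      by (simp add: mult_ac)
    have "cmod (G w) \<le> (B * exp (A * (1 + cmod w) powr s)) *
          (exp (- (x powr s)) * exp (M * (1 + cmod w) powr s))"
      by (rule order_trans[OF G_far[OF w(1)]]) (intro mult_right_mono \<alpha>_le, simp)
    also have "\<dots> = exp (- (x powr s)) * (B * exp ((A + M) * (1 + cmod w) powr s))"
      by (simp add: exp_add[symmetric] algebra_simps)
    also have "\<dots> \<le> b R"
      unfolding b_def using * AB by (intro mult_left_mono) auto
    finally show ?thesis .
  qed
  \<comment> \<open>Inside the doubled disc the maximum principle is used. Its radius is at most
    1/2, so boundary points lie within distance 1 of z and 1 + |w| at most doubles, whence the
    factor 2^s.\<close>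
  have G_all: "cmod (G z) \<le> b (1 + cmod z)" for z
  proof (cases "cmod (z - of_real p) \<ge> 2 * \<rho>")
    case True
    then show ?thesis by (rule far_le) simp
  next
    case False
    show ?thesis
    proof (rule norm_le_on_cball[OF G(1), of "of_real p" "2 * \<rho>"])
      show "cmod (G w) \<le> b (1 + cmod z)" if w: "cmod (w - of_real p) = 2 * \<rho>" for w
      proof (rule far_le)
        have "cmod (w - z) \<le> cmod (w - of_real p) + cmod (z - of_real p)"
          using norm_triangle_ineq4[of "w - of_real p" "z - of_real p"] by simp
        then have "cmod (w - z) \<le> 1" using False w \<rho> by simp
        then show "1 + cmod w \<le> 2 * (1 + cmod z)"
          by (rule norm_le_double)
      qed (use w in auto)
    qed (use False \<rho> in auto)
  qed
  show ?thesis
    using G G_far G_all unfolding x_def b_def by (intro exI[of _ G] conjI allI impI)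
qed

text \<open>Here \<gamma> is the sum of the interpolation terms. Near a zero of \<alpha> the
  matching term gives \<open>\<gamma> \<beta> = 1\<close> up to O(|\<alpha>|), and all others are
  O(|\<alpha>|) by their bounds off their own discs; so \<alpha> divides
  \<open>\<gamma> \<beta> - 1\<close>.\<close>

theorem corona_from_discs:
  fixes \<alpha> \<beta> :: "complex \<Rightarrow> complex" and \<mu> \<rho> :: "nat \<Rightarrow> real"
  assumes R: "\<alpha> \<in> R_ring t" "\<beta> \<in> R_ring t" and t: "0 \<le> t" "t \<le> s" and s: "s > 0" and K: "K \<ge> 0"
    and zeros: "\<And>z. \<alpha> z = 0 \<Longrightarrow> \<exists>j. z = of_real (\<mu> j)"
    and \<rho>: "\<And>j. 0 < \<rho> j" "\<And>j. \<rho> j \<le> 1 / 4"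
    and sep: "\<And>j k. j \<noteq> k \<Longrightarrow> \<bar>\<mu> j - \<mu> k\<bar> \<ge> 4 * \<rho> j"
    and \<beta>_nz: "\<And>j z. \<alpha> (of_real (\<mu> j)) = 0 \<Longrightarrow> cmod (z - of_real (\<mu> j)) \<le> \<rho> j \<Longrightarrow> \<beta> z \<noteq> 0"
    and lower: "\<And>j z. \<alpha> (of_real (\<mu> j)) = 0 \<Longrightarrow> cmod (z - of_real (\<mu> j)) = \<rho> j \<Longrightarrow>
        exp (- K * (1 + \<bar>\<mu> j\<bar>) powr s) \<le> cmod (\<alpha> z * \<beta> z)"
    and lower_\<alpha>: "\<And>z. (\<And>j. cmod (z - of_real (\<mu> j)) \<ge> 2 * \<rho> j) \<Longrightarrow>
        exp (- K * (1 + cmod z) powr s) \<le> cmod (\<alpha> z)"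
    and summable: "summable (\<lambda>j. exp (- ((1 + \<bar>\<mu> j\<bar>) powr s)))"
  obtains \<gamma> \<delta> where "\<gamma> \<in> R_ring s" "\<delta> \<in> R_ring s" "\<And>z. \<gamma> z * \<beta> z - \<alpha> z * \<delta> z = 1"
proof -
  have hol: "\<alpha> holomorphic_on UNIV" "\<beta> holomorphic_on UNIV"
    using R by (auto intro: R_ring_holomorphic)
  obtain A B where A: "A > 0" and B: "B > 0"
    and \<alpha>_le: "\<And>z. cmod (\<alpha> z) \<le> B * exp (A * (1 + cmod z) powr s)"
    using R_ring_D[OF R(1) t] by metis
  obtain A' B' where A': "A' > 0" and B': "B' > 0"
    and \<beta>_le: "\<And>z. cmod (\<beta> z) \<le> B' * exp (A' * (1 + cmod z) powr s)"
    using R_ring_D[OF R(2) t] by metis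
  have sep': "4 * \<rho> k \<le> cmod (of_real (\<mu> j) - of_real (\<mu> k))" 
             "4 * \<rho> j \<le> cmod (of_real (\<mu> j) - of_real (\<mu> k))" if "j \<noteq> k" for j k
    using sep[of j k] sep[of k j] that by (auto simp: abs_minus_commute simp flip: of_real_diff)
  \<comment> \<open>Both 4 \<rho>_j and 4 \<rho>_k are at most the distance of the centres, hence so
    is their mean 2 \<rho>_j + 2 \<rho>_k: a point in one closed doubled disc is outside the open
    others.\<close>
  have far: "cmod (z - of_real (\<mu> k)) \<ge> 2 * \<rho> k"
    if "j \<noteq> k" "cmod (z - of_real (\<mu> j)) \<le> 2 * \<rho> j" for j k z
  proof -
    have "cmod (of_real (\<mu> j) - of_real (\<mu> k) :: complex) \<le> cmod (z - of_real (\<mu> j)) + cmod (z - of_real (\<mu> k))"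
      using norm_triangle_ineq4[of "z - of_real (\<mu> k)" "z - of_real (\<mu> j)"] by simp
    with sep'[OF that(1)] that(2) show ?thesis by linarith
  qed
  have nz: "\<alpha> (2 * \<i>) \<noteq> 0" using zeros[of "2 * \<i>"] by (auto simp: complex_eq_iff)

  \<comment> \<open>The interpolation terms and their weights\<close>
  define M where "M = ((K + 2) / s + (K + 1) * 3 powr s) * 6 powr s"
  have M: "M \<ge> 0" using K s by (simp add: M_def)
  define c where "c = (\<lambda>j. exp (- ((1 + \<bar>\<mu> j\<bar>) powr s)))"
  have c: "summable c" "\<And>j. c j \<ge> 0" using summable by (auto simp: c_def)
  define \<sigma> where "\<sigma> = suminf c"
  have \<sigma>: "\<sigma> \<ge> 0" unfolding \<sigma>_def using c by (intro suminf_nonneg)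
  define b where "b = (\<lambda>R::real. B * exp ((A + M) * 2 powr s * R powr s))"
  define d where "d = (\<lambda>R::real. exp (M * R powr s))"
  \<comment> \<open>An index whose \<open>\<mu> j\<close> is not a zero of \<alpha> receives the
    term 0; this is why the interpolation clause is conditional.\<close>
  define P where "P = (\<lambda>j G. G holomorphic_on UNIV \<and>
    (\<forall>z. cmod (z - of_real (\<mu> j)) \<ge> 2 * \<rho> j \<longrightarrow> cmod (G z) \<le> cmod (\<alpha> z) * (c j * d (1 + cmod z))) \<and>
    (\<forall>z. cmod (G z) \<le> c j * b (1 + cmod z)) \<and>
    (\<alpha> (of_real (\<mu> j)) = 0 \<longrightarrow>
      (\<exists>C. eventually (\<lambda>z. cmod (G z * \<beta> z - 1) \<le> C * cmod (\<alpha> z)) (nhds (of_real (\<mu> j))))))"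
  have "\<exists>G. P j G" for j
  proof (cases "\<alpha> (of_real (\<mu> j)) = 0")
    case False
    have "P j (\<lambda>_. 0)"
      using False c(2)[of j] B by (auto simp: P_def b_def d_def)
    then show ?thesis by blast
  next
    case True
    have za: "\<alpha> z \<noteq> 0" if z: "z \<in> cball (of_real (\<mu> j)) (\<rho> j)" "z \<noteq> of_real (\<mu> j)" for z
    proof
      assume "\<alpha> z = 0"
      then obtain k where k: "z = of_real (\<mu> k)" using zeros by blast
      then have "k \<noteq> j" using z by auto
      from far[of j k z] show False
        using \<open>k \<noteq> j\<close> k z \<rho>(1)[of k] \<rho>(1)[of j] by (auto simp: dist_norm norm_minus_commute)
    qed
    have zb: "\<beta> z \<noteq> 0" if "z \<in> cball (of_real (\<mu> j)) (\<rho> j)" for z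
      using \<beta>_nz[OF True, of z] that by (simp add: dist_norm norm_minus_commute)
    have "\<exists>G. G holomorphic_on UNIV \<and>
      (\<forall>z. cmod (z - of_real (\<mu> j)) \<ge> 2 * \<rho> j \<longrightarrow> cmod (G z) \<le> cmod (\<alpha> z) * (c j * d (1 + cmod z))) \<and>
      (\<forall>z. cmod (G z) \<le> c j * b (1 + cmod z)) \<and>
      (\<exists>C. eventually (\<lambda>z. cmod (G z * \<beta> z - 1) \<le> C * cmod (\<alpha> z)) (nhds (of_real (\<mu> j))))"
      unfolding c_def b_def d_def M_def
      by (rule interpolation_term[OF hol nz \<rho>(1) \<rho>(2) K s less_imp_le[OF A] less_imp_le[OF B]
            \<alpha>_le za zb lower[OF True]])
    then obtain G where "P j G" unfolding P_def by (elim exE conjE) blast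
    then show ?thesis by blast
  qed
  then obtain G where PG: "\<And>j. P j (G j)"
    by metis
  have G: "G j holomorphic_on UNIV"
    and G_far: "cmod (z - of_real (\<mu> j)) \<ge> 2 * \<rho> j \<Longrightarrow>
        cmod (G j z) \<le> cmod (\<alpha> z) * (c j * d (1 + cmod z))"
    and G_all: "cmod (G j z) \<le> c j * b (1 + cmod z)"
    and G_near: "\<alpha> (of_real (\<mu> j)) = 0 \<Longrightarrow>
        \<exists>C. eventually (\<lambda>z. cmod (G j z * \<beta> z - 1) \<le> C * cmod (\<alpha> z)) (nhds (of_real (\<mu> j)))"
    for j z
    using PG[of j] unfolding P_def by simp_all
  have b_mono: "b R \<le> b R'" if "0 \<le> R" "R \<le> R'" for R R'
    unfolding b_def using that A B M s by (intro mult_left_mono) (auto intro!: mult_left_mono powr_mono2)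
  have d_mono: "d R \<le> d R'" if "0 \<le> R" "R \<le> R'" for R R'
    unfolding d_def using that M s by (auto intro!: mult_left_mono powr_mono2)
  have summable_G: "summable (\<lambda>j. cmod (G j z))" for z
    by (rule summable_comparison_test'[OF summable_mult2[OF c(1), of "b (1 + cmod z)"], of 0])
       (use G_all in auto)

  \<comment> \<open>The series for \<gamma>\<close>
  define \<gamma> where "\<gamma> = (\<lambda>z. \<Sum>j. G j z)"
  have \<gamma>_hol: "\<gamma> holomorphic_on UNIV"
  proof (rule holomorphic_uniform_sequence[of UNIV "\<lambda>n z. \<Sum>j<n. G j z"])
    fix z :: complex
    have "uniform_limit (cball z 1) (\<lambda>n z. \<Sum>j<n. G j z) \<gamma> sequentially"
      unfolding \<gamma>_def
    proof (rule Weierstrass_m_test)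
      show "summable (\<lambda>j. c j * b (2 + cmod z))" by (intro summable_mult2 c)
      show "cmod (G j w) \<le> c j * b (2 + cmod z)" if "w \<in> cball z 1" for j w
      proof -
        have "1 + cmod w \<le> 2 + cmod z"
          using that norm_triangle_ineq[of "w - z" z] by (simp add: dist_norm norm_minus_commute)
        then have "c j * b (1 + cmod w) \<le> c j * b (2 + cmod z)"
          by (intro mult_left_mono b_mono c) auto
        with G_all[of j w] show ?thesis by linarith
      qed
    qed
    then show "\<exists>d>0. cball z d \<subseteq> UNIV \<and> uniform_limit (cball z d) (\<lambda>n z. \<Sum>j<n. G j z) \<gamma> sequentially"
      by (intro exI[of _ 1]) auto
  qed (auto intro!: holomorphic_intros G)
  have \<gamma>_le: "cmod (\<gamma> z) \<le> \<sigma> * b (1 + cmod z)" for z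
  proof -
    have "cmod (\<gamma> z) \<le> (\<Sum>j. cmod (G j z))"
      unfolding \<gamma>_def by (rule summable_norm[OF summable_G])
    also have "\<dots> \<le> (\<Sum>j. c j * b (1 + cmod z))"
      by (intro suminf_le summable_G summable_mult2 c G_all)
    also have "\<dots> = \<sigma> * b (1 + cmod z)"
      unfolding \<sigma>_def by (rule suminf_mult2[OF c(1), symmetric])
    finally show ?thesis .
  qed
  have \<gamma>_R: "\<gamma> \<in> R_ring s"
  proof (rule R_ring_I[OF \<gamma>_hol s])
    show "cmod (\<gamma> z) \<le> (\<sigma> * B) * exp ((A + M) * 2 powr s * (1 + cmod z) powr s)" for z
      using \<gamma>_le[of z] by (simp add: b_def mult_ac)
  qed (use A B M \<sigma> in auto)
  \<comment> \<open>Stated for arbitrary terms \<open>H\<close>, since it serves twice: for the full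
    series off all discs, and near a zero for the series with one term removed.\<close>
  have far_sum: "cmod (\<Sum>j. H j) \<le> cmod (\<alpha> z) * (\<sigma> * d (1 + cmod z))"
    if H: "\<And>j. cmod (H j) \<le> cmod (\<alpha> z) * (c j * d (1 + cmod z))" for H z
  proof -
    have 1: "summable (\<lambda>j. cmod (\<alpha> z) * (c j * d (1 + cmod z)))"
      by (intro summable_mult summable_mult2 c)
    have 2: "summable (\<lambda>j. cmod (H j))"
      by (rule summable_comparison_test'[OF 1, of 0]) (use H in auto)
    have "cmod (\<Sum>j. H j) \<le> (\<Sum>j. cmod (H j))"
      by (rule summable_norm[OF 2])
    also have "\<dots> \<le> (\<Sum>j. cmod (\<alpha> z) * (c j * d (1 + cmod z)))"
      by (intro suminf_le 1 2 H)
    also have "\<dots> = cmod (\<alpha> z) * (\<sigma> * d (1 + cmod z))"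
      unfolding \<sigma>_def by (simp add: suminf_mult suminf_mult2[symmetric] summable_mult2 c)
    finally show ?thesis .
  qed

  \<comment> \<open>Divisibility by \<alpha>\<close>
  define f where "f = (\<lambda>z. \<gamma> z * \<beta> z - 1)"
  obtain \<delta> where \<delta>: "\<delta> holomorphic_on UNIV" "\<And>z. f z = \<alpha> z * \<delta> z"
  proof (rule entire_quotient[of f \<alpha> "2 * \<i>"])
    show "f holomorphic_on UNIV" unfolding f_def by (intro holomorphic_intros \<gamma>_hol hol)
    show "\<exists>C. eventually (\<lambda>z. cmod (f z) \<le> C * cmod (\<alpha> z)) (nhds p)" if p: "\<alpha> p = 0" for p
    proof -
      from zeros[OF p] obtain j where j: "p = of_real (\<mu> j)" by blast
      obtain C where C: "eventually (\<lambda>z. cmod (G j z * \<beta> z - 1) \<le> C * cmod (\<alpha> z)) (nhds p)"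
        using G_near[of j] j p by blast
      define C' where "C' = C + (\<sigma> * d (2 + cmod p)) * (B' * exp (A' * (2 + cmod p) powr s))"
      have "eventually (\<lambda>z. z \<in> ball p (\<rho> j)) (nhds p)"
        using \<rho>(1)[of j] by (intro eventually_nhds_in_open) auto
      then have "eventually (\<lambda>z. cmod (f z) \<le> C' * cmod (\<alpha> z)) (nhds p)"
        using C
      proof eventually_elim
        case (elim z)
        have z: "cmod (z - of_real (\<mu> j)) \<le> \<rho> j"
          using elim(1) by (simp add: j dist_norm norm_minus_commute)
        then have "cmod z \<le> 1 + cmod p"
          using norm_triangle_ineq[of "z - p" p] \<rho>(2)[of j] by (simp add: j)
        then have zp: "1 + cmod z \<le> 2 + cmod p" by simp
        \<comment> \<open>The series at z with the j-th term deleted; that term alone is compared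
          with 1 / \<beta>.\<close>
        define H where "H = (\<lambda>k. if k = j then 0 else G k z)"
        have sG: "summable (\<lambda>k. G k z)" using summable_G by (rule summable_norm_cancel)
        have "(\<lambda>k. if k = j then G k z else 0) sums G j z"
          by (rule sums_single)
        then have "(\<lambda>k. G k z - (if k = j then G k z else 0)) sums (\<gamma> z - G j z)"
          unfolding \<gamma>_def by (intro sums_diff summable_sums sG)
        moreover have "(\<lambda>k. G k z - (if k = j then G k z else 0)) = H"
          by (auto simp: H_def)
        ultimately have \<gamma>: "\<gamma> z = G j z + (\<Sum>k. H k)"
          by (simp add: sums_iff)
        have "cmod (\<Sum>k. H k) \<le> cmod (\<alpha> z) * (\<sigma> * d (1 + cmod z))"
        proof (rule far_sum)
          fix k
          show "cmod (H k) \<le> cmod (\<alpha> z) * (c k * d (1 + cmod z))"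
          proof (cases "k = j")
            case True
            then show ?thesis using c by (simp add: H_def d_def)
          next
            case False
            then show ?thesis using G_far[OF far[of j k z]] z \<rho>(1)[of j] by (simp add: H_def)
          qed
        qed
        also have "\<dots> \<le> cmod (\<alpha> z) * (\<sigma> * d (2 + cmod p))"
          using d_mono[OF _ zp] \<sigma> by (intro mult_left_mono) auto
        finally have 1: "cmod (\<Sum>k. H k) \<le> cmod (\<alpha> z) * (\<sigma> * d (2 + cmod p))" .
        have "cmod (\<beta> z) \<le> B' * exp (A' * (1 + cmod z) powr s)" by (rule \<beta>_le)
        also have "\<dots> \<le> B' * exp (A' * (2 + cmod p) powr s)"
          using A' B' s zp by (auto intro!: mult_left_mono powr_mono2)
        finally have "cmod (\<Sum>k. H k) * cmod (\<beta> z) \<le>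
            (cmod (\<alpha> z) * (\<sigma> * d (2 + cmod p))) * (B' * exp (A' * (2 + cmod p) powr s))"
          using 1 \<sigma> by (intro mult_mono) (auto simp: d_def)
        moreover have "f z = (G j z * \<beta> z - 1) + (\<Sum>k. H k) * \<beta> z"
          by (simp add: f_def \<gamma> algebra_simps)
        then have "cmod (f z) \<le> cmod (G j z * \<beta> z - 1) + cmod (\<Sum>k. H k) * cmod (\<beta> z)"
          by (metis norm_mult norm_triangle_ineq)
        ultimately show ?case using elim(2) by (simp add: C'_def algebra_simps)
      qed
      then show ?thesis by blast
    qed
  qed (use hol nz in auto)

  \<comment> \<open>Growth of \<delta>\<close>
  have \<delta>_far: "cmod (\<delta> z) \<le> (\<sigma> * B' + 1) * exp ((M + A' + K) * (1 + cmod z) powr s)"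
    if z: "\<And>j. cmod (z - of_real (\<mu> j)) \<ge> 2 * \<rho> j" for z
  proof -
    define X where "X = (1 + cmod z) powr s"
    have X: "X \<ge> 0" by (simp add: X_def)
    have low: "exp (- K * X) \<le> cmod (\<alpha> z)" unfolding X_def by (rule lower_\<alpha>[OF z])
    then have \<alpha>0: "cmod (\<alpha> z) > 0" using less_le_trans[OF exp_gt_zero] by blast
    \<comment> \<open>The factor |\<alpha>| carried by \<gamma> cancels upon division; the lower
      bound on \<alpha> is spent only on the summand 1.\<close>
    have "cmod (\<gamma> z) \<le> cmod (\<alpha> z) * (\<sigma> * d (1 + cmod z))"
      unfolding \<gamma>_def by (rule far_sum) (rule G_far[OF z])
    then have "cmod (\<gamma> z) * cmod (\<beta> z) \<le> (cmod (\<alpha> z) * (\<sigma> * d (1 + cmod z))) * (B' * exp (A' * X))"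
      using \<beta>_le[of z] \<sigma> by (intro mult_mono) (auto simp: d_def X_def)
    moreover have "1 \<le> cmod (\<alpha> z) * exp (K * X)"
      using low by (simp add: exp_minus field_simps)
    moreover have "cmod (f z) \<le> cmod (\<gamma> z) * cmod (\<beta> z) + 1"
      unfolding f_def by (metis norm_mult norm_one norm_triangle_ineq4)
    ultimately have "cmod (\<alpha> z) * cmod (\<delta> z) \<le>
        cmod (\<alpha> z) * (\<sigma> * d (1 + cmod z) * (B' * exp (A' * X)) + exp (K * X))"
      by (simp add: \<delta>(2) norm_mult algebra_simps)
    then have "cmod (\<delta> z) \<le> \<sigma> * d (1 + cmod z) * (B' * exp (A' * X)) + exp (K * X)"
      using \<alpha>0 by simp
    also have "\<dots> = \<sigma> * B' * exp ((M + A') * X) + exp (K * X)"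
      by (simp add: d_def X_def exp_add algebra_simps)
    also have "\<dots> \<le> \<sigma> * B' * exp ((M + A' + K) * X) + exp ((M + A' + K) * X)"
      using \<sigma> A' B' K M X by (intro add_mono mult_left_mono) (auto intro!: mult_right_mono)
    finally show ?thesis by (simp add: X_def algebra_simps)
  qed
  \<comment> \<open>A point in an open doubled disc is reached from its boundary circle, which lies
    outside all open doubled discs, by the maximum principle.\<close>
  have \<delta>_R: "\<delta> \<in> R_ring s"
  proof (rule R_ring_I[OF \<delta>(1) s])
    show "cmod (\<delta> z) \<le> (\<sigma> * B' + 1) * exp ((M + A' + K) * 2 powr s * (1 + cmod z) powr s)" for z
    proof -
      have *: "cmod (\<delta> w) \<le> (\<sigma> * B' + 1) * exp ((M + A' + K) * 2 powr s * (1 + cmod z) powr s)"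
        if w: "\<And>j. cmod (w - of_real (\<mu> j)) \<ge> 2 * \<rho> j" "1 + cmod w \<le> 2 * (1 + cmod z)" for w
      proof -
        have "(1 + cmod w) powr s \<le> (2 * (1 + cmod z)) powr s" using w(2) s by (intro powr_mono2) auto
        also have "\<dots> = 2 powr s * (1 + cmod z) powr s" by (rule powr_mult)
        finally have "(M + A' + K) * (1 + cmod w) powr s \<le> (M + A' + K) * (2 powr s * (1 + cmod z) powr s)"
          using M A' K by (intro mult_left_mono) auto
        then have "(\<sigma> * B' + 1) * exp ((M + A' + K) * (1 + cmod w) powr s)
           \<le> (\<sigma> * B' + 1) * exp ((M + A' + K) * 2 powr s * (1 + cmod z) powr s)"
          using \<sigma> B' by (intro mult_left_mono) (auto simp: mult.assoc)
        with \<delta>_far[OF w(1)] show ?thesis by linarith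
      qed
      show ?thesis
      proof (cases "\<forall>j. cmod (z - of_real (\<mu> j)) \<ge> 2 * \<rho> j")
        case True
        then show ?thesis by (intro *) auto
      next
        case False
        then obtain j where j: "cmod (z - of_real (\<mu> j)) < 2 * \<rho> j" by (meson not_le)
        show ?thesis
        proof (rule norm_le_on_cball[OF \<delta>(1), of "of_real (\<mu> j)" "2 * \<rho> j"])
          fix w assume w: "cmod (w - of_real (\<mu> j)) = 2 * \<rho> j"
          show "cmod (\<delta> w) \<le> (\<sigma> * B' + 1) * exp ((M + A' + K) * 2 powr s * (1 + cmod z) powr s)"
          proof (rule *)
            show "2 * \<rho> k \<le> cmod (w - of_real (\<mu> k))" for k
              using w far[of j k w] by (cases "k = j") auto
            have "cmod (w - z) \<le> cmod (w - of_real (\<mu> j)) + cmod (z - of_real (\<mu> j))"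
              using norm_triangle_ineq4[of "w - of_real (\<mu> j)" "z - of_real (\<mu> j)"] by simp
            then have "cmod (w - z) \<le> 1" using j w \<rho>(2)[of j] by simp
            then show "1 + cmod w \<le> 2 * (1 + cmod z)"
              by (rule norm_le_double)
          qed
        qed (use j \<rho>(1)[of j] in auto)
      qed
    qed
  qed (use M A' K \<sigma> B' in auto)
  show ?thesis
  proof (rule that[OF \<gamma>_R \<delta>_R])
    show "\<gamma> z * \<beta> z - \<alpha> z * \<delta> z = 1" for z
      using \<delta>(2)[of z] by (simp add: f_def algebra_simps)
  qed
qed

section \<open>Algebra of the growth classes and symmetrisation\<close>

lemma R_ring_mult:
  assumes f: "f \<in> R_ring s" and g: "g \<in> R_ring s"
  shows "(\<lambda>z. f z * g z) \<in> R_ring s"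
proof -
  obtain A B A' B' where AB: "A > 0" "B > 0" "A' > 0" "B' > 0"
    and le: "\<And>z. cmod (f z) \<le> B * exp (A * cmod z powr s)"
      "\<And>z. cmod (g z) \<le> B' * exp (A' * cmod z powr s)"
    using f g unfolding R_ring_def by blast
  have "cmod (f z * g z) \<le> (B * B') * exp ((A + A') * cmod z powr s)" for z
  proof -
    have "cmod (f z * g z) \<le> (B * exp (A * cmod z powr s)) * (B' * exp (A' * cmod z powr s))"
      unfolding norm_mult using AB by (intro mult_mono le) auto
    then show ?thesis by (simp add: exp_add algebra_simps)
  qed
  moreover have "(\<lambda>z. f z * g z) holomorphic_on UNIV"
    using f g by (intro holomorphic_intros R_ring_holomorphic)
  moreover have "A + A' > 0" "B * B' > 0" using AB by auto
  ultimately show ?thesis unfolding R_ring_def by blast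
qed

lemma R_ring_add:
  assumes f: "f \<in> R_ring s" and g: "g \<in> R_ring s"
  shows "(\<lambda>z. f z + g z) \<in> R_ring s"
proof -
  obtain A B A' B' where AB: "A > 0" "B > 0" "A' > 0" "B' > 0"
    and le: "\<And>z. cmod (f z) \<le> B * exp (A * cmod z powr s)"
      "\<And>z. cmod (g z) \<le> B' * exp (A' * cmod z powr s)"
    using f g unfolding R_ring_def by blast
  have "cmod (f z + g z) \<le> (B + B') * exp ((A + A') * cmod z powr s)" for z
  proof -
    have "cmod (f z + g z) \<le> B * exp (A * cmod z powr s) + B' * exp (A' * cmod z powr s)"
      using norm_triangle_ineq[of "f z" "g z"] le[of z] by linarith
    also have "\<dots> \<le> B * exp ((A + A') * cmod z powr s) + B' * exp ((A + A') * cmod z powr s)"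
      using AB by (intro add_mono mult_left_mono) (auto intro!: mult_right_mono)
    finally show ?thesis by (simp add: distrib_right)
  qed
  moreover have "(\<lambda>z. f z + g z) holomorphic_on UNIV"
    using f g by (intro holomorphic_intros R_ring_holomorphic)
  moreover have "A + A' > 0" "B + B' > 0" using AB by auto
  ultimately show ?thesis unfolding R_ring_def by blast
qed

lemma R_ring_const: "(\<lambda>_. w) \<in> R_ring s"
proof -
  have "cmod w \<le> (cmod w + 1) * exp (1 * cmod z powr s)" for z
    using mult_left_mono[of 1 "exp (1 * cmod z powr s)" "cmod w + 1"] by simp
  moreover have "cmod w + 1 > 0" by (simp add: add_nonneg_pos)
  ultimately have "\<exists>A>0. \<exists>B>0. \<forall>z. cmod w \<le> B * exp (A * cmod z powr s)"
    using zero_less_one by blast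
  then show ?thesis by (simp add: R_ring_def)
qed

lemma R_ring_reflect:
  assumes f: "f \<in> R_ring s"
  shows "(\<lambda>z. cnj (f (cnj z))) \<in> R_ring s"
proof -
  obtain A B where AB: "A > 0" "B > 0" and le: "\<And>z. cmod (f z) \<le> B * exp (A * cmod z powr s)"
    using f unfolding R_ring_def by blast
  have "(cnj \<circ> f \<circ> cnj) holomorphic_on UNIV"
    using R_ring_holomorphic[OF f] by (subst holomorphic_on_compose_cnj_cnj) auto
  moreover have "cmod (cnj (f (cnj z))) \<le> B * exp (A * cmod z powr s)" for z
    using le[of "cnj z"] by simp
  ultimately show ?thesis
    unfolding R_ring_def using AB by (auto simp: o_def)
qed

text \<open>Schwarz reflection by the identity theorem: both sides, suitably conjugated, are entire
  and agree on the real axis.\<close>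

lemma real_entire_cnj:
  assumes f: "real_entire f"
  shows "f (cnj z) = cnj (f z)"
proof -
  have hol: "f holomorphic_on UNIV" using f by (simp add: real_entire_def)
  have hol': "(\<lambda>z. cnj (f (cnj z))) holomorphic_on UNIV"
  proof -
    have "range cnj = UNIV" by (metis complex_cnj_cnj surjI)
    then show ?thesis using hol holomorphic_on_compose_cnj_cnj[of f UNIV] by (simp add: o_def)
  qed
  have "f z - cnj (f (cnj z)) = 0"
  proof (rule analytic_continuation[of "\<lambda>z. f z - cnj (f (cnj z))" UNIV "range of_real" 0])
    show "(\<lambda>z. f z - cnj (f (cnj z))) holomorphic_on UNIV"
      by (intro holomorphic_intros hol hol')
    show "f w - cnj (f (cnj w)) = 0" if "w \<in> range of_real" for w
      using that f by (auto simp: real_entire_def Reals_cnj_iff)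
    show "0 islimpt range complex_of_real"
      unfolding islimpt_approachable
    proof (intro allI impI)
      fix e :: real assume "e > 0"
      then show "\<exists>x'\<in>range complex_of_real. x' \<noteq> 0 \<and> dist x' 0 < e"
        by (intro bexI[OF _ rangeI[of of_real "e / 2"]]) auto
    qed
  qed auto
  then show ?thesis by (metis complex_cnj_cnj eq_iff_diff_eq_0)
qed

text \<open>Since \<alpha> and \<beta> are real, conjugating the equation at \<open>cnj z\<close>
  gives another solution pair. The equation is affine in the pair, so the average of both solves it
  too, and it is real on the real axis.\<close>

lemma bezout_real_entire:
  assumes R: "\<gamma> \<in> R_ring s" "\<delta> \<in> R_ring s" and eq: "\<And>z. \<gamma> z * \<beta> z - \<alpha> z * \<delta> z = 1"
    and real: "real_entire \<alpha>" "real_entire \<beta>"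
  obtains \<gamma>' \<delta>' where "\<gamma>' \<in> R_ring s" "\<delta>' \<in> R_ring s" "real_entire \<gamma>'" "real_entire \<delta>'"
    "\<And>z. \<gamma>' z * \<beta> z - \<alpha> z * \<delta>' z = 1"
proof -
  define S where "S = (\<lambda>f z. 1 / 2 * (f z + cnj (f (cnj z))))"
  have S_R: "S f \<in> R_ring s" if "f \<in> R_ring s" for f
    unfolding S_def by (intro R_ring_mult R_ring_const R_ring_add R_ring_reflect that)
  have S_real: "real_entire (S f)" if "f \<in> R_ring s" for f
  proof -
    have "S f (of_real x) \<in> \<real>" for x :: real
      by (simp add: S_def complex_is_Real_iff)
    then show ?thesis
      using R_ring_holomorphic[OF S_R[OF that]] by (simp add: real_entire_def)
  qed
  have "S \<gamma> z * \<beta> z - \<alpha> z * S \<delta> z = 1" for z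
  proof -
    have "cnj (\<gamma> (cnj z) * \<beta> (cnj z) - \<alpha> (cnj z) * \<delta> (cnj z)) = 1"
      by (simp add: eq)
    then have "cnj (\<gamma> (cnj z)) * \<beta> z - \<alpha> z * cnj (\<delta> (cnj z)) = 1"
      by (simp add: real_entire_cnj[OF real(1)] real_entire_cnj[OF real(2)])
    moreover have "S \<gamma> z * \<beta> z - \<alpha> z * S \<delta> z = 1 / 2 * ((\<gamma> z * \<beta> z - \<alpha> z * \<delta> z) +
        (cnj (\<gamma> (cnj z)) * \<beta> z - \<alpha> z * cnj (\<delta> (cnj z))))"
      by (simp add: S_def algebra_simps)
    ultimately show ?thesis by (simp add: eq)
  qed
  with S_R[OF R(1)] S_R[OF R(2)] S_real[OF R(1)] S_real[OF R(2)] show ?thesis by (rule that)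
qed

section \<open>Disc radii from the separation of the zeros\<close>

lemma powr_neg_le_one:
  fixes x r :: real
  assumes "x \<ge> 1" "r \<ge> 0"
  shows "x powr (- r) \<le> 1"
  using powr_mono[of "- r" 0 x] assms by simp

text \<open>Turns an eventual separation into one for all indices: the finitely many exceptions each
  admit some positive distance, and a common constant \<open>\<kappa>\<close> shrinks the weights
  below all of these.\<close>

lemma uniform_scale:
  fixes P :: "nat \<Rightarrow> real \<Rightarrow> bool" and w :: "nat \<Rightarrow> real"
  assumes ev: "eventually (\<lambda>j. P j (w j)) sequentially" and pos: "\<And>j. \<exists>e>0. P j e"
    and mono: "\<And>j e e'. P j e \<Longrightarrow> e' \<le> e \<Longrightarrow> P j e'" and w: "\<And>j. 0 < w j" "\<And>j. w j \<le> 1"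
  shows "\<exists>\<kappa>>0. \<kappa> \<le> 1 \<and> (\<forall>j. P j (\<kappa> * w j))"
proof -
  obtain N where N: "\<And>j. j \<ge> N \<Longrightarrow> P j (w j)"
    using ev by (auto simp: eventually_sequentially)
  have "\<exists>\<kappa>>0. \<kappa> \<le> 1 \<and> (\<forall>j<n. P j (\<kappa> * w j))" for n
  proof (induction n)
    case 0
    then show ?case by (intro exI[of _ 1]) auto
  next
    case (Suc n)
    then obtain \<kappa> where \<kappa>: "\<kappa> > 0" "\<kappa> \<le> 1" "\<And>j. j < n \<Longrightarrow> P j (\<kappa> * w j)" by blast
    obtain e where e: "e > 0" "P n e" using pos by blast
    define \<kappa>' where "\<kappa>' = min \<kappa> e"
    have \<kappa>': "\<kappa>' > 0" "\<kappa>' \<le> \<kappa>" "\<kappa>' \<le> e" using \<kappa> e by (auto simp: \<kappa>'_def)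
    have "P j (\<kappa>' * w j)" if "j < Suc n" for j
    proof (cases "j = n")
      case True
      have "\<kappa>' * w n \<le> e * 1" using \<kappa>' w[of n] less_imp_le[OF w(1)] by (intro mult_mono) auto
      then show ?thesis using mono[OF e(2)] True by simp
    next
      case False
      then have "P j (\<kappa> * w j)" using \<kappa>(3) that by simp
      then show ?thesis by (rule mono) (use \<kappa>' less_imp_le[OF w(1)] in \<open>intro mult_right_mono; auto\<close>)
    qed
    then show ?case using \<kappa>' \<kappa>(2) by (intro exI[of _ \<kappa>']) auto
  qed
  then obtain \<kappa> where \<kappa>: "\<kappa> > 0" "\<kappa> \<le> 1" "\<And>j. j < N \<Longrightarrow> P j (\<kappa> * w j)" by blast
  have "P j (\<kappa> * w j)" for j
  proof (cases "j < N")
    case False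
    have "\<kappa> * w j \<le> 1 * w j" using \<kappa> less_imp_le[OF w(1)] by (intro mult_right_mono) auto
    then show ?thesis using mono[OF N[of j]] False by simp
  qed (rule \<kappa>)
  then show ?thesis using \<kappa> by blast
qed

text \<open>The radii are a fixed multiple of (1 + |m_j|)^(-r): small enough to isolate the discs,
  large enough for the minimum modulus estimate to bound both \<alpha> and \<beta> from below on the
  circles.\<close>

theorem corona_of_separated_zeros:
  fixes \<alpha> \<beta> :: "complex \<Rightarrow> complex" and m :: "nat \<Rightarrow> real"
  assumes R: "\<alpha> \<in> R_ring t" "\<beta> \<in> R_ring t" and t: "0 \<le> t" "t < s" and r: "r \<ge> 0"
    and zeros: "\<And>z. \<alpha> z = 0 \<Longrightarrow> \<exists>j. z = of_real (m j)"
    and \<beta>i: "\<beta> \<i> \<noteq> 0"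
    and no_common: "\<And>z. \<alpha> z = 0 \<Longrightarrow> \<beta> z \<noteq> 0"
    and mono: "strict_mono m"
    and sep: "eventually (\<lambda>j. (\<forall>k. k \<noteq> j \<longrightarrow> (1 + \<bar>m j\<bar>) powr (- r) \<le> \<bar>m j - m k\<bar>) \<and>
        (\<forall>z. \<beta> z = 0 \<longrightarrow> (1 + \<bar>m j\<bar>) powr (- r) \<le> cmod (of_real (m j) - z))) sequentially"
    and summable: "summable (\<lambda>j. 1 / (1 + \<bar>m j\<bar> powr s))"
  obtains \<gamma> \<delta> where "\<gamma> \<in> R_ring s" "\<delta> \<in> R_ring s" "\<And>z. \<gamma> z * \<beta> z - \<alpha> z * \<delta> z = 1"
proof -
  have s: "s > 0" using t by simp
  have \<alpha>i: "\<alpha> \<i> \<noteq> 0" using zeros[of \<i>] by (auto simp: complex_eq_iff)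
  define w where "w = (\<lambda>j. (1 + \<bar>m j\<bar>) powr (- r))"
  have w: "0 < w j" "w j \<le> 1" for j
    unfolding w_def using r by (auto intro!: powr_neg_le_one simp: add_pos_nonneg)
  \<comment> \<open>The distance to zeros of \<beta> is asked for only at actual zeros of \<alpha>;
    at another \<open>m j\<close> the function \<beta> could vanish, and then no positive distance
    exists.\<close>
  define P where "P = (\<lambda>j e. (\<forall>k. k \<noteq> j \<longrightarrow> e \<le> \<bar>m j - m k\<bar>) \<and>
      (\<alpha> (of_real (m j)) = 0 \<longrightarrow> (\<forall>z. \<beta> z = 0 \<longrightarrow> e \<le> cmod (of_real (m j) - z))))"
  have "\<exists>\<kappa>>0. \<kappa> \<le> 1 \<and> (\<forall>j. P j (\<kappa> * w j))"
  proof (rule uniform_scale)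
    show "eventually (\<lambda>j. P j (w j)) sequentially"
      using sep by eventually_elim (auto simp: P_def w_def)
    show "P j e'" if "P j e" "e' \<le> e" for j e e'
      using that unfolding P_def by (meson order_trans)
    show "\<exists>e>0. P j e" for j
    proof -
      obtain e1 where e1: "e1 > 0" "\<And>k. k \<noteq> j \<Longrightarrow> e1 \<le> \<bar>m j - m k\<bar>"
      proof -
        define e1 where "e1 = (if j = 0 then m 1 - m 0 else min (m j - m (j - 1)) (m (Suc j) - m j))"
        have "e1 > 0" using mono by (auto simp: e1_def strict_mono_def)
        moreover have "e1 \<le> \<bar>m j - m k\<bar>" if "k \<noteq> j" for k
        proof (cases "k < j")
          case True
          then have "m k \<le> m (j - 1)" using strict_mono_less_eq[OF mono, of k "j - 1"] by simp
          then show ?thesis using True by (auto simp: e1_def)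
        next
          case False
          then have "m (Suc j) \<le> m k" using strict_mono_less_eq[OF mono, of "Suc j" k] that by simp
          then show ?thesis by (auto simp: e1_def)
        qed
        ultimately show ?thesis using that by blast
      qed
      obtain e2 where e2: "e2 > 0" "\<alpha> (of_real (m j)) = 0 \<Longrightarrow> \<beta> z = 0 \<Longrightarrow> e2 \<le> cmod (of_real (m j) - z)" for z
      proof (cases "\<alpha> (of_real (m j)) = 0")
        case True
        have "isCont \<beta> (of_real (m j))"
          using R_ring_holomorphic[OF R(2)]
          by (meson UNIV_I continuous_on_eq_continuous_at holomorphic_on_imp_continuous_on open_UNIV)
        then obtain e where "e > 0" "\<And>z. dist (of_real (m j)) z < e \<Longrightarrow> \<beta> z \<noteq> 0"
          using continuous_at_avoid[of "of_real (m j)" \<beta> 0] no_common[OF True] by blast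
        then show ?thesis using that[of e] by (force simp: dist_norm not_less[symmetric])
      next
        case False
        then show ?thesis using that[of 1] by simp
      qed
      have "P j (min e1 e2)" using e1 e2 unfolding P_def by (auto simp: min_le_iff_disj)
      then show ?thesis using e1 e2 by (intro exI[of _ "min e1 e2"]) auto
    qed
  qed (use w in auto)
  then obtain \<kappa> where \<kappa>: "\<kappa> > 0" "\<kappa> \<le> 1" and PK: "\<And>j. P j (\<kappa> * w j)" by blast
  define \<rho> where "\<rho> = (\<lambda>j. \<kappa> * w j / 4)"
  have \<rho>: "0 < \<rho> j" "\<rho> j \<le> 1 / 4" for j
    using \<kappa> w[of j] mult_mono[of \<kappa> 1 "w j" 1] by (auto simp: \<rho>_def)
  have sep_m: "4 * \<rho> j \<le> \<bar>m j - m k\<bar>" if "j \<noteq> k" for j k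
    using PK[of j] that by (auto simp: P_def \<rho>_def)
  have sep_\<beta>: "4 * \<rho> j \<le> cmod (of_real (m j) - z)" if "\<alpha> (of_real (m j)) = 0" "\<beta> z = 0" for j z
    using PK[of j] that by (auto simp: P_def \<rho>_def)
  \<comment> \<open>The radii depend on the centre, the minimum modulus estimate on z. If |m_j| <=
    |z| + 1, then 1 + |m_j| <= 2 (1 + |z|), and the exchange costs 2^(-r).\<close>
  define \<kappa>' where "\<kappa>' = \<kappa> / 4 * 2 powr (- r)"
  have "(2 :: real) powr (- r) \<le> 1" using r by (intro powr_neg_le_one) auto
  then have \<kappa>': "0 < \<kappa>'" "\<kappa>' \<le> 1"
    using \<kappa> mult_mono[of "\<kappa> / 4" 1 "2 powr (- r)" 1] by (auto simp: \<kappa>'_def)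
  have \<rho>_ge: "\<kappa>' * (1 + cmod z) powr (- r) \<le> \<rho> j" if "\<bar>m j\<bar> \<le> cmod z + 1" for j z
  proof -
    have "(2 * (1 + cmod z)) powr (- r) \<le> (1 + \<bar>m j\<bar>) powr (- r)"
    proof (rule powr_mono2')
      show "1 + \<bar>m j\<bar> \<le> 2 * (1 + cmod z)"
        using that norm_ge_zero[of z] unfolding distrib_left by linarith
    qed (use r in \<open>auto simp: add_pos_nonneg\<close>)
    then have "\<kappa> / 4 * (2 powr (- r) * (1 + cmod z) powr (- r)) \<le> \<kappa> / 4 * w j"
      using \<kappa> by (intro mult_left_mono) (auto simp: w_def powr_mult[symmetric])
    then show ?thesis by (simp add: \<kappa>'_def \<rho>_def)
  qed
  have \<kappa>'_le1: "\<kappa>' * (1 + cmod z) powr (- r) \<le> 1" for z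
    using \<kappa>' powr_neg_le_one[of "1 + cmod z" r] r mult_mono[of \<kappa>' 1 "(1 + cmod z) powr (- r)" 1] by simp
  obtain K1 where K1: "K1 \<ge> 0" "\<And>z. (\<And>a. \<alpha> a = 0 \<Longrightarrow> cmod (z - a) \<ge> \<kappa>' * (1 + cmod z) powr (- r)) \<Longrightarrow>
      cmod (\<alpha> z) \<ge> exp (- K1 * (1 + cmod z) powr s)"
    using minimum_modulus_entire[OF R(1) t \<alpha>i \<kappa>' r] by blast
  obtain K2 where K2: "K2 \<ge> 0" "\<And>z. (\<And>a. \<beta> a = 0 \<Longrightarrow> cmod (z - a) \<ge> \<kappa>' * (1 + cmod z) powr (- r)) \<Longrightarrow>
      cmod (\<beta> z) \<ge> exp (- K2 * (1 + cmod z) powr s)"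
    using minimum_modulus_entire[OF R(2) t \<beta>i \<kappa>' r] by blast
  have lower_\<alpha>: "exp (- K1 * (1 + cmod z) powr s) \<le> cmod (\<alpha> z)"
    if z: "\<And>j. cmod (z - of_real (m j)) \<ge> \<rho> j" for z
  proof (rule K1(2))
    fix a assume "\<alpha> a = 0"
    then obtain k where k: "a = of_real (m k)" using zeros by blast
    show "\<kappa>' * (1 + cmod z) powr (- r) \<le> cmod (z - a)"
    \<comment> \<open>A zero with |m_k| > |z| + 1 is farther than 1 from z, and 1 exceeds every
      required distance.\<close>
    proof (cases "\<bar>m k\<bar> \<le> cmod z + 1")
      case True
      then show ?thesis using \<rho>_ge[OF True] z[of k] k by simp
    next
      case False
      have "\<bar>m k\<bar> \<le> cmod (z - a) + cmod z"
        using norm_triangle_ineq4[of z "z - a"] k by simp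
      then show ?thesis using False \<kappa>'_le1[of z] by simp
    qed
  qed
  have circle: "\<rho> k \<le> cmod (z - of_real (m k))" if "cmod (z - of_real (m j)) = \<rho> j" for z j k
  proof (cases "k = j")
    case False
    have "\<bar>m j - m k\<bar> = cmod (of_real (m j) - of_real (m k))" by (simp flip: of_real_diff)
    also have "\<dots> \<le> cmod (z - of_real (m j)) + cmod (z - of_real (m k))"
      using norm_triangle_ineq4[of "z - of_real (m k)" "z - of_real (m j)"] by simp
    finally show ?thesis
      using sep_m[of j k] sep_m[of k j] False that \<rho>(1)[of k] \<rho>(1)[of j] by (simp add: abs_minus_commute)
  qed (use that in simp)
  \<comment> \<open>The factor 2^s moves the bound from points z of a circle to its centre, as 1 +
    |z| <= 2 (1 + |m_j|) there.\<close>
  define K where "K = (K1 + K2) * 2 powr s"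
  have K: "K \<ge> 0" using K1 K2 by (simp add: K_def)
  have two: "(1 :: real) \<le> 2 powr s" using s by (simp add: ge_one_powr_ge_zero)
  have "K1 \<le> (K1 + K2) * 1" using K2 by simp
  also have "\<dots> \<le> K" unfolding K_def using K1 K2 two by (intro mult_left_mono) auto
  finally have K1_le: "K1 \<le> K" .
  show ?thesis
  proof (rule corona_from_discs[OF R t(1) less_imp_le[OF t(2)] s K zeros \<rho> sep_m])
    show "\<beta> z \<noteq> 0" if "\<alpha> (of_real (m j)) = 0" "cmod (z - of_real (m j)) \<le> \<rho> j" for j z
      using sep_\<beta>[of j z] that \<rho>(1)[of j] by (auto simp: norm_minus_commute)
    show "exp (- K * (1 + \<bar>m j\<bar>) powr s) \<le> cmod (\<alpha> z * \<beta> z)"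
      if \<alpha>0: "\<alpha> (of_real (m j)) = 0" and z: "cmod (z - of_real (m j)) = \<rho> j" for j z
    proof -
      have mz: "\<bar>m j\<bar> \<le> cmod z + 1" "cmod z \<le> \<bar>m j\<bar> + 1"
        using norm_triangle_ineq2[of "of_real (m j)" z] norm_triangle_ineq2[of z "of_real (m j)"] z \<rho>(2)[of j]
        by (auto simp: norm_minus_commute)
      have 1: "exp (- K1 * (1 + cmod z) powr s) \<le> cmod (\<alpha> z)"
        by (rule lower_\<alpha>) (rule circle[OF z])
      have 2: "exp (- K2 * (1 + cmod z) powr s) \<le> cmod (\<beta> z)"
      proof (rule K2(2))
        fix b assume "\<beta> b = 0"
        from sep_\<beta>[OF \<alpha>0 this] have "4 * \<rho> j \<le> cmod (z - of_real (m j)) + cmod (z - b)"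
          using norm_triangle_ineq4[of "z - b" "z - of_real (m j)"] by simp
        then show "\<kappa>' * (1 + cmod z) powr (- r) \<le> cmod (z - b)"
          using z \<rho>_ge[OF mz(1)] \<rho>(1)[of j] by simp
      qed
      have "(1 + cmod z) powr s \<le> (2 * (1 + \<bar>m j\<bar>)) powr s"
        using mz s by (intro powr_mono2) auto
      also have "\<dots> = 2 powr s * (1 + \<bar>m j\<bar>) powr s" by (rule powr_mult)
      finally have "(K1 + K2) * (1 + cmod z) powr s \<le> K * (1 + \<bar>m j\<bar>) powr s"
        using mult_left_mono[of _ _ "K1 + K2"] K1 K2 unfolding K_def by (simp add: mult.assoc)
      then have "exp (- K * (1 + \<bar>m j\<bar>) powr s) \<le>
          exp (- K1 * (1 + cmod z) powr s) * exp (- K2 * (1 + cmod z) powr s)"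
        unfolding exp_add[symmetric] by (simp add: algebra_simps)
      also have "\<dots> \<le> cmod (\<alpha> z) * cmod (\<beta> z)" using 1 2 by (intro mult_mono) auto
      finally show ?thesis by (simp add: norm_mult)
    qed
    show "exp (- K * (1 + cmod z) powr s) \<le> cmod (\<alpha> z)"
      if z: "\<And>j. 2 * \<rho> j \<le> cmod (z - of_real (m j))" for z
    proof -
      have "\<rho> j \<le> cmod (z - of_real (m j))" for j using z[of j] \<rho>(1)[of j] by linarith
      then have "exp (- K1 * (1 + cmod z) powr s) \<le> cmod (\<alpha> z)" by (rule lower_\<alpha>)
      moreover have "exp (- K * (1 + cmod z) powr s) \<le> exp (- K1 * (1 + cmod z) powr s)"
        using K1_le by (simp add: mult_right_mono)
      ultimately show ?thesis by linarith
    qed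
    \<comment> \<open>The convergence exponent of the zeros enters here: X <= exp X gives exp (-X)
      <= 2 / (1 + |m_j|^s) for X = (1 + |m_j|)^s.\<close>
    show "summable (\<lambda>j. exp (- ((1 + \<bar>m j\<bar>) powr s)))"
    proof (rule summable_comparison_test'[OF summable_mult[OF summable, of 2], of 0])
      fix j :: nat
      define X where "X = (1 + \<bar>m j\<bar>) powr s"
      have X1: "X \<ge> 1" unfolding X_def using s by (intro ge_one_powr_ge_zero) auto
      have "\<bar>m j\<bar> powr s \<le> X" unfolding X_def using s by (intro powr_mono2) auto
      with X1 have "1 + \<bar>m j\<bar> powr s \<le> 2 * X" by simp
      moreover have "X \<le> exp X" using exp_ge_add_one_self[of X] by linarith
      ultimately have "1 + \<bar>m j\<bar> powr s \<le> 2 * exp X" by linarith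
      moreover have "1 + \<bar>m j\<bar> powr s > 0" by (simp add: add_pos_nonneg)
      ultimately have "exp (- X) \<le> 2 * (1 / (1 + \<bar>m j\<bar> powr s))"
        by (simp add: exp_minus field_simps)
      then show "norm (exp (- ((1 + \<bar>m j\<bar>) powr s))) \<le> 2 * (1 / (1 + \<bar>m j\<bar> powr s))"
        by (simp add: X_def)
    qed
  qed (assumption, assumption, rule that)
qed

section \<open>Solutions of the differential equation\<close>

lemma is_interval_atLeastAtMost_subset:
  fixes x y :: real
  assumes "is_interval I" "x \<in> I" "y \<in> I"
  shows "{x..y} \<subseteq> I"
  using assms unfolding is_interval_1 by (meson atLeastAtMost_iff subsetI)

text \<open>Carries the derivative along as data and fixes the representative (q - z) u of the
  second derivative, so that the equation becomes an integral equation without exceptional null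
  sets.\<close>

definition ode_pair ::
    "real set \<Rightarrow> (real \<Rightarrow> real) \<Rightarrow> complex \<Rightarrow> (real \<Rightarrow> complex) \<Rightarrow> (real \<Rightarrow> complex) \<Rightarrow> bool" where
  "ode_pair I q z u u1 \<longleftrightarrow> (\<forall>x\<in>I. (u has_vector_derivative u1 x) (at x)) \<and>
     AC_loc_deriv I u1 (\<lambda>x. (of_real (q x) - z) * u x)"

text \<open>The second derivative in \<open>solution\<close> is determined almost everywhere;
  replacing it by (q - z) u changes no integral.\<close>

lemma solution_iff_ode_pair:
  assumes I: "I \<in> sets lebesgue" "is_interval I"
  shows "solution I q z u \<longleftrightarrow> (\<exists>u1. ode_pair I q z u u1)"
proof
  assume "solution I q z u"
  then obtain u1 u2 where u1: "\<forall>x\<in>I. (u has_vector_derivative u1 x) (at x)"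
    and AC: "AC_loc_deriv I u1 u2"
    and ae: "AE x in lebesgue_on I. z * u x = - u2 x + of_real (q x) * u x"
    unfolding solution_def tau_rel_def ae_eq_def by blast
  have "AE x in lebesgue. x \<in> I \<longrightarrow> z * u x = - u2 x + of_real (q x) * u x"
    using ae I by (simp add: AE_restrict_space_iff)
  then obtain N where N: "negligible N" 
      "{x. \<not> (x \<in> I \<longrightarrow> z * u x = - u2 x + of_real (q x) * u x)} \<subseteq> N"
    unfolding eventually_ae_filter_negligible by blast
  have eq: "(of_real (q x) - z) * u x = u2 x" if "x \<in> I - N" for x
  proof -
    have "z * u x = - u2 x + of_real (q x) * u x" using N(2) that by blast
    then show ?thesis by (simp add: left_diff_distrib)
  qed
  have "AC_loc_deriv I u1 (\<lambda>x. (of_real (q x) - z) * u x)"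
    unfolding AC_loc_deriv_def
  proof (intro ballI impI)
    fix x y assume xy: "x \<in> I" "y \<in> I" "x \<le> y"
    have sub: "{x..y} \<subseteq> I"
      using xy I(2) by (simp add: is_interval_atLeastAtMost_subset)
    have u2: "u2 absolutely_integrable_on {x..y}" "u1 y - u1 x = integral {x..y} u2"
      using AC xy by (auto simp: AC_loc_deriv_def)
    have "(\<lambda>x. (of_real (q x) - z) * u x) absolutely_integrable_on {x..y}"
      by (rule absolutely_integrable_spike[OF u2(1) N(1)]) (rule eq, use sub in auto)
    moreover have "integral {x..y} u2 = integral {x..y} (\<lambda>x. (of_real (q x) - z) * u x)"
      by (rule integral_spike[OF N(1)]) (rule eq, use sub in auto)
    ultimately show "(\<lambda>x. (of_real (q x) - z) * u x) absolutely_integrable_on {x..y} \<and>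
        u1 y - u1 x = integral {x..y} (\<lambda>x. (of_real (q x) - z) * u x)"
      using u2(2) by simp
  qed
  with u1 show "\<exists>u1. ode_pair I q z u u1"
    unfolding ode_pair_def by blast
next
  assume "\<exists>u1. ode_pair I q z u u1"
  then obtain u1 where "\<forall>x\<in>I. (u has_vector_derivative u1 x) (at x)"
      "AC_loc_deriv I u1 (\<lambda>x. (of_real (q x) - z) * u x)"
    unfolding ode_pair_def by blast
  then show "solution I q z u"
    unfolding solution_def tau_rel_def ae_eq_def
    by (intro exI[of _ u1] exI[of _ "\<lambda>x. (of_real (q x) - z) * u x"] conjI) (auto simp: algebra_simps)
qed

lemma AC_loc_deriv_lincomb:
  assumes "AC_loc_deriv I f g" "AC_loc_deriv I f' g'"
  shows "AC_loc_deriv I (\<lambda>x. A * f x + B * f' x) (\<lambda>x. A * g x + B * g' x)"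
  unfolding AC_loc_deriv_def
proof (intro ballI impI)
  fix x y assume xy: "x \<in> I" "y \<in> I" "x \<le> y"
  have g: "g absolutely_integrable_on {x..y}" "f y - f x = integral {x..y} g"
    "g' absolutely_integrable_on {x..y}" "f' y - f' x = integral {x..y} g'"
    using assms xy by (auto simp: AC_loc_deriv_def)
  have int: "g integrable_on {x..y}" "g' integrable_on {x..y}"
    using g by (auto simp: absolutely_integrable_on_def)
  have "(\<lambda>x. A * g x + B * g' x) absolutely_integrable_on {x..y}"
    using g by (intro set_integral_add set_integrable_mult_right impI)
  moreover have "integral {x..y} (\<lambda>x. A * g x + B * g' x) = A * integral {x..y} g + B * integral {x..y} g'"
    using int by (subst integral_add) (auto intro!: integrable_on_mult_right)
  ultimately show "(\<lambda>x. A * g x + B * g' x) absolutely_integrable_on {x..y} \<and>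
      A * f y + B * f' y - (A * f x + B * f' x) = integral {x..y} (\<lambda>x. A * g x + B * g' x)"
    using g by (simp add: algebra_simps)
qed

lemma ode_pair_lincomb:
  assumes "ode_pair I q z u u1" "ode_pair I q z v v1"
  shows "ode_pair I q z (\<lambda>x. A * u x + B * v x) (\<lambda>x. A * u1 x + B * v1 x)"
proof -
  have "AC_loc_deriv I (\<lambda>x. A * u1 x + B * v1 x)
      (\<lambda>x. A * ((of_real (q x) - z) * u x) + B * ((of_real (q x) - z) * v x))"
    using assms by (intro AC_loc_deriv_lincomb) (auto simp: ode_pair_def)
  then have "AC_loc_deriv I (\<lambda>x. A * u1 x + B * v1 x) (\<lambda>x. (of_real (q x) - z) * (A * u x + B * v x))"
    by (simp add: algebra_simps)
  with assms show ?thesis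
    unfolding ode_pair_def by (auto intro!: derivative_intros)
qed

lemma ode_pair_isCont:
  assumes "ode_pair I q z u u1" and I: "open I" "is_interval I" and x: "x \<in> I"
  shows "isCont u x" "isCont u1 x"
proof -
  show "isCont u x"
    using assms by (auto simp: ode_pair_def intro: has_vector_derivative_continuous)
  obtain e where e: "e > 0" "cball x e \<subseteq> I"
    using I(1) x open_contains_cball by blast
  define g where "g = (\<lambda>x. (of_real (q x) - z) * u x)"
  have ends: "x - e \<in> I" "x + e \<in> I" using e by (auto simp: subset_iff dist_real_def)
  have AC: "AC_loc_deriv I u1 g" using assms by (simp add: ode_pair_def g_def)
  then have int: "g integrable_on {x - e..x + e}"
    using ends e(1) by (auto simp: AC_loc_deriv_def absolutely_integrable_on_def)
  have eq: "u1 (x - e) + integral {x - e..t} g = u1 t" if "t \<in> {x - e..x + e}" for t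
  proof -
    have "t \<in> I" using that is_interval_atLeastAtMost_subset[OF I(2) ends] by blast
    then have "u1 t - u1 (x - e) = integral {x - e..t} g"
      using AC ends that by (auto simp: AC_loc_deriv_def)
    then show ?thesis by (simp add: algebra_simps)
  qed
  have "continuous_on {x - e..x + e} (\<lambda>t. u1 (x - e) + integral {x - e..t} g)"
    by (intro continuous_intros indefinite_integral_continuous_1 int)
  then have "continuous_on {x - e..x + e} u1"
    by (rule continuous_on_eq) (rule eq)
  then show "isCont u1 x"
    by (rule continuous_on_interior) (use e in auto)
qed

lemma ode_pair_restrict:
  assumes "ode_pair I q z u u1" "J \<subseteq> I"
  shows "ode_pair J q z u u1"
  using assms unfolding ode_pair_def AC_loc_deriv_def by blast

text \<open>In the norm \<open>max |y| (|y'| / k)\<close> with the weight \<open>exp (- 4 k (x - c))\<close>, the Volterra operator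
  of the first order system has norm at most \<open>1 / 2\<close>. Since \<open>k\<close> may be chosen of order \<open>sqrt |z|\<close>,
  the bound is of growth order \<open>1 / 2\<close> in \<open>z\<close>.\<close>

lemma apriori_right:
  fixes y y1 g :: "real \<Rightarrow> complex" and q :: "real \<Rightarrow> real"
  assumes cd: "c \<le> d"
    and y: "\<And>x. x \<in> {c..d} \<Longrightarrow> (y has_vector_derivative y1 x) (at x within {c..d})"
    and y1: "\<And>x. x \<in> {c..d} \<Longrightarrow> y1 x - y1 c = integral {c..x} g"
    and g: "g integrable_on {c..d}"
    and g_le: "\<And>x. x \<in> {c..d} \<Longrightarrow> cmod (g x) \<le> (\<bar>q x\<bar> + Z) * cmod (y x) + P"
    and q: "q absolutely_integrable_on {c..d}" and q_le: "integral {c..d} (\<lambda>x. \<bar>q x\<bar>) \<le> k / 4"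
    and Z: "0 \<le> Z" "Z \<le> k\<^sup>2" and k: "k \<ge> 1" and P: "P \<ge> 0"
  shows "cmod (y d) \<le> 2 * (cmod (y c) + cmod (y1 c) + (d - c) * P) * exp (4 * k * (d - c))"
proof -
  \<comment> \<open>Initial data plus total forcing; \<open>P\<close> bounds an inhomogeneity, which
    is needed for difference quotients in z.\<close>
  define B where "B = cmod (y c) + cmod (y1 c) + (d - c) * P"
  define E where "E = (\<lambda>x. exp (4 * k * (x - c)))"
  define W where "W = (\<lambda>x. max (cmod (y x)) (cmod (y1 x) / k) / E x)"
  have B: "B \<ge> 0" using cd P by (simp add: B_def)
  have cont_y: "continuous_on {c..d} y"
    using y by (meson continuous_on_eq_continuous_within has_vector_derivative_continuous)
  have "continuous_on {c..d} (\<lambda>x. y1 c + integral {c..x} g)"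
    by (intro continuous_intros indefinite_integral_continuous_1 g)
  moreover have "y1 c + integral {c..x} g = y1 x" if "x \<in> {c..d}" for x
    using y1[OF that, symmetric] by simp
  ultimately have cont_y1: "continuous_on {c..d} y1"
    by (rule continuous_on_eq)
  have "continuous_on {c..d} W"
    unfolding W_def E_def using k by (intro continuous_intros cont_y cont_y1) auto
  \<comment> \<open>Estimating the weighted norm at its maximum bounds \<open>N\<close> by a
    multiple of itself with factor 1/2, to be absorbed.\<close>
  then obtain x0 where x0: "x0 \<in> {c..d}" "\<And>x. x \<in> {c..d} \<Longrightarrow> W x \<le> W x0"
    using continuous_attains_sup[of "{c..d}" W] cd by auto
  define N where "N = W x0"
  have E: "E x > 0" for x by (simp add: E_def)
  have N: "N \<ge> 0" using k E[of x0] by (simp add: N_def W_def le_max_iff_disj)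
  have W_le: "cmod (y x) \<le> N * E x" "cmod (y1 x) \<le> k * N * E x" if "x \<in> {c..d}" for x
  proof -
    have "W x \<le> N" unfolding N_def by (rule x0(2)[OF that])
    then have "max (cmod (y x)) (cmod (y1 x) / k) \<le> N * E x"
      using E[of x] by (simp only: W_def pos_divide_le_eq)
    then show "cmod (y x) \<le> N * E x" "cmod (y1 x) \<le> k * N * E x"
      using k by (auto simp: pos_divide_le_eq mult_ac)
  qed
  have E_int: "(E has_integral (E x - 1) / (4 * k)) {c..x}" if "x \<in> {c..d}" for x
  proof -
    have "((\<lambda>x. E x / (4 * k)) has_real_derivative E t) (at t within {c..x})" for t
      unfolding E_def using k by (auto intro!: derivative_eq_intros)
    then have "(E has_integral (E x / (4 * k) - E c / (4 * k))) {c..x}"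
      using that by (intro fundamental_theorem_of_calculus)
        (auto simp: has_real_derivative_iff_has_vector_derivative[symmetric])
    then show ?thesis by (simp add: E_def diff_divide_distrib)
  qed
  have sub: "{c..x0} \<subseteq> {c..d}" using x0 by auto
  define E0 where "E0 = E x0"
  have E0: "E0 \<ge> 1" using x0 k by (simp add: E0_def E_def)
  have int_E_le: "integral {c..x0} E \<le> E0 / (4 * k)"
    using E_int[OF x0(1)] k by (simp add: integral_unique E0_def divide_right_mono)
  have int_E: "E integrable_on {c..x0}" using E_int[OF x0(1)] by blast
  have 1: "cmod (y x0) \<le> B + N / 2 * E0"
  proof -
    have hi: "(y1 has_integral (y x0 - y c)) {c..x0}"
    proof (rule fundamental_theorem_of_calculus)
      show "(y has_vector_derivative y1 x) (at x within {c..x0})" if "x \<in> {c..x0}" for x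
        by (rule has_vector_derivative_within_subset[OF y]) (use that sub in auto)
    qed (use x0 in auto)
    then have "cmod (y x0 - y c) = cmod (integral {c..x0} y1)"
      by (simp add: integral_unique)
    also have "\<dots> \<le> integral {c..x0} (\<lambda>t. k * N * E t)"
    proof (rule integral_norm_bound_integral)
      show "y1 integrable_on {c..x0}" using hi by blast
      show "(\<lambda>t. k * N * E t) integrable_on {c..x0}"
        by (intro integrable_on_mult_right int_E)
      show "cmod (y1 t) \<le> k * N * E t" if "t \<in> {c..x0}" for t
        using W_le(2)[of t] that sub by auto
    qed
    also have "\<dots> = k * N * integral {c..x0} E" by simp
    also have "\<dots> \<le> k * N * (E0 / (4 * k))"
      using int_E_le k N by (intro mult_left_mono) auto
    also have "\<dots> \<le> N / 2 * E0" using k N E0 by (simp add: field_simps)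
    finally have "cmod (y x0 - y c) \<le> N / 2 * E0" .
    moreover have "cmod (y x0) \<le> cmod (y x0 - y c) + cmod (y c)"
      using norm_triangle_ineq[of "y x0 - y c" "y c"] by simp
    moreover have "cmod (y c) \<le> B" using cd P by (simp add: B_def)
    ultimately show ?thesis by linarith
  qed
  have 2: "cmod (y1 x0) \<le> k * (B + N / 2 * E0)"
  proof -
    have q0: "(\<lambda>t. \<bar>q t\<bar>) integrable_on {c..d}"
      using q by (auto simp: absolutely_integrable_on_def)
    have q_int: "(\<lambda>t. \<bar>q t\<bar>) integrable_on {c..x0}"
      by (rule integrable_on_subinterval[OF q0 sub])
    have q_int_le: "integral {c..x0} (\<lambda>t. \<bar>q t\<bar>) \<le> k / 4"
      using integral_subset_le[OF sub q_int q0] q_le by auto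
    have bnd: "cmod (g t) \<le> N * E0 * \<bar>q t\<bar> + Z * N * E t + P" if t: "t \<in> {c..x0}" for t
    proof -
      have "E t \<le> E0" using t k by (simp add: E_def E0_def)
      have "(\<bar>q t\<bar> + Z) * cmod (y t) \<le> (\<bar>q t\<bar> + Z) * (N * E t)"
        using W_le(1)[of t] t sub Z by (intro mult_left_mono) auto
      also have "\<dots> = \<bar>q t\<bar> * (N * E t) + Z * N * E t" by (simp add: algebra_simps)
      also have "\<bar>q t\<bar> * (N * E t) \<le> \<bar>q t\<bar> * (N * E0)"
        using \<open>E t \<le> E0\<close> N by (intro mult_left_mono) auto
      finally have "(\<bar>q t\<bar> + Z) * cmod (y t) \<le> N * E0 * \<bar>q t\<bar> + Z * N * E t"
        by (simp add: mult_ac)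
      with g_le[of t] t sub show ?thesis by auto
    qed
    have hi: "((\<lambda>t. N * E0 * \<bar>q t\<bar> + Z * N * E t + P) has_integral
        (N * E0 * integral {c..x0} (\<lambda>t. \<bar>q t\<bar>) + Z * N * integral {c..x0} E + (x0 - c) * P)) {c..x0}"
      using q_int int_E x0(1)
      by (intro has_integral_add has_integral_mult_right integrable_integral)
         (use has_integral_const_real[of P c x0] in auto)
    have "cmod (y1 x0 - y1 c) = cmod (integral {c..x0} g)"
      using y1[OF x0(1)] by simp
    also have "\<dots> \<le> integral {c..x0} (\<lambda>t. N * E0 * \<bar>q t\<bar> + Z * N * E t + P)"
    proof (rule integral_norm_bound_integral)
      show "g integrable_on {c..x0}" by (rule integrable_on_subinterval[OF g sub])
      show "(\<lambda>t. N * E0 * \<bar>q t\<bar> + Z * N * E t + P) integrable_on {c..x0}" using hi by blast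
    qed (rule bnd)
    also have "\<dots> = N * E0 * integral {c..x0} (\<lambda>t. \<bar>q t\<bar>) + Z * N * integral {c..x0} E + (x0 - c) * P"
      using hi by (rule integral_unique)
    \<comment> \<open>Two quarters make the half: k / 4 from the integral of |q|, and k^2 / (4 k)
      from the z-part, since integrating the weight gains 1 / (4 k).\<close>
    also have "\<dots> \<le> N * E0 * (k / 4) + k\<^sup>2 * N * (E0 / (4 * k)) + (d - c) * P"
    proof (intro add_mono mult_mono)
      show "0 \<le> integral {c..x0} E" using E_int[OF x0(1)] E0 k
        by (simp add: integral_unique E0_def)
    qed (use q_int_le int_E_le Z N E0 k P x0 in \<open>auto intro!: integral_nonneg q_int\<close>)
    also have "\<dots> = k * (N / 2 * E0) + (d - c) * P"
      using k by (simp add: field_simps power2_eq_square)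
    finally have "cmod (y1 x0) \<le> k * (N / 2 * E0) + (cmod (y1 c) + (d - c) * P)"
      using norm_triangle_ineq[of "y1 x0 - y1 c" "y1 c"] by simp
    moreover have "cmod (y1 c) + (d - c) * P \<le> B" by (simp add: B_def)
    moreover have "B \<le> k * B" using k B mult_right_mono[of 1 k B] by simp
    ultimately show ?thesis by (simp add: algebra_simps)
  qed
  have "max (cmod (y x0)) (cmod (y1 x0) / k) \<le> B + N / 2 * E0"
    using 1 2 k by (simp add: pos_divide_le_eq mult_ac)
  moreover have "N * E0 = max (cmod (y x0)) (cmod (y1 x0) / k)"
    using E[of x0] by (simp add: N_def W_def E0_def)
  ultimately have "N * E0 \<le> B + N / 2 * E0" by (simp only:)
  then have "N * E0 \<le> 2 * B" by simp
  moreover have "N * 1 \<le> N * E0" using E0 N by (intro mult_left_mono) auto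
  ultimately have "N \<le> 2 * B" by simp
  then have "N * E d \<le> 2 * B * E d" using E[of d] by (intro mult_right_mono) auto
  moreover have "cmod (y d) \<le> N * E d" by (rule W_le(1)) (use cd in simp)
  ultimately have "cmod (y d) \<le> 2 * B * E d" by linarith
  then show ?thesis by (simp only: B_def E_def)
qed

text \<open>To the left of \<open>c\<close> the estimate follows by the reflection t -> -t, which
  flips the sign of the derivative and leaves the form of the equation unchanged.\<close>

lemma apriori:
  fixes y y1 g :: "real \<Rightarrow> complex" and q :: "real \<Rightarrow> real"
  assumes I: "is_interval I" and c: "c \<in> I" and x: "x \<in> I"
    and y: "\<And>t. t \<in> I \<Longrightarrow> (y has_vector_derivative y1 t) (at t)"
    and AC: "AC_loc_deriv I y1 g"
    and g_le: "\<And>t. t \<in> {min c x..max c x} \<Longrightarrow> cmod (g t) \<le> (\<bar>q t\<bar> + Z) * cmod (y t) + P"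
    and q: "q absolutely_integrable_on {min c x..max c x}"
    and q_le: "integral {min c x..max c x} (\<lambda>t. \<bar>q t\<bar>) \<le> k / 4"
    and Z: "0 \<le> Z" "Z \<le> k\<^sup>2" and k: "k \<ge> 1" and P: "P \<ge> 0"
  shows "cmod (y x) \<le> 2 * (cmod (y c) + cmod (y1 c) + \<bar>x - c\<bar> * P) * exp (4 * k * \<bar>x - c\<bar>)"
proof (cases "c \<le> x")
  case True
  have sub: "{c..x} \<subseteq> I" using is_interval_atLeastAtMost_subset[OF I c x] .
  have AC': "g absolutely_integrable_on {c..t}" "y1 t - y1 c = integral {c..t} g" if "t \<in> {c..x}" for t
    using AC c that sub unfolding AC_loc_deriv_def by auto
  have "cmod (y x) \<le> 2 * (cmod (y c) + cmod (y1 c) + (x - c) * P) * exp (4 * k * (x - c))"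
  proof (rule apriori_right[where g = g and q = q and Z = Z])
    show "(y has_vector_derivative y1 t) (at t within {c..x})" if "t \<in> {c..x}" for t
      by (rule has_vector_derivative_at_within[OF y]) (use that sub in auto)
    show "g integrable_on {c..x}"
      using AC'(1)[of x] True by (auto simp: absolutely_integrable_on_def)
  qed (use AC'(2) assms True in \<open>auto simp: min_def max_def\<close>)
  then show ?thesis using True by simp
next
  case False
  then have xc: "- c \<le> - x" by simp
  have J: "{min c x..max c x} = {x..c}" using False by auto
  have sub: "{x..c} \<subseteq> I" using is_interval_atLeastAtMost_subset[OF I x c] .
  have AC': "g absolutely_integrable_on {t..c}" "y1 c - y1 t = integral {t..c} g" if "t \<in> {x..c}" for t
    using AC c that sub unfolding AC_loc_deriv_def by auto
  have "cmod (y (- (- x))) \<le> 2 * (cmod (y (- (- c))) + cmod (- y1 (- (- c))) + (- x - - c) * P) *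
      exp (4 * k * (- x - - c))"
  proof (rule apriori_right[where y = "\<lambda>t. y (- t)" and ?y1.0 = "\<lambda>t. - y1 (- t)" and g = "\<lambda>t. g (- t)"
        and q = "\<lambda>t. q (- t)" and Z = Z])
    show "((\<lambda>t. y (- t)) has_vector_derivative - y1 (- t)) (at t within {- c..- x})"
      if "t \<in> {- c..- x}" for t
    proof -
      have "- t \<in> I" using that sub by auto
      have "((y \<circ> uminus) has_vector_derivative (- 1) *\<^sub>R y1 (- t)) (at t)"
        by (rule vector_diff_chain_at) (auto intro!: derivative_eq_intros y[OF \<open>- t \<in> I\<close>])
      then show ?thesis by (simp add: o_def has_vector_derivative_at_within)
    qed
    show "- y1 (- t) - - y1 (- (- c)) = integral {- c..t} (\<lambda>t. g (- t))" if "t \<in> {- c..- x}" for t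
      using AC'(2)[of "- t"] that Henstock_Kurzweil_Integration.integral_reflect_real[of c "- t" g] by simp
    show "(\<lambda>t. g (- t)) integrable_on {- c..- x}"
      using AC'(1)[of x] False by (auto simp: absolutely_integrable_on_def)
    show "cmod (g (- t)) \<le> (\<bar>q (- t)\<bar> + Z) * cmod (y (- t)) + P" if "t \<in> {- c..- x}" for t
      by (rule g_le) (use that J in auto)
    show "(\<lambda>t. q (- t)) absolutely_integrable_on {- c..- x}"
      using q by (simp add: J)
    show "integral {- c..- x} (\<lambda>t. \<bar>q (- t)\<bar>) \<le> k / 4"
      using q_le Henstock_Kurzweil_Integration.integral_reflect_real[of c x "\<lambda>t. \<bar>q t\<bar>"] by (simp add: J)
  qed (use xc Z k P in auto)
  then show ?thesis using False by simp
qed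

text \<open>A Cauchy criterion for a limit with no candidate at hand: one sequence of points
  produces \<open>L\<close>, and the bound compares all other points with it. \<open>D\<close> is
  meant to be a difference quotient.\<close>

lemma convergent_at_of_Lipschitz:
  fixes D :: "complex \<Rightarrow> complex"
  assumes C: "\<And>z w. z \<noteq> z0 \<Longrightarrow> w \<noteq> z0 \<Longrightarrow> cmod (z - z0) \<le> 1 \<Longrightarrow> cmod (w - z0) \<le> 1 \<Longrightarrow>
      cmod (D z - D w) \<le> C * (cmod (z - z0) + cmod (w - z0))"
  shows "\<exists>L. D \<midarrow>z0\<rightarrow> L"
proof -
  define w where "w = (\<lambda>n. z0 + of_real (1 / real (Suc n)))"
  have w: "w n \<noteq> z0" "cmod (w n - z0) = 1 / real (Suc n)" "cmod (w n - z0) \<le> 1" for n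
    by (auto simp: w_def norm_divide simp del: of_nat_Suc)
  have C0: "C \<ge> 0"
    using C[of "w 0" "w 0"] w[of 0] by (simp add: zero_le_mult_iff)
  have lim0: "(\<lambda>n. 1 / real (Suc n)) \<longlonglongrightarrow> 0"
    using LIMSEQ_inverse_real_of_nat by (simp add: inverse_eq_divide)
  have "Cauchy (\<lambda>n. D (w n))"
  proof (rule CauchyI)
    fix e :: real assume e: "e > 0"
    have "e / (C + 1) / 2 > 0" using e C0 by simp
    with lim0 have "eventually (\<lambda>n. 1 / real (Suc n) < e / (C + 1) / 2) sequentially"
      by (rule order_tendstoD)
    then obtain M where M: "\<And>n. n \<ge> M \<Longrightarrow> 1 / real (Suc n) < e / (C + 1) / 2"
      by (auto simp: eventually_sequentially)
    have "norm (D (w m) - D (w n)) < e" if mn: "m \<ge> M" "n \<ge> M" for m n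
    proof -
      have "norm (D (w m) - D (w n)) \<le> C * (1 / real (Suc m) + 1 / real (Suc n))"
        using C[of "w m" "w n"] w by simp
      also have "\<dots> \<le> C * (e / (C + 1))"
      proof (rule mult_left_mono[OF _ C0])
        have "1 / real (Suc m) + 1 / real (Suc n) \<le> e / (C + 1) / 2 + e / (C + 1) / 2"
          by (intro add_mono less_imp_le M mn)
        also have "\<dots> = e / (C + 1)" by (rule field_sum_of_halves)
        finally show "1 / real (Suc m) + 1 / real (Suc n) \<le> e / (C + 1)" .
      qed
      also have "\<dots> < e" using C0 e by (simp add: field_simps)
      finally show ?thesis .
    qed
    then show "\<exists>M. \<forall>m\<ge>M. \<forall>n\<ge>M. norm (D (w m) - D (w n)) < e" by blast
  qed
  then obtain L where L: "(\<lambda>n. D (w n)) \<longlonglongrightarrow> L"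
    using Cauchy_convergent_iff convergent_def by blast
  have le: "cmod (D z - L) \<le> C * cmod (z - z0)" if z: "z \<noteq> z0" "cmod (z - z0) \<le> 1" for z
  proof (rule LIMSEQ_le)
    show "(\<lambda>n. cmod (D z - D (w n))) \<longlonglongrightarrow> cmod (D z - L)"
      by (intro tendsto_intros L)
    have "(\<lambda>n. C * (cmod (z - z0) + 1 / real (Suc n))) \<longlonglongrightarrow> C * (cmod (z - z0) + 0)"
      by (intro tendsto_intros lim0)
    then show "(\<lambda>n. C * (cmod (z - z0) + 1 / real (Suc n))) \<longlonglongrightarrow> C * cmod (z - z0)" by simp
    show "\<exists>N. \<forall>n\<ge>N. cmod (D z - D (w n)) \<le> C * (cmod (z - z0) + 1 / real (Suc n))"
      using C[of z "w _"] w z by (metis)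
  qed
  have "((\<lambda>z. C * cmod (z - z0)) \<longlongrightarrow> C * cmod (z0 - z0)) (at z0)"
    by (intro tendsto_intros)
  then have lim: "((\<lambda>z. C * cmod (z - z0)) \<longlongrightarrow> 0) (at z0)" by simp
  have "eventually (\<lambda>z. cmod (D z - L) \<le> C * cmod (z - z0)) (at z0)"
    unfolding eventually_at using le by (intro exI[of _ 1]) (auto simp: dist_norm)
  then have "((\<lambda>z. D z - L) \<longlongrightarrow> 0) (at z0)"
    using lim by (rule Lim_null_comparison)
  then show ?thesis
    by (auto simp: LIM_zero_iff)
qed

text \<open>Difference quotients in \<open>z\<close> solve an inhomogeneous equation, so the a priori bound makes them
  Lipschitz, hence convergent.\<close>

lemma ivp_family:
  fixes u u1 :: "complex \<Rightarrow> real \<Rightarrow> complex"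
  assumes I: "is_interval I" and c: "c \<in> I" and x: "x \<in> I" and q: "L1_loc I q"
    and u: "\<And>z. ode_pair I q z (u z) (u1 z)" and init: "\<And>z. u z c = v0" "\<And>z. u1 z c = v1"
    and s: "s \<ge> 1 / 2"
  shows "(\<lambda>z. u z x) \<in> R_ring s"
proof -
  define J where "J = {min c x..max c x}"
  define Q where "Q = integral J (\<lambda>t. \<bar>q t\<bar>)"
  define l where "l = \<bar>x - c\<bar>"
  define V where "V = cmod v0 + cmod v1"
  have l: "l \<ge> 0" by (simp add: l_def)
  have J: "J \<subseteq> I" unfolding J_def
    using is_interval_atLeastAtMost_subset[OF I] c x by (simp add: min_def max_def)
  have qJ: "q absolutely_integrable_on J"
    using q c x unfolding J_def L1_loc_def by (simp add: min_def max_def)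
  have absq: "(\<lambda>t. \<bar>q t\<bar>) integrable_on J" 
    using qJ by (auto simp: absolutely_integrable_on_def)
  have Q: "Q \<ge> 0" unfolding Q_def by (intro integral_nonneg absq) auto
  \<comment> \<open>The a priori bound with the constants \<open>Q\<close> and \<open>l\<close> of
    all of \<open>J\<close>; it is used with forcing 0 for solutions, with a bounded forcing for
    quotients and a small one for differences of quotients.\<close>
  have ap: "cmod (y t) \<le> 2 * (cmod (y c) + cmod (y1 c) + l * P) * exp (4 * k * l)"
    if y: "\<And>t. t \<in> I \<Longrightarrow> (y has_vector_derivative y1 t) (at t)" "AC_loc_deriv I y1 g"
      and g: "\<And>t. t \<in> J \<Longrightarrow> cmod (g t) \<le> (\<bar>q t\<bar> + Z) * cmod (y t) + P"
      and k: "4 * Q \<le> k" "0 \<le> Z" "Z \<le> k\<^sup>2" "k \<ge> 1" "P \<ge> 0" and t: "t \<in> J"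
    for y y1 g Z P k t
  proof -
    have Jt: "{min c t..max c t} \<subseteq> J" using t unfolding J_def by auto
    have tI: "t \<in> I" using t J by blast
    have qt: "q absolutely_integrable_on {min c t..max c t}"
      using q c tI unfolding L1_loc_def by (simp add: min_def max_def)
    then have "(\<lambda>t. \<bar>q t\<bar>) integrable_on {min c t..max c t}"
      by (auto simp: absolutely_integrable_on_def)
    then have "integral {min c t..max c t} (\<lambda>t. \<bar>q t\<bar>) \<le> Q"
      unfolding Q_def using absq Jt by (intro integral_subset_le) auto
    then have "cmod (y t) \<le> 2 * (cmod (y c) + cmod (y1 c) + \<bar>t - c\<bar> * P) * exp (4 * k * \<bar>t - c\<bar>)"
      using k by (intro apriori[OF I c tI y _ qt _ k(2-5)] g) (use Jt in auto)
    also have "\<dots> \<le> 2 * (cmod (y c) + cmod (y1 c) + l * P) * exp (4 * k * l)"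
    proof -
      have "\<bar>t - c\<bar> \<le> l" using t unfolding J_def l_def by (auto simp: min_def max_def split: if_splits)
      then show ?thesis using k l
        by (intro mult_mono add_mono) (auto intro!: mult_left_mono mult_right_mono add_nonneg_nonneg)
    qed
    finally show ?thesis .
  qed
  have u_deriv: "(u z has_vector_derivative u1 z t) (at t)" if "t \<in> I" for z t
    using u[of z] that by (auto simp: ode_pair_def)
  have u_AC: "AC_loc_deriv I (u1 z) (\<lambda>t. (of_real (q t) - z) * u z t)" for z
    using u[of z] by (auto simp: ode_pair_def)
  have norm_qz: "cmod (of_real (q t) - z) \<le> \<bar>q t\<bar> + cmod z" for t z
    using norm_triangle_ineq4[of "of_real (q t)" z] by simp
  have u_le: "cmod (u z t) \<le> 2 * V * exp (4 * k * l)"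
    if "t \<in> J" "4 * Q \<le> k" "cmod z \<le> k\<^sup>2" "k \<ge> 1" for z t k
  proof -
    have "cmod (u z t) \<le> 2 * (cmod (u z c) + cmod (u1 z c) + l * 0) * exp (4 * k * l)"
    proof (rule ap[OF u_deriv u_AC])
      show "cmod ((of_real (q t) - z) * u z t) \<le> (\<bar>q t\<bar> + cmod z) * cmod (u z t) + 0" for t
        using norm_qz[of t z] by (simp add: norm_mult mult_right_mono)
    qed (use that in auto)
    then show ?thesis by (simp add: init V_def)
  qed
  have x_J: "x \<in> J" by (simp add: J_def)
  show ?thesis
  proof (rule R_ring_I)
    show "(\<lambda>z. u z x) holomorphic_on UNIV"
      unfolding holomorphic_on_open[OF open_UNIV]
    proof (intro ballI)
      fix z0 :: complex
      \<comment> \<open>Large enough that k^2 bounds |z| throughout the unit disc about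
        \<open>z0\<close>, besides k >= 4 Q and k >= 1.\<close>
      define k where "k = sqrt (cmod z0 + 1) + 1 + 4 * Q"
      have k: "4 * Q \<le> k" "k \<ge> 1" using Q by (auto simp: k_def)
      have "cmod z0 + 1 = (sqrt (cmod z0 + 1))\<^sup>2" by simp
      also have "\<dots> \<le> k\<^sup>2" using Q by (intro power_mono) (auto simp: k_def)
      finally have k2: "cmod z0 + 1 \<le> k\<^sup>2" .
      define U where "U = 2 * V * exp (4 * k * l)"
      have U: "U \<ge> 0" by (simp add: U_def V_def)
      have uU: "cmod (u z t) \<le> U" if "cmod (z - z0) \<le> 1" "t \<in> J" for z t
        unfolding U_def
      proof (rule u_le)
        show "cmod z \<le> k\<^sup>2" using that(1) k2 norm_triangle_ineq[of "z - z0" z0] by simp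
      qed (use that k in auto)
      define D where "D = (\<lambda>z t. 1 / (z - z0) * u z t + - 1 / (z - z0) * u z0 t)"
      define D1 where "D1 = (\<lambda>z t. 1 / (z - z0) * u1 z t + - 1 / (z - z0) * u1 z0 t)"
      \<comment> \<open>The difference quotient has zero data at \<open>c\<close> and solves the
        equation with parameter \<open>z0\<close> and forcing - u z.\<close>
      define gD where "gD = (\<lambda>z t. (of_real (q t) - z0) * D z t - u z t)"
      have D_deriv: "(D z has_vector_derivative D1 z t) (at t)" if "t \<in> I" for z t
        unfolding D_def D1_def by (intro derivative_intros u_deriv that)
      have D_AC: "AC_loc_deriv I (D1 z) (gD z)" if "z \<noteq> z0" for z
      proof -
        have "AC_loc_deriv I (D1 z) (\<lambda>t. 1 / (z - z0) * ((of_real (q t) - z) * u z t) +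
            - 1 / (z - z0) * ((of_real (q t) - z0) * u z0 t))"
          unfolding D1_def by (rule AC_loc_deriv_lincomb[OF u_AC u_AC])
        moreover have "1 / (z - z0) * ((of_real (q t) - z) * u z t) +
            - 1 / (z - z0) * ((of_real (q t) - z0) * u z0 t) = gD z t" for t
        proof -
          have alg: "d \<noteq> 0 \<Longrightarrow> 1 / d * ((a - d) * v) + - 1 / d * (a * v') = a * (1 / d * v + - 1 / d * v') - v"
            for a d v v' :: complex by (simp add: field_simps)
          have eq: "of_real (q t) - z = (of_real (q t) - z0) - (z - z0)" by simp
          show ?thesis
            unfolding gD_def D_def by (subst eq, rule alg) (use that in simp)
        qed
        ultimately show ?thesis by simp
      qed
      have D_init: "D z c = 0" "D1 z c = 0" for z
        by (simp_all add: D_def D1_def init)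
      define U1 where "U1 = 2 * (l * U) * exp (4 * k * l)"
      have U1: "U1 \<ge> 0" using l U by (simp add: U1_def)
      have D_le: "cmod (D z t) \<le> U1" if z: "z \<noteq> z0" "cmod (z - z0) \<le> 1" and t: "t \<in> J" for z t
      proof -
        have "cmod (D z t) \<le> 2 * (cmod (D z c) + cmod (D1 z c) + l * U) * exp (4 * k * l)"
        proof (rule ap[OF D_deriv D_AC])
          show "cmod (gD z t) \<le> (\<bar>q t\<bar> + cmod z0) * cmod (D z t) + U" if "t \<in> J" for t
          proof -
            have "cmod (gD z t) \<le> cmod ((of_real (q t) - z0) * D z t) + cmod (u z t)"
              unfolding gD_def by (rule norm_triangle_ineq4)
            also have "\<dots> \<le> (\<bar>q t\<bar> + cmod z0) * cmod (D z t) + U"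
              unfolding norm_mult by (intro add_mono mult_right_mono norm_qz uU z that) auto
            finally show ?thesis .
          qed
        qed (use z t k k2 U in auto)
        then show ?thesis by (simp add: D_init U1_def)
      qed
      have u_diff: "cmod (u z t - u z0 t) \<le> U1 * cmod (z - z0)"
        if z: "z \<noteq> z0" "cmod (z - z0) \<le> 1" and t: "t \<in> J" for z t
      proof -
        have "u z t - u z0 t = (z - z0) * D z t"
        proof -
          have alg: "d \<noteq> 0 \<Longrightarrow> v - v' = d * (1 / d * v + - 1 / d * v')" for d v v' :: complex
            by (simp add: field_simps)
          show ?thesis unfolding D_def by (rule alg) (use z in simp)
        qed
        then have "cmod (u z t - u z0 t) = cmod (z - z0) * cmod (D z t)" by (simp add: norm_mult)
        also have "\<dots> \<le> cmod (z - z0) * U1" using D_le[OF z t] by (intro mult_left_mono) auto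
        finally show ?thesis by (simp add: mult.commute)
      qed
      have D_lip: "cmod (D z x - D w x) \<le> (2 * l * U1 * exp (4 * k * l)) * (cmod (z - z0) + cmod (w - z0))"
        if z: "z \<noteq> z0" "w \<noteq> z0" "cmod (z - z0) \<le> 1" "cmod (w - z0) \<le> 1" for z w
      proof -
        \<comment> \<open>Two quotients differ by a solution with forcing u w - u z, which is
          already known to be Lipschitz small near \<open>z0\<close>.\<close>
        define P where "P = U1 * (cmod (z - z0) + cmod (w - z0))"
        define y where "y = (\<lambda>t. 1 * D z t + - 1 * D w t)"
        define y1 where "y1 = (\<lambda>t. 1 * D1 z t + - 1 * D1 w t)"
        define g where "g = (\<lambda>t. 1 * gD z t + - 1 * gD w t)"
        have "cmod (y x) \<le> 2 * (cmod (y c) + cmod (y1 c) + l * P) * exp (4 * k * l)"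
        proof (rule ap)
          show "(y has_vector_derivative y1 t) (at t)" if "t \<in> I" for t
            unfolding y_def y1_def by (intro derivative_intros D_deriv that)
          show "AC_loc_deriv I y1 g"
            unfolding y1_def g_def by (intro AC_loc_deriv_lincomb D_AC z)
          show "cmod (g t) \<le> (\<bar>q t\<bar> + cmod z0) * cmod (y t) + P" if "t \<in> J" for t
          proof -
            have "g t = (of_real (q t) - z0) * y t - (u z t - u w t)"
              by (simp add: g_def gD_def y_def algebra_simps)
            then have "cmod (g t) \<le> cmod ((of_real (q t) - z0) * y t) + cmod (u z t - u w t)"
              by (metis norm_triangle_ineq4)
            also have "\<dots> \<le> (\<bar>q t\<bar> + cmod z0) * cmod (y t) + P"
              unfolding norm_mult
            proof (intro add_mono mult_right_mono norm_qz)
              have "cmod (u z t - u w t) \<le> cmod (u z t - u z0 t) + cmod (u w t - u z0 t)"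
                using norm_triangle_ineq4[of "u z t - u z0 t" "u w t - u z0 t"] by simp
              then show "cmod (u z t - u w t) \<le> P"
                using u_diff[OF z(1,3) that] u_diff[OF z(2,4) that] by (simp add: P_def distrib_left)
            qed auto
            finally show ?thesis .
          qed
        qed (use k k2 U1 x_J in \<open>auto simp: P_def\<close>)
        then have "cmod (D z x - D w x) \<le> 2 * (l * P) * exp (4 * k * l)"
          by (simp add: y_def y1_def D_init)
        also have "\<dots> = (2 * l * U1 * exp (4 * k * l)) * (cmod (z - z0) + cmod (w - z0))"
          by (simp only: P_def mult_ac)
        finally show ?thesis .
      qed
      obtain L where L: "(\<lambda>z. D z x) \<midarrow>z0\<rightarrow> L"
        using convergent_at_of_Lipschitz[of z0 "\<lambda>z. D z x", OF D_lip] by blast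
      have "(\<lambda>z. D z x) = (\<lambda>z. (u z x - u z0 x) / (z - z0))"
        by (auto simp: D_def diff_divide_distrib)
      with L show "\<exists>f'. ((\<lambda>z. u z x) has_field_derivative f') (at z0)"
        by (auto simp: has_field_derivative_iff)
    qed
    show "s > 0" using s by simp
    show "0 \<le> 4 * l * (2 + 4 * Q)" "0 \<le> 2 * V" using l Q by (auto simp: V_def)
    show "cmod (u z x) \<le> 2 * V * exp (4 * l * (2 + 4 * Q) * (1 + cmod z) powr s)" for z
    proof -
      define X where "X = (1 + cmod z) powr s"
      \<comment> \<open>k is of order sqrt |z|, so exp (4 k l) has growth order at most 1/2.\<close>
      define k where "k = sqrt (cmod z) + 1 + 4 * Q"
      have k: "4 * Q \<le> k" "k \<ge> 1" using Q by (auto simp: k_def)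
      have "cmod z = (sqrt (cmod z))\<^sup>2" by simp
      also have "\<dots> \<le> k\<^sup>2" using Q by (intro power_mono) (auto simp: k_def)
      finally have "cmod z \<le> k\<^sup>2" .
      from u_le[OF x_J k(1) this k(2)] have "cmod (u z x) \<le> 2 * V * exp (4 * k * l)" .
      also have "\<dots> \<le> 2 * V * exp (4 * l * (2 + 4 * Q) * X)"
      proof -
        have X: "X \<ge> 1" unfolding X_def by (rule ge_one_powr_ge_zero) (use s in auto)
        have "sqrt (cmod z) \<le> sqrt (1 + cmod z)" by simp
        also have "\<dots> = (1 + cmod z) powr (1 / 2)" by (simp add: powr_half_sqrt)
        also have "\<dots> \<le> X" unfolding X_def using s by (intro powr_mono) auto
        finally have "k \<le> X + X + 4 * Q * X"
          unfolding k_def using X Q mult_left_mono[of 1 X "4 * Q"] by (intro add_mono) auto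
        then have "k \<le> (2 + 4 * Q) * X" by (simp add: algebra_simps)
        then have "4 * l * k \<le> 4 * l * ((2 + 4 * Q) * X)" using l by (intro mult_left_mono) auto
        then have "4 * k * l \<le> 4 * l * (2 + 4 * Q) * X" by (simp add: mult_ac)
        then show ?thesis by (intro mult_left_mono) (auto simp: V_def)
      qed
      finally show ?thesis by (simp add: X_def)
    qed
  qed
qed

text \<open>Both products are close to the same \<open>A * B\<close>; such cross differences are the
  integrands of Wronskian increments.\<close>

lemma norm_cross_diff_le:
  fixes A B p p' q q' :: complex and \<eta> :: real
  assumes "cmod (p - A) \<le> \<eta>" "cmod (p' - A) \<le> \<eta>" "cmod (q - B) \<le> \<eta>" "cmod (q' - B) \<le> \<eta>"
    and "\<eta> \<le> 1"
  shows "cmod (p * q - q' * p') \<le> \<eta> * (2 * cmod A + 2 * cmod B + 2)"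
proof -
  have *: "cmod (r * s - A * B) \<le> \<eta> * (cmod A + cmod B + 1)"
    if "cmod (r - A) \<le> \<eta>" "cmod (s - B) \<le> \<eta>" for r s
  proof -
    have \<eta>: "\<eta> \<ge> 0" using that(1) norm_ge_zero order_trans by blast
    have "cmod s \<le> cmod B + 1"
      using norm_triangle_ineq[of "s - B" B] that(2) assms(5) by simp
    have "r * s - A * B = (r - A) * s + A * (s - B)" by (simp add: algebra_simps)
    then have "cmod (r * s - A * B) \<le> cmod (r - A) * cmod s + cmod A * cmod (s - B)"
      by (metis norm_mult norm_triangle_ineq)
    also have "\<dots> \<le> \<eta> * (cmod B + 1) + cmod A * \<eta>"
      using that \<eta> \<open>cmod s \<le> cmod B + 1\<close> by (intro add_mono mult_mono) auto
    finally show ?thesis by (simp add: algebra_simps)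
  qed
  have "cmod (p * q - q' * p') \<le> cmod (p * q - A * B) + cmod (p' * q' - A * B)"
    using norm_triangle_ineq4[of "p * q - A * B" "p' * q' - A * B"] by (simp add: mult.commute)
  also have "\<dots> \<le> \<eta> * (cmod A + cmod B + 1) + \<eta> * (cmod A + cmod B + 1)"
    by (intro add_mono * assms)
  finally show ?thesis by (simp add: algebra_simps)
qed

text \<open>Instead of a product rule for absolutely continuous functions: increments of the Wronskian are
  small relative to those of \<open>x + \<integral> |q - z|\<close>, locally and hence by bisection globally.\<close>

lemma ode_pair_wronskian_const:
  assumes I: "open I" "is_interval I" and q: "L1_loc I q"
    and u: "ode_pair I q z u u1" and v: "ode_pair I q z v v1" and xy: "x \<in> I" "y \<in> I" "x \<le> y"
  shows "u x * v1 x - u1 x * v x = u y * v1 y - u1 y * v y"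
proof -
  define W where "W = (\<lambda>x. u x * v1 x - u1 x * v x)"
  define h where "h = (\<lambda>s. of_real (q s) - z)"
  \<comment> \<open>An additive interval function, so that local estimates of increments add up
    under bisection.\<close>
  define \<Phi> where "\<Phi> = (\<lambda>a b. (b - a) * (cmod z + 1) + integral {a..b} (\<lambda>s. \<bar>q s\<bar>))"
  have sub: "{a..b} \<subseteq> I" if "a \<in> I" "b \<in> I" for a b
    using is_interval_atLeastAtMost_subset[OF I(2) that] .
  have absq: "(\<lambda>s. \<bar>q s\<bar>) integrable_on {a..b}" if "a \<in> I" "b \<in> I" for a b
    using q that by (auto simp: L1_loc_def absolutely_integrable_on_def)
  have small: "cmod (W y - W x) \<le> \<epsilon> * \<Phi> x y" if \<epsilon>: "\<epsilon> > 0" for \<epsilon>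
  proof -
    have "x \<in> I \<longrightarrow> y \<in> I \<longrightarrow> cmod (W y - W x) \<le> \<epsilon> * \<Phi> x y"
      using xy(3)
    proof (induction rule: Bolzano)
      case (trans a b c)
      show ?case
      proof (intro impI)
        assume ac: "a \<in> I" "c \<in> I"
        have b: "b \<in> I" using sub[OF ac] trans by auto
        have "\<Phi> a c = \<Phi> a b + \<Phi> b c"
          unfolding \<Phi>_def using Henstock_Kurzweil_Integration.integral_combine[OF trans(3,4) absq[OF ac]] by (simp add: algebra_simps)
        moreover have "cmod (W c - W a) \<le> cmod (W b - W a) + cmod (W c - W b)"
          using norm_triangle_ineq[of "W b - W a" "W c - W b"] by simp
        ultimately show "cmod (W c - W a) \<le> \<epsilon> * \<Phi> a c"
          using trans(1,2) ac b by (simp add: distrib_left)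
      qed
    next
      case (local t)
      then have t: "t \<in> I" using sub[OF xy(1,2)] by auto
      define S where "S = 2 * cmod (u t) + 2 * cmod (v t) + 2 * cmod (u1 t) + 2 * cmod (v1 t) + 2"
      define \<eta> where "\<eta> = min 1 (\<epsilon> / S)"
      have S: "S > 0" unfolding S_def by (intro add_nonneg_pos add_nonneg_nonneg) auto
      have \<eta>: "\<eta> > 0" "\<eta> \<le> 1" "\<eta> * S \<le> \<epsilon>"
        using \<epsilon> S by (auto simp: \<eta>_def min_def field_simps)
      have "isCont u t" "isCont u1 t" "isCont v t" "isCont v1 t"
        using ode_pair_isCont[OF u I t] ode_pair_isCont[OF v I t] by auto
      then have "eventually (\<lambda>s. dist (f s) (f t) < \<eta>) (nhds t)" if "f \<in> {u, u1, v, v1}" for f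
        using that \<eta>(1) by (auto simp: isCont_def tendsto_at_iff_tendsto_nhds intro: tendstoD)
      moreover have "eventually (\<lambda>s. s \<in> I) (nhds t)" using I(1) t by (rule eventually_nhds_in_open)
      ultimately have "eventually (\<lambda>s. s \<in> I \<and> dist (u s) (u t) < \<eta> \<and> dist (u1 s) (u1 t) < \<eta> \<and>
          dist (v s) (v t) < \<eta> \<and> dist (v1 s) (v1 t) < \<eta>) (nhds t)"
        by (intro eventually_conj) auto
      then obtain d where d: "d > 0" "\<And>s. dist s t < d \<Longrightarrow> s \<in> I \<and> dist (u s) (u t) < \<eta> \<and>
          dist (u1 s) (u1 t) < \<eta> \<and> dist (v s) (v t) < \<eta> \<and> dist (v1 s) (v1 t) < \<eta>"
        unfolding eventually_nhds_metric by blast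
      have "a \<in> I \<longrightarrow> b \<in> I \<longrightarrow> cmod (W b - W a) \<le> \<epsilon> * \<Phi> a b" if ab: "a \<le> t" "t \<le> b" "b - a < d" for a b
      proof (intro impI)
        assume abI: "a \<in> I" "b \<in> I"
        have near: "cmod (u s - u t) \<le> \<eta>" "cmod (u1 s - u1 t) \<le> \<eta>" "cmod (v s - v t) \<le> \<eta>" "cmod (v1 s - v1 t) \<le> \<eta>"
          if "s \<in> {a..b}" for s
        proof -
          have "dist s t < d" using that ab by (auto simp: dist_real_def)
          from d(2)[OF this] show "cmod (u s - u t) \<le> \<eta>" "cmod (u1 s - u1 t) \<le> \<eta>"
            "cmod (v s - v t) \<le> \<eta>" "cmod (v1 s - v1 t) \<le> \<eta>" by (auto simp: dist_norm)
        qed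
        have hi1: "((\<lambda>s. h s * f s) has_integral (f1 b - f1 a)) {a..b}" if "ode_pair I q z f f1" for f f1
        proof -
          have "(\<lambda>s. h s * f s) absolutely_integrable_on {a..b}" "f1 b - f1 a = integral {a..b} (\<lambda>s. h s * f s)"
            using that abI ab unfolding ode_pair_def AC_loc_deriv_def h_def by auto
          then show ?thesis by (simp add: absolutely_integrable_on_def integrable_integral)
        qed
        have hi2: "(f1 has_integral (f b - f a)) {a..b}" if "ode_pair I q z f f1" for f f1
        proof (rule fundamental_theorem_of_calculus)
          show "a \<le> b" using ab by simp
          show "(f has_vector_derivative f1 s) (at s within {a..b})" if "s \<in> {a..b}" for s
          proof (rule has_vector_derivative_at_within)
            have "s \<in> I" using that sub[OF abI] by blast
            then show "(f has_vector_derivative f1 s) (at s)"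
              using \<open>ode_pair I q z f f1\<close> unfolding ode_pair_def by blast
          qed
        qed
        \<comment> \<open>With endpoint values frozen, the four increments telescope to W b - W a.
          The integrand splits into h times a cross difference of u, v, plus a cross difference of
          u1, v1, both small by continuity.\<close>
        define F where "F = (\<lambda>s. (u b * (h s * v s) - v a * (h s * u s)) + (u1 s * v1 a - u1 b * v1 s))"
        have "(F has_integral (u b * (v1 b - v1 a) - v a * (u1 b - u1 a)) +
            ((u b - u a) * v1 a - u1 b * (v b - v a))) {a..b}"
          unfolding F_def
          by (intro has_integral_add has_integral_diff has_integral_mult_right has_integral_mult_left
              hi1[OF u] hi1[OF v] hi2[OF u] hi2[OF v])
        also have "(u b * (v1 b - v1 a) - v a * (u1 b - u1 a)) + ((u b - u a) * v1 a - u1 b * (v b - v a))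
            = W b - W a"
          by (simp add: W_def algebra_simps)
        finally have F: "(F has_integral (W b - W a)) {a..b}" .
        have F_le: "cmod (F s) \<le> \<epsilon> * (cmod z + 1 + \<bar>q s\<bar>)" if s: "s \<in> {a..b}" for s
        proof -
          have ab': "a \<in> {a..b}" "b \<in> {a..b}" using ab by auto
          have 1: "cmod (u b * v s - v a * u s) \<le> \<epsilon>"
          proof -
            have "cmod (u b * v s - v a * u s) \<le> \<eta> * (2 * cmod (u t) + 2 * cmod (v t) + 2)"
              using near(1)[OF ab'(2)] near(1)[OF s] near(3)[OF s] near(3)[OF ab'(1)] \<eta>(2)
              by (rule norm_cross_diff_le)
            also have "\<dots> \<le> \<eta> * S" unfolding S_def using \<eta> by (intro mult_left_mono) auto
            finally show ?thesis using \<eta>(3) by simp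
          qed
          have 2: "cmod (u1 s * v1 a - v1 s * u1 b) \<le> \<epsilon>"
          proof -
            have "cmod (u1 s * v1 a - v1 s * u1 b) \<le> \<eta> * (2 * cmod (u1 t) + 2 * cmod (v1 t) + 2)"
              using near(2)[OF s] near(2)[OF ab'(2)] near(4)[OF ab'(1)] near(4)[OF s] \<eta>(2)
              by (rule norm_cross_diff_le)
            also have "\<dots> \<le> \<eta> * S" unfolding S_def using \<eta> by (intro mult_left_mono) auto
            finally show ?thesis using \<eta>(3) by simp
          qed
          have "F s = h s * (u b * v s - v a * u s) + (u1 s * v1 a - v1 s * u1 b)"
            by (simp add: F_def algebra_simps)
          then have "cmod (F s) \<le> cmod (h s) * cmod (u b * v s - v a * u s) + cmod (u1 s * v1 a - v1 s * u1 b)"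
            by (metis norm_mult norm_triangle_ineq)
          also have "\<dots> \<le> (\<bar>q s\<bar> + cmod z) * \<epsilon> + \<epsilon>"
            using 1 2 \<epsilon> norm_triangle_ineq4[of "of_real (q s)" z] unfolding h_def
            by (intro add_mono mult_mono) auto
          finally show ?thesis by (simp add: algebra_simps)
        qed
        have hi: "((\<lambda>s. \<epsilon> * (cmod z + 1 + \<bar>q s\<bar>)) has_integral \<epsilon> * \<Phi> a b) {a..b}"
        proof -
          have "((\<lambda>s. cmod z + 1) has_integral (b - a) * (cmod z + 1)) {a..b}"
            using has_integral_const_real[of "cmod z + 1" a b] ab by simp
          then show ?thesis
            unfolding \<Phi>_def by (intro has_integral_mult_right has_integral_add integrable_integral absq abI)
        qed
        have "cmod (integral {a..b} F) \<le> integral {a..b} (\<lambda>s. \<epsilon> * (cmod z + 1 + \<bar>q s\<bar>))"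
          using F hi F_le by (intro integral_norm_bound_integral) blast+
        then show "cmod (W b - W a) \<le> \<epsilon> * \<Phi> a b"
          by (simp only: integral_unique[OF F] integral_unique[OF hi])
      qed
      then show ?case using d(1) by blast
    qed
    then show ?thesis using xy by blast
  qed
  have \<Phi>: "\<Phi> x y \<ge> 0"
    unfolding \<Phi>_def using xy by (intro add_nonneg_nonneg mult_nonneg_nonneg integral_nonneg absq) auto
  have "cmod (W y - W x) \<le> 0 + e" if "e > 0" for e
  proof -
    have "cmod (W y - W x) \<le> e / (\<Phi> x y + 1) * \<Phi> x y" using \<Phi> that by (intro small) simp
    also have "\<dots> \<le> e" using \<Phi> that by (simp add: field_simps)
    finally show ?thesis by simp
  qed
  then have "cmod (W y - W x) \<le> 0" by (rule field_le_epsilon)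
  then show ?thesis by (simp add: W_def)
qed

section \<open>Eigenfunctions and spectra of the restrictions to (a, c)\<close>

lemma einterval_lebesgue: "einterval a b \<in> sets lebesgue"
  using borel_einterval sets_completionI_sets by (metis sets_lborel)

lemma is_interval_einterval: "is_interval (einterval a b)"
  unfolding is_interval_1
proof (intro ballI allI impI)
  fix p r x assume "p \<in> einterval a b" "r \<in> einterval a b" "p \<le> x \<and> x \<le> r"
  then have "a < ereal p" "ereal p \<le> ereal x" "ereal x \<le> ereal r" "ereal r < b"
    by (auto simp: einterval_iff)
  then show "x \<in> einterval a b"
    using less_le_trans le_less_trans unfolding einterval_iff by blast
qed

lemma einterval_mono_right: "b \<le> b' \<Longrightarrow> einterval a b \<subseteq> einterval a b'"
  by (auto simp: einterval_iff)

text \<open>The cut-off point in \<open>L2_near_left\<close> is immaterial for continuous functions: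
  between \<open>d\<close> and \<open>c\<close> they are bounded.\<close>

lemma L2_left_restrict:
  assumes c: "c \<in> einterval a b" and cont: "continuous_on (einterval a b) f" and L2: "L2_near_left a b f"
  shows "f \<in> L2 (einterval a (ereal c))"
proof -
  let ?J = "einterval a (ereal c)"
  obtain d where d: "d \<in> einterval a b" "f \<in> L2 (einterval a (ereal d))"
    using L2 by (auto simp: L2_near_left_def)
  have sub: "?J \<subseteq> einterval a b"
    using c by (intro einterval_mono_right) (auto simp: einterval_iff)
  have sub': "{min d c..c} \<subseteq> einterval a b"
    by (rule is_interval_atLeastAtMost_subset[OF is_interval_einterval]) (use c d in \<open>auto simp: min_def\<close>)
  have "set_integrable lebesgue (einterval a (ereal d)) (\<lambda>x. (cmod (f x))\<^sup>2)"
    using d(2) einterval_lebesgue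
    by (auto simp: L2_def set_integrable_def integrable_restrict_space)
  moreover have "set_integrable lebesgue {min d c..c} (\<lambda>x. (cmod (f x))\<^sup>2)"
    by (intro absolutely_integrable_continuous_real continuous_intros continuous_on_subset[OF cont sub'])
  ultimately have "set_integrable lebesgue (einterval a (ereal d) \<union> {min d c..c}) (\<lambda>x. (cmod (f x))\<^sup>2)"
    by (intro set_integrable_Un einterval_lebesgue) auto
  then have "set_integrable lebesgue ?J (\<lambda>x. (cmod (f x))\<^sup>2)"
    by (rule set_integrable_subset) (auto simp: einterval_lebesgue, auto simp: einterval_iff)
  then show ?thesis
    using einterval_lebesgue continuous_imp_measurable_on_sets_lebesgue[OF continuous_on_subset[OF cont sub]]
    by (auto simp: L2_def set_integrable_def integrable_restrict_space)
qed

lemma L2_cmult: "f \<in> L2 I \<Longrightarrow> (\<lambda>x. z * f x) \<in> L2 I"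
  by (auto simp: L2_def norm_mult power_mult_distrib)

lemma solution_restrict:
  assumes "solution I q z u" "J \<subseteq> I" "I \<in> sets lebesgue" "is_interval I" "J \<in> sets lebesgue" "is_interval J"
  shows "solution J q z u"
  using assms ode_pair_restrict unfolding solution_iff_ode_pair[OF assms(3,4)] solution_iff_ode_pair[OF assms(5,6)]
  by blast

lemma near_left_max_graph:
  assumes c: "c \<in> einterval a b" and f: "solution (einterval a b) q z f"
    and cont: "continuous_on (einterval a b) f" and dom: "near_left_dom a b q v f"
  shows "(f, \<lambda>x. z * f x) \<in> max_graph (einterval a (ereal c)) q"
proof -
  have sub: "einterval a (ereal c) \<subseteq> einterval a b"
    using c by (intro einterval_mono_right) (auto simp: einterval_iff)
  have "solution (einterval a (ereal c)) q z f"
    by (rule solution_restrict[OF f sub]) (auto intro: einterval_lebesgue is_interval_einterval)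
  then have "tau_rel (einterval a (ereal c)) q f (\<lambda>x. z * f x)"
    by (simp add: solution_def)
  moreover have "f \<in> L2 (einterval a (ereal c))"
    by (rule L2_left_restrict[OF c cont]) (use dom in \<open>simp add: near_left_dom_def\<close>)
  ultimately show "(f, \<lambda>x. z * f x) \<in> max_graph (einterval a (ereal c)) q"
    by (simp add: max_graph_def L2_cmult)
qed

text \<open>The resolvent estimate applied to T f - z f = 0 gives norm 0. The set where f is nonzero
  is then negligible, and it is open by continuity, hence empty.\<close>

lemma resolvent_eigenfunction_zero:
  assumes z: "z \<in> resolvent_set I T" and f: "(f, \<lambda>x. z * f x) \<in> T" and L2: "f \<in> L2 I"
    and I: "open I" and cont: "continuous_on I f" and x: "x \<in> I"
  shows "f x = 0"
proof (rule ccontr)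
  assume fx: "f x \<noteq> 0"
  have meas: "I \<in> sets lebesgue" using I by (metis borel_open sets_completionI_sets sets_lborel)
  obtain C where C: "\<forall>(f, h)\<in>T. L2_norm I f \<le> C * L2_norm I (\<lambda>x. h x - z * f x)"
    using z unfolding resolvent_set_def by blast
  from bspec[OF C f] have "L2_norm I f \<le> 0" by (simp add: L2_norm_def)
  moreover have int: "integrable (lebesgue_on I) (\<lambda>x. (cmod (f x))\<^sup>2)" using L2 by (simp add: L2_def)
  moreover have "(LINT x|lebesgue_on I. (cmod (f x))\<^sup>2) \<ge> 0" by simp
  ultimately have "(LINT x|lebesgue_on I. (cmod (f x))\<^sup>2) = 0"
    by (simp add: L2_norm_def)
  then have "AE x in lebesgue_on I. (cmod (f x))\<^sup>2 = 0"
    using integral_nonneg_eq_0_iff_AE[OF int] by simp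
  then have "AE x in lebesgue. x \<in> I \<longrightarrow> f x = 0"
    using meas by (simp add: AE_restrict_space_iff)
  then obtain N where N: "negligible N" "{x. \<not> (x \<in> I \<longrightarrow> f x = 0)} \<subseteq> N"
    unfolding eventually_ae_filter_negligible by blast
  have "open (I \<inter> f -` (- {0}))"
    by (rule continuous_open_preimage[OF cont I]) auto
  moreover have "I \<inter> f -` (- {0}) \<subseteq> N" using N(2) by auto
  then have "negligible (I \<inter> f -` (- {0}))" using N(1) negligible_subset by blast
  moreover have "x \<in> I \<inter> f -` (- {0})" using x fx by simp
  ultimately show False using open_not_negligible by blast
qed

text \<open>An eigenfunction at a resolvent point vanishes on (a, c); as f and f1 are continuous at
  the interior point \<open>c\<close> of (a, b), both limits from the left are 0.\<close>

lemma resolvent_Cauchy_data_zero: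
  assumes c: "c \<in> einterval a b" and f: "ode_pair (einterval a b) q z f f1"
    and dom: "near_left_dom a b q v f"
    and z: "z \<in> resolvent_set (einterval a (ereal c)) T"
    and T: "(f, \<lambda>x. z * f x) \<in> T"
  shows "f c = 0" "f1 c = 0"
proof -
  let ?I = "einterval a b" and ?J = "einterval a (ereal c)"
  have I: "open ?I" "is_interval ?I" by (auto intro: is_interval_einterval)
  have cont: "continuous_on ?I f"
    using ode_pair_isCont[OF f I] by (auto intro: continuous_at_imp_continuous_on)
  have sub: "?J \<subseteq> ?I"
    using c by (intro einterval_mono_right) (auto simp: einterval_iff)
  have zero: "f x = 0" if "x \<in> ?J" for x
    by (rule resolvent_eigenfunction_zero[OF z T _ open_einterval continuous_on_subset[OF cont sub] that])
       (rule L2_left_restrict[OF c cont], use dom in \<open>simp add: near_left_dom_def\<close>)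
  have zero1: "f1 x = 0" if x: "x \<in> ?J" for x
  proof -
    have "(f has_vector_derivative f1 x) (at x)" using f x sub by (auto simp: ode_pair_def)
    moreover have "(f has_vector_derivative 0) (at x)"
      by (rule has_vector_derivative_transform_within_open[OF has_vector_derivative_const open_einterval x])
         (use zero in auto)
    ultimately show ?thesis by (rule vector_derivative_unique_at)
  qed
  have ev: "eventually (\<lambda>x. x \<in> ?J) (at_left c)"
  proof -
    obtain e where "e > 0" "ball c e \<subseteq> ?I" using I(1) c open_contains_ball by blast
    then have "x \<in> ?J" if "x \<in> {c - e<..<c}" for x
    proof -
      have "x \<in> ball c e" using that by (auto simp: dist_real_def)
      then have "x \<in> ?I" using \<open>ball c e \<subseteq> ?I\<close> by blast
      then show ?thesis using that by (auto simp: einterval_iff)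
    qed
    then show ?thesis
      using eventually_at_left_real[of "c - e" c] \<open>e > 0\<close> by (auto elim: eventually_mono)
  qed
  have lim0: "g c = 0" if "isCont g c" "\<And>x. x \<in> ?J \<Longrightarrow> g x = 0" for g :: "real \<Rightarrow> complex"
  proof -
    have "(g \<longlongrightarrow> g c) (at_left c)"
      using that(1) by (simp add: isCont_def filterlim_at_split)
    moreover have "(g \<longlongrightarrow> 0) (at_left c)"
      by (rule tendsto_eventually) (use ev that(2) in \<open>auto elim: eventually_mono\<close>)
    ultimately show ?thesis using tendsto_unique trivial_limit_at_left_real by blast
  qed
  show "f c = 0" "f1 c = 0"
    using ode_pair_isCont[OF f I c] zero zero1 by (auto intro: lim0)
qed

text \<open>If z were in the resolvent set, f, which satisfies the condition at \<open>c\<close>,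
  would have zero Cauchy data there, contradicting the other datum.\<close>

lemma zero_in_spectrum:
  assumes c: "c \<in> einterval a b" and f: "ode_pair (einterval a b) q z f f1"
    and dom: "near_left_dom a b q v f"
  shows "f c = 0 \<Longrightarrow> f1 c \<noteq> 0 \<Longrightarrow> z \<in> spectrum (einterval a (ereal c)) (HD_left a b q v c)"
    and "f1 c = 0 \<Longrightarrow> f c \<noteq> 0 \<Longrightarrow> z \<in> spectrum (einterval a (ereal c)) (HN_left a b q v c)"
proof -
  have I: "open (einterval a b)" "is_interval (einterval a b)" by (auto intro: is_interval_einterval)
  have cont: "continuous_on (einterval a b) f"
    using ode_pair_isCont[OF f I] by (auto intro: continuous_at_imp_continuous_on)
  have sol: "solution (einterval a b) q z f"
    using f solution_iff_ode_pair[OF einterval_lebesgue is_interval_einterval] by blast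
  have graph: "(f, \<lambda>x. z * f x) \<in> max_graph (einterval a (ereal c)) q" "bc_left a b q v f"
    using near_left_max_graph[OF c sol cont dom] dom by (auto simp: near_left_dom_def)
  have lim: "(f \<longlongrightarrow> f c) (at_left c)" "(f1 \<longlongrightarrow> f1 c) (at_left c)"
    using ode_pair_isCont[OF f I c] by (simp_all add: isCont_def filterlim_at_split)
  \<comment> \<open>The Neumann condition is phrased with \<open>vector_derivative\<close>, which
    agrees with \<open>f1\<close> near \<open>c\<close>.\<close>
  have "eventually (\<lambda>x. x \<in> einterval a b) (at_left c)"
    using filter_leD[OF at_le[of "{..<c}" UNIV c] eventually_at_in_open'[OF I(1) c]] by simp
  then have "eventually (\<lambda>x. f1 x = vector_derivative f (at x)) (at_left c)"
    by eventually_elim (use f in \<open>auto simp: ode_pair_def intro!: vector_derivative_at[symmetric]\<close>)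
  then have lim': "((\<lambda>x. vector_derivative f (at x)) \<longlongrightarrow> f1 c) (at_left c)"
    using lim(2) by (rule Lim_transform_eventually[rotated])
  show "z \<in> spectrum (einterval a (ereal c)) (HD_left a b q v c)" if "f c = 0" "f1 c \<noteq> 0"
  proof (rule ccontr)
    assume "\<not> ?thesis"
    then have z: "z \<in> resolvent_set (einterval a (ereal c)) (HD_left a b q v c)"
      by (simp add: spectrum_def)
    have "(f, \<lambda>x. z * f x) \<in> HD_left a b q v c"
      using graph lim(1) that by (simp add: HD_left_def)
    from resolvent_Cauchy_data_zero(2)[OF c f dom z this] show False using that by simp
  qed
  show "z \<in> spectrum (einterval a (ereal c)) (HN_left a b q v c)" if "f1 c = 0" "f c \<noteq> 0"
  proof (rule ccontr)
    assume "\<not> ?thesis"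
    then have z: "z \<in> resolvent_set (einterval a (ereal c)) (HN_left a b q v c)"
      by (simp add: spectrum_def)
    have "(f, \<lambda>x. z * f x) \<in> HN_left a b q v c"
      using graph lim' that by (simp add: HN_left_def)
    from resolvent_Cauchy_data_zero(1)[OF c f dom z this] show False using that by simp
  qed
qed

text \<open>Beyond some radius the limsup bounds ln (ln M(r)) by t ln r; below it compactness gives
  a constant.\<close>

lemma growth_order_less_imp_R_ring:
  assumes f: "f holomorphic_on UNIV" and t: "growth_order f < ereal t" "t > 0"
  shows "f \<in> R_ring t"
proof -
  define M where "M = (\<lambda>r. SUP z\<in>sphere 0 r. cmod (f z))"
  have cont: "continuous_on S (\<lambda>z. cmod (f z))" for S
    by (intro continuous_intros continuous_on_subset[OF holomorphic_on_imp_continuous_on[OF f]]) simp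
  have f_le: "cmod (f z) \<le> M (cmod z)" for z
    unfolding M_def
  proof (rule cSUP_upper)
    show "bdd_above ((\<lambda>z. cmod (f z)) ` sphere 0 (cmod z))"
      by (intro bounded_imp_bdd_above compact_imp_bounded compact_continuous_image cont) auto
  qed auto
  have "eventually (\<lambda>r. ereal (ln (ln (M r)) / ln r) < ereal t) at_top"
    using t(1) unfolding growth_order_def M_def by (rule Limsup_lessD)
  then obtain R0 where R0: "\<And>r. r \<ge> R0 \<Longrightarrow> ln (ln (M r)) / ln r < t"
    unfolding eventually_at_top_linorder by auto
  \<comment> \<open>The 2 keeps ln r positive, so that dividing by it preserves
    inequalities.\<close>
  define R where "R = max R0 2"
  obtain B where B: "\<And>z. cmod z \<le> R \<Longrightarrow> cmod (f z) \<le> B"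
  proof -
    have "bounded ((\<lambda>z. cmod (f z)) ` cball 0 R)"
      by (intro compact_imp_bounded compact_continuous_image cont) auto
    then obtain B where "\<forall>x\<in>(\<lambda>z. cmod (f z)) ` cball 0 R. norm x \<le> B"
      unfolding bounded_iff by blast
    then show ?thesis using that[of B] by auto
  qed
  have B0: "B \<ge> 0" using order_trans[OF norm_ge_zero B[of 0]] by (simp add: R_def)
  have "cmod (f z) \<le> (B + 1) * exp (1 * cmod z powr t)" for z
  proof (cases "cmod z \<le> R")
    case True
    have "cmod (f z) \<le> (B + 1) * 1" using B[OF True] by simp
    also have "\<dots> \<le> (B + 1) * exp (1 * cmod z powr t)" using B0 by (intro mult_left_mono) auto
    finally show ?thesis .
  next
    case False
    define r where "r = cmod z"
    have r: "r > 2" "r \<ge> R0" using False by (auto simp: r_def R_def)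
    have "M r \<le> exp (r powr t)"
    \<comment> \<open>For M r <= 1 the double logarithm carries no usable information, but the bound
      is then trivial.\<close>
    proof (cases "M r \<le> 1")
      case True
      then show ?thesis using order_trans[of "M r" 1 "exp (r powr t)"] by simp
    next
      case False
      then have M: "ln (M r) > 0" "M r > 0" by auto
      have "ln (ln (M r)) < t * ln r" using R0[OF r(2)] r(1) by (simp add: divide_less_eq)
      then have "exp (ln (ln (M r))) < exp (t * ln r)" by simp
      then have "ln (M r) < r powr t" using M r by (simp add: powr_def)
      then have "exp (ln (M r)) < exp (r powr t)" by simp
      then show ?thesis using M by simp
    qed
    then have "cmod (f z) \<le> 1 * exp (1 * cmod z powr t)" using f_le[of z] by (simp add: r_def)
    also have "\<dots> \<le> (B + 1) * exp (1 * cmod z powr t)" using B0 by (intro mult_right_mono) auto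
    finally show ?thesis .
  qed
  then show ?thesis
    unfolding R_ring_def using f B0 by (intro CollectI conjI exI[of _ 1] exI[of _ "B + 1"]) auto
qed

section \<open>The second solution\<close>

text \<open>A bounded increasing sequence would keep the summands away from 0. The divergence is
  needed to compare \<mu>_j^(-r) with (1 + |\<mu>_j|)^(-r).\<close>

lemma strict_mono_filterlim_at_top:
  fixes m :: "nat \<Rightarrow> real"
  assumes mono: "strict_mono m" and summable: "summable (\<lambda>j. 1 / (1 + \<bar>m j\<bar>))"
  shows "filterlim m at_top sequentially"
proof -
  have unbounded: "\<exists>j. m j \<ge> C" for C
  proof (rule ccontr)
    assume "\<not> ?thesis"
    then have less: "m j < C" for j by (simp add: not_le)
    define D where "D = 1 + \<bar>C\<bar> + \<bar>m 0\<bar>"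
    have "\<bar>m j\<bar> \<le> \<bar>C\<bar> + \<bar>m 0\<bar>" for j
      using less[of j] strict_mono_less_eq[OF mono, of 0 j] by simp
    then have ge: "1 / D \<le> 1 / (1 + \<bar>m j\<bar>)" for j
      unfolding D_def by (intro divide_left_mono) (auto simp: add_pos_nonneg)
    have "(\<lambda>j. 1 / (1 + \<bar>m j\<bar>)) \<longlonglongrightarrow> 0" by (rule summable_LIMSEQ_zero[OF summable])
    then have "1 / D \<le> 0" by (rule LIMSEQ_le_const) (use ge in blast)
    moreover have "1 / D > 0" by (simp add: D_def add_pos_nonneg)
    ultimately show False by simp
  qed
  show ?thesis
    unfolding filterlim_at_top eventually_sequentially
  proof
    fix C
    obtain N where "m N \<ge> C" using unbounded by blast
    then show "\<exists>N. \<forall>n\<ge>N. C \<le> m n"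
      using strict_mono_less_eq[OF mono] order_trans by blast
  qed
qed

text \<open>The neighbours of \<mu>_(j+1) are \<nu>_j and \<nu>_(j+1), each at distance at least
  \<mu>_(j+1)^(-r); every other \<mu> or \<nu> lies at or beyond one of them. The shift
  \<open>Suc j\<close> reflects that \<mu> is listed from 1.\<close>

lemma interlacing_separation:
  fixes \<mu> \<nu> :: "nat \<Rightarrow> real"
  assumes \<nu>: "strict_mono \<nu>" and \<mu>: "strict_mono_on {1..} \<mu>" and r: "r > 0"
    and lim: "filterlim (\<lambda>j. \<mu> (Suc j)) at_top sequentially"
    and sep: "eventually (\<lambda>j. \<mu> j - \<nu> (j - 1) \<ge> 1 / \<nu> (j - 1) powr r + 1 / \<mu> j powr r \<and>
            \<nu> j - \<mu> j \<ge> 1 / \<nu> j powr r + 1 / \<mu> j powr r) sequentially"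
  shows "eventually (\<lambda>j. (\<forall>k. k \<noteq> j \<longrightarrow> (1 + \<bar>\<mu> (Suc j)\<bar>) powr (- r) \<le> \<bar>\<mu> (Suc j) - \<mu> (Suc k)\<bar>) \<and>
      (\<forall>k. (1 + \<bar>\<mu> (Suc j)\<bar>) powr (- r) \<le> \<bar>\<mu> (Suc j) - \<nu> k\<bar>)) sequentially"
proof -
  obtain N where N: "\<And>j. j \<ge> N \<Longrightarrow> \<mu> j - \<nu> (j - 1) \<ge> 1 / \<nu> (j - 1) powr r + 1 / \<mu> j powr r \<and>
            \<nu> j - \<mu> j \<ge> 1 / \<nu> j powr r + 1 / \<mu> j powr r"
    using sep by (auto simp: eventually_sequentially)
  have below: "\<nu> (j - 1) + 1 / \<mu> j powr r \<le> \<mu> j" "\<mu> j + 1 / \<mu> j powr r \<le> \<nu> j" if "j \<ge> N" for j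
  proof -
    have "1 / \<nu> (j - 1) powr r \<ge> 0" "1 / \<nu> j powr r \<ge> 0" by simp_all
    then show "\<nu> (j - 1) + 1 / \<mu> j powr r \<le> \<mu> j" "\<mu> j + 1 / \<mu> j powr r \<le> \<nu> j"
      using N[OF that] by linarith+
  qed
  have interlace: "\<nu> (j - 1) \<le> \<mu> j" "\<mu> j \<le> \<nu> j" if "j \<ge> N" for j
    using below[OF that] by (smt (verit) divide_nonneg_nonneg powr_ge_zero)+
  have \<mu>_le: "\<mu> (Suc j) \<le> \<mu> (Suc k)" if "j \<le> k" for j k
    using strict_mono_on_leD[OF \<mu>, of "Suc j" "Suc k"] that by simp
  have \<nu>_le: "\<nu> j \<le> \<nu> k" if "j \<le> k" for j k
    using strict_mono_less_eq[OF \<nu>] that by simp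
  have "eventually (\<lambda>j. \<mu> (Suc j) \<ge> 1) sequentially"
    using lim by (simp add: filterlim_at_top)
  then show ?thesis
    using eventually_ge_at_top[of "Suc N"]
  proof eventually_elim
    case (elim j)
    define e where "e = 1 / \<mu> (Suc j) powr r"
    have le: "(1 + \<bar>\<mu> (Suc j)\<bar>) powr (- r) \<le> e"
    proof -
      have "\<mu> (Suc j) powr r \<le> (1 + \<bar>\<mu> (Suc j)\<bar>) powr r" using elim r by (intro powr_mono2) auto
      then show ?thesis
        unfolding e_def powr_minus_divide using elim by (intro divide_left_mono) auto
    qed
    have up: "\<mu> (Suc j) + e \<le> \<nu> (Suc j)" and down: "\<nu> j + e \<le> \<mu> (Suc j)"
      using below[of "Suc j"] elim by (auto simp: e_def)
    have "e \<le> \<bar>\<mu> (Suc j) - \<mu> (Suc k)\<bar>" if "k \<noteq> j" for k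
    proof (cases "k < j")
      case True
      \<comment> \<open>Here j > 0, so the right side is \<mu>_j; monotonicity of \<mu> is available
        only from index 1 on.\<close>
      have "\<mu> (Suc k) \<le> \<mu> (Suc (j - 1))" using True by (intro \<mu>_le) simp
      also have "\<dots> \<le> \<nu> j" using interlace(2)[of j] True elim by simp
      finally show ?thesis using down by linarith
    next
      case False
      then have "\<mu> (Suc (Suc j)) \<le> \<mu> (Suc k)" using that by (intro \<mu>_le) simp
      moreover have "\<nu> (Suc j) \<le> \<mu> (Suc (Suc j))" using interlace(1)[of "Suc (Suc j)"] elim by simp
      ultimately show ?thesis using up by linarith
    qed
    moreover have "e \<le> \<bar>\<mu> (Suc j) - \<nu> k\<bar>" for k
    proof (cases "k \<le> j")
      case True
      from \<nu>_le[OF this] show ?thesis using down by linarith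
    next
      case False
      then have "\<nu> (Suc j) \<le> \<nu> k" by (intro \<nu>_le) simp
      then show ?thesis using up by linarith
    qed
    ultimately show ?case using le order_trans by blast
  qed
qed

theorem lemma6p10:
  fixes a b :: ereal and c :: real and q :: "real \<Rightarrow> real"
    and v w :: "real \<Rightarrow> complex"
    and \<mu> \<nu> :: "nat \<Rightarrow> real"
    and cs sn :: "complex \<Rightarrow> real \<Rightarrow> complex"
    and \<alpha> \<beta> :: "complex \<Rightarrow> complex"
    and \<phi> :: "complex \<Rightarrow> real \<Rightarrow> complex"
  assumes ab: "a < b" and a_finite: "\<bar>a\<bar> \<noteq> \<infinity>"
    and c: "c \<in> einterval a b"
    and q: "L1_loc (einterval a b) q"
    and bdry_a: "limit_circle_left a b q \<Longrightarrow> boundary_function_left a b q v"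
    and bdry_b: "limit_circle_right a b q \<Longrightarrow> boundary_function_right a b q w"
    and H: "self_adjoint (einterval a b) (H_op a b q v w)"
    and D_discrete: "purely_discrete (einterval a (ereal c)) (HD_left a b q v c)"
    and D_spectrum: "spectrum (einterval a (ereal c)) (HD_left a b q v c)
                       = (\<lambda>j. of_real (\<mu> j)) ` {1..}"
    and D_increasing: "strict_mono_on {1..} \<mu>"
    and D_bounded_below: "bdd_below (\<mu> ` {1..})"
    and N_discrete: "purely_discrete (einterval a (ereal c)) (HN_left a b q v c)"
    and N_spectrum: "spectrum (einterval a (ereal c)) (HN_left a b q v c)
                       = range (\<lambda>j. of_real (\<nu> j))"
    and N_increasing: "strict_mono \<nu>"
    and N_bounded_below: "bdd_below (range \<nu>)"
    and convergence: "\<And>s::real. s > 1/2 \<Longrightarrow> (\<lambda>j. 1 / (1 + \<bar>\<mu> j\<bar> powr s)) summable_on {1..}"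
    and separation: "\<exists>r>0. \<forall>\<^sub>F j in sequentially.
            \<mu> j - \<nu> (j - 1) \<ge> 1 / \<nu> (j - 1) powr r + 1 / \<mu> j powr r \<and>
            \<nu> j - \<mu> j \<ge> 1 / \<nu> j powr r + 1 / \<mu> j powr r"
    and cs: "\<And>z. ivp_solution (einterval a b) q z c 1 0 (cs z)"
    and sn: "\<And>z. ivp_solution (einterval a b) q z c 0 1 (sn z)"
    and \<phi>: "\<phi> = (\<lambda>z x. \<alpha> z * cs z x + \<beta> z * sn z x)"
    and \<phi>_entire: "real_entire \<alpha>" "real_entire \<beta>"
    and \<phi>_order: "growth_order \<alpha> = ereal (1/2)" "growth_order \<beta> = ereal (1/2)"
    and \<phi>_nontrivial: "\<And>z. \<exists>x\<in>einterval a b. \<phi> z x \<noteq> 0"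
    and \<phi>_dom: "\<And>z. near_left_dom a b q v (\<phi> z)"
  shows "\<forall>s::real. s > 1/2 \<longrightarrow>
    (\<exists>\<gamma> \<delta> \<theta>. \<theta> = (\<lambda>z x. \<gamma> z * cs z x + \<delta> z * sn z x) \<and>
       (\<forall>z. solution (einterval a b) q z (\<theta> z)) \<and>
       real_entire \<gamma> \<and> real_entire \<delta> \<and> (\<forall>z. \<not> (\<gamma> z = 0 \<and> \<delta> z = 0)) \<and>
       (\<forall>z. \<forall>x\<in>einterval a b. wronskian (\<theta> z) (\<phi> z) x = 1) \<and>
       (\<forall>z. \<gamma> z * \<beta> z - \<alpha> z * \<delta> z = 1) \<and>
       \<gamma> \<in> R_ring s \<and> \<delta> \<in> R_ring s \<and>
       (\<forall>x\<in>einterval a b. (\<lambda>z. \<theta> z x) \<in> R_ring s))"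
proof (intro allI impI)
  fix s :: real assume s: "s > 1 / 2"
  define I where "I = einterval a b"
  have I: "open I" "is_interval I" "I \<in> sets lebesgue"
    by (auto simp: I_def is_interval_einterval einterval_lebesgue)
  have cI: "c \<in> I" using c by (simp add: I_def)
  have qI: "L1_loc I q" using q by (simp add: I_def)
  have pair: "\<exists>u1. ode_pair I q z u u1 \<and> u c = v0 \<and> u1 c = v1"
    if "ivp_solution (einterval a b) q z c v0 v1 u" for z v0 v1 u
  proof -
    have "solution I q z u" "u c = v0" "(u has_vector_derivative v1) (at c)"
      using that by (auto simp: ivp_solution_def I_def)
    moreover from this obtain u1 where u1: "ode_pair I q z u u1"
      using solution_iff_ode_pair[OF I(3,2)] by blast
    moreover have "(u has_vector_derivative u1 c) (at c)" using u1 cI by (simp add: ode_pair_def)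
    ultimately show ?thesis using vector_derivative_unique_at by blast
  qed
  from pair[OF cs] pair[OF sn] obtain cs1 sn1 where
    cs_pair: "\<And>z. ode_pair I q z (cs z) (cs1 z)" and cs_c: "\<And>z. cs z c = 1" "\<And>z. cs1 z c = 0" and
    sn_pair: "\<And>z. ode_pair I q z (sn z) (sn1 z)" and sn_c: "\<And>z. sn z c = 0" "\<And>z. sn1 z c = 1"
    by metis
  have comb_pair: "ode_pair I q z (\<lambda>x. A * cs z x + B * sn z x) (\<lambda>x. A * cs1 z x + B * sn1 z x)" for z A B
    by (rule ode_pair_lincomb[OF cs_pair sn_pair])
  define \<phi>1 where "\<phi>1 = (\<lambda>z x. \<alpha> z * cs1 z x + \<beta> z * sn1 z x)"
  have \<phi>_pair: "ode_pair (einterval a b) q z (\<phi> z) (\<phi>1 z)" for z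
    using comb_pair[of z "\<alpha> z" "\<beta> z"] by (simp add: \<phi> \<phi>1_def I_def)
  have \<phi>_c: "\<phi> z c = \<alpha> z" "\<phi>1 z c = \<beta> z" for z
    by (simp_all add: \<phi> \<phi>1_def cs_c sn_c)
  \<comment> \<open>A common zero would make \<phi>(z) vanish identically. As \<alpha>(z) and
    \<beta>(z) are the Cauchy data of \<phi>(z) at \<open>c\<close>, this supplies the nonzero datum
    for the spectral argument.\<close>
  have no_common: "\<alpha> z \<noteq> 0 \<or> \<beta> z \<noteq> 0" for z
    using \<phi>_nontrivial[of z] by (auto simp: \<phi>)
  have \<alpha>_zero: "\<exists>j. z = of_real (\<mu> (Suc j))" if "\<alpha> z = 0" for z
  proof -
    have "z \<in> spectrum (einterval a (ereal c)) (HD_left a b q v c)"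
      using zero_in_spectrum(1)[OF c \<phi>_pair \<phi>_dom, of z] \<phi>_c no_common[of z] that by simp
    then obtain j where j: "j \<ge> 1" "z = of_real (\<mu> j)" unfolding D_spectrum by auto
    then show ?thesis by (intro exI[of _ "j - 1"]) simp
  qed
  have \<beta>_zero: "\<exists>k. z = of_real (\<nu> k)" if "\<beta> z = 0" for z
  proof -
    have "z \<in> spectrum (einterval a (ereal c)) (HN_left a b q v c)"
      using zero_in_spectrum(2)[OF c \<phi>_pair \<phi>_dom, of z] \<phi>_c no_common[of z] that by simp
    then show ?thesis unfolding N_spectrum by auto
  qed
  have summable: "summable (\<lambda>j. 1 / (1 + \<bar>\<mu> (Suc j)\<bar> powr s'))" if "s' > 1 / 2" for s'
  proof -
    have bij: "bij_betw Suc UNIV {1..}"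
      by (rule bij_betwI[of _ _ _ "\<lambda>n. n - 1"]) auto
    have "(\<lambda>j. 1 / (1 + \<bar>\<mu> (Suc j)\<bar> powr s')) summable_on UNIV"
      using convergence[OF that] summable_on_reindex_bij_betw[OF bij, of "\<lambda>j. 1 / (1 + \<bar>\<mu> j\<bar> powr s')"] by simp
    then show ?thesis by (simp add: summable_on_UNIV_nonneg_real_iff add_nonneg_nonneg)
  qed
  have mono: "strict_mono (\<lambda>j. \<mu> (Suc j))"
    using D_increasing by (auto simp: strict_mono_def strict_mono_on_def)
  obtain r where r: "r > 0" and sep: "\<forall>\<^sub>F j in sequentially.
            \<mu> j - \<nu> (j - 1) \<ge> 1 / \<nu> (j - 1) powr r + 1 / \<mu> j powr r \<and>
            \<nu> j - \<mu> j \<ge> 1 / \<nu> j powr r + 1 / \<mu> j powr r"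
    using separation by blast
  have lim: "filterlim (\<lambda>j. \<mu> (Suc j)) at_top sequentially"
    using strict_mono_filterlim_at_top[OF mono] summable[of 1] by simp
  \<comment> \<open>Order 1/2 places \<alpha> and \<beta> in \<open>R_ring t\<close> only for t >
    1/2, and t < s leaves the room that the minimum modulus estimate consumes.\<close>
  define t where "t = (1 / 2 + s) / 2"
  have t: "1 / 2 < t" "t < s" using s by (auto simp: t_def)
  have R: "\<alpha> \<in> R_ring t" "\<beta> \<in> R_ring t"
    using \<phi>_entire \<phi>_order t by (auto simp: real_entire_def intro!: growth_order_less_imp_R_ring)
  obtain \<gamma>0 \<delta>0 where "\<gamma>0 \<in> R_ring s" "\<delta>0 \<in> R_ring s" "\<And>z. \<gamma>0 z * \<beta> z - \<alpha> z * \<delta>0 z = 1"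
  proof (rule corona_of_separated_zeros[OF R _ t(2) less_imp_le[OF r] \<alpha>_zero _ _ mono _ summable[OF s]])
    show "0 \<le> t" using t by simp
    show "\<beta> \<i> \<noteq> 0" using \<beta>_zero[of \<i>] by (auto simp: complex_eq_iff)
    show "\<beta> z \<noteq> 0" if "\<alpha> z = 0" for z using no_common[of z] that by simp
    show "\<forall>\<^sub>F j in sequentially.
        (\<forall>k. k \<noteq> j \<longrightarrow> (1 + \<bar>\<mu> (Suc j)\<bar>) powr - r \<le> \<bar>\<mu> (Suc j) - \<mu> (Suc k)\<bar>) \<and>
        (\<forall>z. \<beta> z = 0 \<longrightarrow> (1 + \<bar>\<mu> (Suc j)\<bar>) powr - r \<le> cmod (of_real (\<mu> (Suc j)) - z))"
      using interlacing_separation[OF N_increasing D_increasing r lim sep]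
    proof eventually_elim
      case (elim j)
      then show ?case
        using \<beta>_zero by (metis norm_of_real of_real_diff)
    qed
  qed (assumption, rule that)
  then obtain \<gamma> \<delta> where \<gamma>\<delta>: "\<gamma> \<in> R_ring s" "\<delta> \<in> R_ring s" "real_entire \<gamma>" "real_entire \<delta>"
    and bezout: "\<And>z. \<gamma> z * \<beta> z - \<alpha> z * \<delta> z = 1"
    using bezout_real_entire[OF _ _ _ \<phi>_entire, of \<gamma>0 s \<delta>0] by metis
  define \<theta> where "\<theta> = (\<lambda>z x. \<gamma> z * cs z x + \<delta> z * sn z x)"
  have sol: "solution (einterval a b) q z (\<theta> z)" for z
    unfolding \<theta>_def using comb_pair solution_iff_ode_pair[OF I(3,2)] unfolding I_def by blast
  have W: "wronskian (\<theta> z) (\<phi> z) x = 1" if x: "x \<in> einterval a b" for z x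
  proof -
    have xI: "x \<in> I" using x by (simp add: I_def)
    define \<theta>1 where "\<theta>1 = (\<lambda>x. \<gamma> z * cs1 z x + \<delta> z * sn1 z x)"
    have "vector_derivative (\<theta> z) (at x) = \<theta>1 x"
      using comb_pair[of z "\<gamma> z" "\<delta> z"] xI
      by (auto simp: ode_pair_def \<theta>_def \<theta>1_def intro!: vector_derivative_at)
    moreover have "vector_derivative (\<phi> z) (at x) = \<phi>1 z x"
      using \<phi>_pair[of z] x by (auto simp: ode_pair_def intro!: vector_derivative_at)
    moreover have "cs z x * sn1 z x - cs1 z x * sn z x = 1"
    proof -
      have "cs z x * sn1 z x - cs1 z x * sn z x = cs z c * sn1 z c - cs1 z c * sn z c"
        using ode_pair_wronskian_const[OF I(1,2) qI cs_pair sn_pair] xI cI by (metis linear)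
      then show ?thesis by (simp add: cs_c sn_c)
    qed
    \<comment> \<open>The Wronskian of two combinations is the coefficient determinant times the
      Wronskian of \<open>cs\<close> and \<open>sn\<close>, which is constantly 1.\<close>
    moreover have "\<theta> z x * \<phi>1 z x - \<theta>1 x * \<phi> z x =
        (\<gamma> z * \<beta> z - \<alpha> z * \<delta> z) * (cs z x * sn1 z x - cs1 z x * sn z x)"
      by (simp add: \<theta>_def \<theta>1_def \<phi> \<phi>1_def algebra_simps)
    ultimately show ?thesis by (simp add: wronskian_def bezout)
  qed
  have "(\<lambda>z. \<theta> z x) \<in> R_ring s" if "x \<in> einterval a b" for x
  proof -
    have xI: "x \<in> I" using that by (simp add: I_def)
    have "(\<lambda>z. cs z x) \<in> R_ring s"
      by (rule ivp_family[OF I(2) cI xI qI cs_pair cs_c]) (use s in simp)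
    moreover have "(\<lambda>z. sn z x) \<in> R_ring s"
      by (rule ivp_family[OF I(2) cI xI qI sn_pair sn_c]) (use s in simp)
    ultimately show ?thesis
      unfolding \<theta>_def using \<gamma>\<delta> by (intro R_ring_add R_ring_mult)
  qed
  moreover have "\<not> (\<gamma> z = 0 \<and> \<delta> z = 0)" for z
    using bezout[of z] by auto
  ultimately show "\<exists>\<gamma> \<delta> \<theta>. \<theta> = (\<lambda>z x. \<gamma> z * cs z x + \<delta> z * sn z x) \<and>
       (\<forall>z. solution (einterval a b) q z (\<theta> z)) \<and>
       real_entire \<gamma> \<and> real_entire \<delta> \<and> (\<forall>z. \<not> (\<gamma> z = 0 \<and> \<delta> z = 0)) \<and>
       (\<forall>z. \<forall>x\<in>einterval a b. wronskian (\<theta> z) (\<phi> z) x = 1) \<and>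
       (\<forall>z. \<gamma> z * \<beta> z - \<alpha> z * \<delta> z = 1) \<and>
       \<gamma> \<in> R_ring s \<and> \<delta> \<in> R_ring s \<and>
       (\<forall>x\<in>einterval a b. (\<lambda>z. \<theta> z x) \<in> R_ring s)"
    using \<gamma>\<delta> bezout sol W
    by (intro exI[of _ \<gamma>] exI[of _ \<delta>] exI[of _ \<theta>] conjI allI ballI) (auto simp: \<theta>_def)
qed

end
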